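(* Let $k$ be a number field and let $K_1/k, \dots, K_r/k$ (with $r \geq 2$) be finite normal extensions, all contained in a fixed algebraic closure $\overline{\mathbb{Q}}$, such that $K_i \cap K_j = k$ for all $i \neq j$. Write $K = K_1K_2\cdots K_r$ and $L = K_r \prod_{i=1}^{r-1} K_i^{\mathrm{ab}}$. Then the Galois group $\Gal(K_r^{\mathrm{ab}} \cap L / K_r k^{\mathrm{ab}})$ is annihilated by \[ e\big(\Gal(K k^{\mathrm{ab}}/K_r k^{\mathrm{ab}})\big) \cdot \operatorname{lcm}_{i \neq j}\{[K:K_i]\,[K_j:k]\}. \]
   Context: All number fields are subfields of a fixed algebraic closure $\overline{\mathbb{Q}}$. For a number field $M$, $M^{\mathrm{ab}} \subset \overline{\mathbb{Q}}$ denotes its maximal abelian extension. A positive integer $n$ annihilates a profinite group $G$ if $g^n = 1$ for all $g \in G$. For a profinite group $G$ of finite exponent, $e(G)$ denotes its exponent (the least positive integer annihilating $G$). The lcm is over ordered pairs $(i,j)$ with $1 \le i,j \le r$, $i \neq j$. *)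

theory Defs
  imports "HOL-Algebra.Algebra"
begin

text \<open>
  An algebraic closure of the rationals: a field \<open>\<Omega>\<close> of characteristic zero that is an algebraic
  closure of its prime field, \<open>generate_field \<Omega> {}\<close>, which is then the copy of the rationals
  inside \<open>\<Omega>\<close>.
\<close>

locale rational_closure = algebraic_closure \<Omega> "generate_field \<Omega> {}" for \<Omega> (structure) +
  assumes char_zero: "0 < (n :: nat) \<Longrightarrow> add_pow \<Omega> n \<one> \<noteq> \<zero>"

definition number_field :: "('a, 'b) ring_scheme \<Rightarrow> 'a set \<Rightarrow> bool"
  where "number_field \<Omega> k \<longleftrightarrow>
    subfield k \<Omega> \<and> (ring.finite_dimension \<Omega> over (generate_field \<Omega> {})) k"

text \<open>
  In \<open>normal_extension \<Omega> F E\<close> the base field \<open>F\<close> comes first, as in the library's \<open>dim\<close>. Splitting is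
  splitting over \<open>E\<close>, hence the \<open>splitted\<close> of the restricted ring; the library's \<open>splitted_on\<close>
  intersects with \<open>mset_set E\<close>, which is empty for infinite \<open>E\<close>.
\<close>

definition normal_extension :: "('a, 'b) ring_scheme \<Rightarrow> 'a set \<Rightarrow> 'a set \<Rightarrow> bool"
  where "normal_extension \<Omega> F E \<longleftrightarrow>
    subfield F \<Omega> \<and> subfield E \<Omega> \<and> F \<subseteq> E \<and>
    (\<forall>x\<in>E. (ring.algebraic \<Omega> over F) x) \<and>
    (\<forall>p\<in>carrier (F[X]\<^bsub>\<Omega>\<^esub>). pirreducible\<^bsub>\<Omega>\<^esub> F p \<and> (\<exists>x\<in>E. ring.eval \<Omega> p x = \<zero>\<^bsub>\<Omega>\<^esub>)
       \<longrightarrow> ring.splitted (\<Omega>\<lparr>carrier := E\<rparr>) p)"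

definition Galois_group :: "('a, 'b) ring_scheme \<Rightarrow> 'a set \<Rightarrow> 'a set \<Rightarrow> ('a \<Rightarrow> 'a) monoid"
  where "Galois_group \<Omega> F E = BijGroup E
    \<lparr>carrier := {\<sigma> \<in> Bij E. \<sigma> \<in> ring_hom (\<Omega>\<lparr>carrier := E\<rparr>) (\<Omega>\<lparr>carrier := E\<rparr>) \<and> (\<forall>x\<in>F. \<sigma> x = x)}\<rparr>"

text \<open>Separability is automatic, since these notions are only used in characteristic zero.\<close>

definition abelian_extension :: "('a, 'b) ring_scheme \<Rightarrow> 'a set \<Rightarrow> 'a set \<Rightarrow> bool"
  where "abelian_extension \<Omega> F E \<longleftrightarrow>
    normal_extension \<Omega> F E \<and> comm_group (Galois_group \<Omega> F E)"

text \<open>\<open>M\<^sup>a\<^sup>b\<close>: the compositum, inside \<open>\<Omega>\<close>, of all (finite or infinite) abelian extensions of \<open>M\<close>.\<close>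

definition max_abelian_extension :: "('a, 'b) ring_scheme \<Rightarrow> 'a set \<Rightarrow> 'a set"
  where "max_abelian_extension \<Omega> M = generate_field \<Omega> (\<Union>{E. abelian_extension \<Omega> M E})"

definition annihilates :: "nat \<Rightarrow> ('g, 'm) monoid_scheme \<Rightarrow> bool"
  where "annihilates n G \<longleftrightarrow> 0 < n \<and> (\<forall>g\<in>carrier G. g [^]\<^bsub>G\<^esub> n = \<one>\<^bsub>G\<^esub>)"

definition group_exponent :: "('g, 'm) monoid_scheme \<Rightarrow> nat"
  where "group_exponent G = (LEAST n. annihilates n G)"

end

theory Submission
  imports Defs
begin

text \<open>
  Let \<open>N\<^sub>i\<close> and \<open>N\<close> be the groups of automorphisms of \<open>\<Omega>\<close> over \<open>K\<^sub>i\<close> and over \<open>KK\<close>. An element of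
  \<open>Gal(K\<^sub>r\<^sup>a\<^sup>b \<inter> L / K\<^sub>r k\<^sup>a\<^sup>b)\<close> lifts to an automorphism of \<open>\<Omega>\<close>, and a suitable power \<open>h\<close> of the lift,
  with exponent \<open>e\<close>, is trivial on \<open>KK k\<^sup>a\<^sup>b\<close>. Let \<open>P\<close> be the product of the conjugates
  \<open>t\<^sup>-\<^sup>1 h t\<close>, where \<open>t\<close> runs through representatives of \<open>N\<^sub>r / N\<close>. On \<open>K\<^sub>r\<^sup>a\<^sup>b\<close> the elements of \<open>N\<^sub>r\<close>
  commute, so \<open>P\<close> acts as the power of \<open>h\<close> with exponent \<open>[KK : K\<^sub>r]\<close>. On \<open>K\<^sub>i\<^sup>a\<^sup>b\<close> with \<open>i < r\<close>,
  a conjugate depends only on the class of \<open>t\<close> modulo \<open>N\<^sub>i\<close>; since \<open>K\<^sub>i \<inter> K\<^sub>r = k\<close>, these classes fill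
  \<open>Gal(K\<^sub>i/k)\<close> evenly, so \<open>P\<close> is there a power of the transfer of \<open>h\<close> into \<open>Gal(K\<^sub>i\<^sup>a\<^sup>b/K\<^sub>i)\<close>. The transfer
  is a homomorphism to an abelian group, hence trivial on \<open>h\<close>, which fixes \<open>k\<^sup>a\<^sup>b\<close>. So \<open>P\<close> is trivial
  on \<open>L\<close>, and already \<open>e \<cdot> [KK : K\<^sub>r]\<close> annihilates.
\<close>

section \<open>Galois groups\<close>

text \<open>The delicate point is the vanishing of the transfer. An automorphism that fixes
  \<open>k\<^sup>a\<^sup>b\<close> is only known to lie in the closure of the commutator subgroup,
  so mapping to an abelian group does not suffice: continuity of the transfer is needed too. No
  topology is set up. Instead, for one element \<open>y\<close> at a time, the automorphisms whose
  transfer fixes \<open>y\<close> form a subgroup that contains the commutators and the stabilizer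
  of a finite set; such a subgroup contains every automorphism that fixes all of its fixed points.
  Two encodings keep this elementary. Cosets of \<open>Aut M\<close> in \<open>Aut k\<close> are
  points in the orbit of a primitive element, so representatives, indices and degrees are all read
  off orbits. And \<open>k\<^sup>a\<^sup>b\<close> is the set of elements at which any two
  automorphisms over \<open>k\<close> commute, so infinite abelian extensions enter only through
  pointwise identities.\<close>

lemma Galois_group_carrier:
  "f \<in> carrier (Galois_group \<Omega> F E) \<longleftrightarrow>
     f \<in> Bij E \<and> f \<in> ring_hom (\<Omega>\<lparr>carrier := E\<rparr>) (\<Omega>\<lparr>carrier := E\<rparr>) \<and> (\<forall>x\<in>F. f x = x)"
  by (simp add: Galois_group_def)

lemma Galois_group_mult:
  assumes "f \<in> carrier (Galois_group \<Omega> F E)" "g \<in> carrier (Galois_group \<Omega> F E)"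
  shows "f \<otimes>\<^bsub>Galois_group \<Omega> F E\<^esub> g = compose E f g"
  using assms by (simp add: Galois_group_def BijGroup_def)

lemma Galois_group_one: "\<one>\<^bsub>Galois_group \<Omega> F E\<^esub> = (\<lambda>x\<in>E. x)"
  by (simp add: Galois_group_def BijGroup_def)

lemma (in ring) group_Galois_group:
  assumes E: "subring E R" and FE: "F \<subseteq> E"
  shows "group (Galois_group R F E)"
proof -
  let ?S = "{f \<in> Bij E. f \<in> ring_hom (R\<lparr>carrier := E\<rparr>) (R\<lparr>carrier := E\<rparr>) \<and> (\<forall>x\<in>F. f x = x)}"
  note Esub = subringE[OF E]
  interpret B: group "BijGroup E" by (rule group_BijGroup)
  have "subgroup ?S (BijGroup E)"
  proof (rule B.subgroupI)
    show "?S \<subseteq> carrier (BijGroup E)" by (auto simp: BijGroup_def)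
    have "(\<lambda>x\<in>E. x) \<in> ?S"
      using FE Esub by (auto simp: id_Bij intro!: ring_hom_memI)
    then show "?S \<noteq> {}" by blast
  next
    fix a assume a: "a \<in> ?S"
    then have aB: "a \<in> Bij E" and ah: "a \<in> ring_hom (R\<lparr>carrier := E\<rparr>) (R\<lparr>carrier := E\<rparr>)"
      and af: "\<And>x. x \<in> F \<Longrightarrow> a x = x" by auto
    have bij: "bij_betw a E E" using aB by (simp add: Bij_def)
    define b where "b = (\<lambda>x\<in>E. inv_into E a x)"
    have bB: "b \<in> Bij E" unfolding b_def by (rule restrict_inv_into_Bij[OF aB])
    have inv: "inv\<^bsub>BijGroup E\<^esub> a = b"
      unfolding b_def using aB by (rule inv_BijGroup)
    have ba: "b (a x) = x" if "x \<in> E" for x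
      using that bij by (simp add: b_def bij_betw_inv_into_left bij_betwE)
    have ab: "a (b x) = x" if "x \<in> E" for x
      using that bij by (simp add: b_def bij_betw_inv_into_right)
    have bE: "b x \<in> E" if "x \<in> E" for x
      using that Bij_imp_funcset[OF bB] by auto
    note ahE = ring_hom_memE[OF ah, simplified]
    have "b \<in> ring_hom (R\<lparr>carrier := E\<rparr>) (R\<lparr>carrier := E\<rparr>)"
    proof (rule ring_hom_memI; simp)
      fix x y assume xy: "x \<in> E" "y \<in> E"
      have "x \<otimes> y = a (b x \<otimes> b y)" using ahE(2)[of "b x" "b y"] xy bE ab by simp
      then show "b (x \<otimes> y) = b x \<otimes> b y" using ba[of "b x \<otimes> b y"] bE xy Esub(6) by simp
      have "x \<oplus> y = a (b x \<oplus> b y)" using ahE(3)[of "b x" "b y"] xy bE ab by simp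
      then show "b (x \<oplus> y) = b x \<oplus> b y" using ba[of "b x \<oplus> b y"] bE xy Esub(7) by simp
    next
      show "b \<one> = \<one>" using ahE(4) ba[OF Esub(3)] by simp
    qed (rule bE)
    moreover have "b x = x" if "x \<in> F" for x using that FE af ba[of x] by auto
    ultimately show "inv\<^bsub>BijGroup E\<^esub> a \<in> ?S" using bB by (simp add: inv)
  next
    fix a b assume a: "a \<in> ?S" and b: "b \<in> ?S"
    have "a \<otimes>\<^bsub>BijGroup E\<^esub> b = compose E a b" using a b by (simp add: BijGroup_def)
    moreover have "compose E a b \<in> ring_hom (R\<lparr>carrier := E\<rparr>) (R\<lparr>carrier := E\<rparr>)"
    proof -
      have "a \<in> ring_hom (R\<lparr>carrier := E\<rparr>) (R\<lparr>carrier := E\<rparr>)"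
        "b \<in> ring_hom (R\<lparr>carrier := E\<rparr>) (R\<lparr>carrier := E\<rparr>)" using a b by auto
      note H = this[THEN ring_hom_memE(1), simplified] this[THEN ring_hom_memE(2), simplified]
        this[THEN ring_hom_memE(3), simplified] this[THEN ring_hom_memE(4), simplified]
      show ?thesis by (rule ring_hom_memI) (simp_all add: compose_def H Esub)
    qed
    moreover have "compose E a b x = x" if "x \<in> F" for x
      using that a b FE by (auto simp: compose_def)
    ultimately show "a \<otimes>\<^bsub>BijGroup E\<^esub> b \<in> ?S"
      using a b by (simp add: compose_Bij)
  qed
  from subgroup.subgroup_is_group[OF this B.group_axioms]
  show ?thesis by (simp add: Galois_group_def)
qed

text \<open>Powers of one automorphism are compared below in several groups, acting on different
  fields; iterates of the map are their common form.\<close>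

lemma (in ring) Galois_group_pow:
  assumes E: "subring E R" and FE: "F \<subseteq> E"
    and f: "f \<in> carrier (Galois_group R F E)" and x: "x \<in> E"
  shows "(f [^]\<^bsub>Galois_group R F E\<^esub> (n :: nat)) x = (f ^^ n) x"
  using x
proof (induction n arbitrary: x)
  case 0
  then show ?case by (simp add: Galois_group_one)
next
  case (Suc n)
  interpret G: group "Galois_group R F E" by (rule group_Galois_group[OF E FE])
  have "f x \<in> E" using f Suc.prems by (auto simp: Galois_group_carrier dest: Bij_imp_funcset)
  then show ?case
    using Suc f by (simp add: Galois_group_mult compose_def funpow_swap1)
qed

section \<open>Extension of embeddings\<close>

lemma (in field) eval_map_ring_hom:
  assumes E: "subfield E R" and h: "h \<in> ring_hom (R\<lparr>carrier := E\<rparr>) R" and y: "y \<in> carrier R"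
  shows "(\<lambda>p. eval (map h p) y) \<in> ring_hom (E[X]) R"
proof -
  note sub = subfieldE(1)[OF E]
  interpret H: ring_hom_ring "R\<lparr>carrier := E\<rparr>" R h
    using ring_hom_ringI2[OF subring_is_ring[OF sub] ring_axioms h] .
  have set_map: "set (map h p) \<subseteq> carrier R" if "set p \<subseteq> E" for p
    using that H.hom_closed by auto
  have inE: "set p \<subseteq> E" if "p \<in> carrier (E[X])" for p
    using that polynomial_incl unfolding sym[OF univ_poly_carrier] by auto
  show ?thesis
  proof (rule ring_hom_memI)
    fix p assume "p \<in> carrier (E[X])"
    then show "eval (map h p) y \<in> carrier R" using eval_in_carrier[OF set_map[OF inE] y] by simp
  next
    fix p q assume p: "p \<in> carrier (E[X])" and q: "q \<in> carrier (E[X])"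
    note c = set_map[OF inE[OF p]] set_map[OF inE[OF q]]
    have "set (poly_mult p q) \<subseteq> E" "set (poly_add p q) \<subseteq> E"
      using poly_mult_is_polynomial[OF sub inE[OF p] inE[OF q]] polynomial_incl
        poly_add_is_polynomial[OF sub inE[OF p] inE[OF q]] by auto
    \<comment> \<open>Mapping \<open>h\<close> over a product agrees with the product of the mapped
      lists after leading zeros are removed; \<open>eval\<close> does not see them.\<close>
    then have "eval (map h (poly_mult p q)) y = eval (normalize (map h (poly_mult p q))) y"
      "eval (map h (poly_add p q)) y = eval (normalize (map h (poly_add p q))) y"
      using eval_normalize[OF set_map y] by auto
    moreover have "normalize (map h (poly_mult p q)) = poly_mult (map h p) (map h q)"
      "normalize (map h (poly_add p q)) = poly_add (map h p) (map h q)"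
      using H.poly_mult_hom'[of p q] H.poly_add_hom'[of p q] inE[OF p] inE[OF q]
      unfolding poly_mult_consistent[OF sub] poly_add_consistent[OF sub] by auto
    ultimately show "eval (map h (p \<otimes>\<^bsub>E[X]\<^esub> q)) y = eval (map h p) y \<otimes> eval (map h q) y"
      and "eval (map h (p \<oplus>\<^bsub>E[X]\<^esub> q)) y = eval (map h p) y \<oplus> eval (map h q) y"
      unfolding univ_poly_mult univ_poly_add using eval_poly_mult[OF c y] eval_poly_add[OF c y]
      by simp_all
  next
    show "eval (map h \<one>\<^bsub>E[X]\<^esub>) y = \<one>"
      using ring_hom_memE(4)[OF h] y by (simp add: univ_poly_one)
  qed
qed

text \<open>Evaluation at \<open>x\<close> maps E[X] onto \<open>simple_extension E x\<close>, with
  kernel generated by the minimal polynomial. Applying \<open>h\<close> to the coefficients and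
  evaluating at \<open>y\<close> kills that polynomial, so it factors through the quotient.\<close>

lemma (in field) extend_hom_simple_extension:
  assumes E: "subfield E R" and h: "h \<in> ring_hom (R\<lparr>carrier := E\<rparr>) R"
    and x: "x \<in> carrier R" "(algebraic over E) x"
    and y: "y \<in> carrier R" "eval (map h (Irr E x)) y = \<zero>"
  obtains h' where "h' \<in> ring_hom (R\<lparr>carrier := simple_extension E x\<rparr>) R"
    "\<And>a. a \<in> E \<Longrightarrow> h' a = h a" "h' x = y"
proof -
  note sub = subfieldE(1)[OF E]
  interpret UP: domain "E[X]" using univ_poly_is_domain[OF sub] .
  define \<phi> where "\<phi> p = eval (map h p) y" for p
  interpret \<phi>: ring_hom_ring "E[X]" R \<phi>
    using ring_hom_ringI2[OF UP.ring_axioms ring_axioms] eval_map_ring_hom[OF E h y(1)]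
    unfolding \<phi>_def by blast
  interpret ev: ring_hom_ring "E[X]" R "\<lambda>p. eval p x"
    using eval_ring_hom[OF sub x(1)] .
  have \<phi>_eq: "\<phi> p = \<phi> q" if p: "p \<in> carrier (E[X])" and q: "q \<in> carrier (E[X])" and eq: "eval p x = eval q x" for p q
  proof -
    have d: "p \<ominus>\<^bsub>E[X]\<^esub> q \<in> carrier (E[X])" using p q by simp
    have "eval (p \<ominus>\<^bsub>E[X]\<^esub> q) x = \<zero>"
      using p q eq by (simp add: a_minus_def r_neg)
    then have "Irr E x divides\<^bsub>E[X]\<^esub> (p \<ominus>\<^bsub>E[X]\<^esub> q)"
      using Irr_minimal[OF E x d] pdivides_iff_shell[OF E IrrE(1)[OF E x] d] by simp
    then obtain r where r: "r \<in> carrier (E[X])" "p \<ominus>\<^bsub>E[X]\<^esub> q = Irr E x \<otimes>\<^bsub>E[X]\<^esub> r"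
      by (auto simp: factor_def)
    have "\<phi> (p \<ominus>\<^bsub>E[X]\<^esub> q) = \<phi> (Irr E x) \<otimes> \<phi> r"
      using r IrrE(1)[OF E x] by simp
    then have "\<phi> (p \<ominus>\<^bsub>E[X]\<^esub> q) = \<zero>" using y(2) r by (simp add: \<phi>_def[of "Irr E x"])
    then have "\<phi> p \<ominus> \<phi> q = \<zero>" using p q by (simp add: a_minus_def)
    then show ?thesis using p q by (simp add: r_right_minus_eq)
  qed
  \<comment> \<open>An arbitrary polynomial with value \<open>z\<close>; \<open>\<phi>_eq\<close>
    makes the choice immaterial.\<close>
  define c where "c z = (SOME p. p \<in> carrier (E[X]) \<and> eval p x = z)" for z
  define h' where "h' z = \<phi> (c z)" for z
  have h'_eval: "h' (eval p x) = \<phi> p" if p: "p \<in> carrier (E[X])" for p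
  proof -
    have "c (eval p x) \<in> carrier (E[X]) \<and> eval (c (eval p x)) x = eval p x"
      unfolding c_def by (rule someI[of _ p]) (use p in simp)
    then show ?thesis unfolding h'_def using \<phi>_eq p by blast
  qed
  note img = simple_extension_as_eval_img[OF subfieldE(3)[OF E] x(1)]
  have "h' \<in> ring_hom (R\<lparr>carrier := simple_extension E x\<rparr>) R"
  proof (rule ring_hom_memI)
    fix a assume "a \<in> carrier (R\<lparr>carrier := simple_extension E x\<rparr>)"
    then obtain p where p: "p \<in> carrier (E[X])" "a = eval p x" unfolding img by auto
    then show "h' a \<in> carrier R" using h'_eval by simp
    fix b assume "b \<in> carrier (R\<lparr>carrier := simple_extension E x\<rparr>)"
    then obtain q where q: "q \<in> carrier (E[X])" "b = eval q x" unfolding img by auto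
    have "a \<otimes> b = eval (p \<otimes>\<^bsub>E[X]\<^esub> q) x" "a \<oplus> b = eval (p \<oplus>\<^bsub>E[X]\<^esub> q) x"
      using p q by simp_all
    then show "h' (a \<otimes>\<^bsub>R\<lparr>carrier := simple_extension E x\<rparr>\<^esub> b) = h' a \<otimes> h' b"
      "h' (a \<oplus>\<^bsub>R\<lparr>carrier := simple_extension E x\<rparr>\<^esub> b) = h' a \<oplus> h' b"
      using p q by (simp_all add: h'_eval del: ev.hom_mult ev.hom_add)
  next
    show "h' \<one>\<^bsub>R\<lparr>carrier := simple_extension E x\<rparr>\<^esub> = \<one>"
      using h'_eval[of "\<one>\<^bsub>E[X]\<^esub>"] by simp
  qed
  moreover have "h' a = h a" if a: "a \<in> E" for a
  \<comment> \<open>Leading coefficients are nonzero, so the zero polynomial is the empty list and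
    not \<open>[a]\<close>.\<close>
  proof (cases "a = \<zero>")
    case True
    interpret H: ring_hom_ring "R\<lparr>carrier := E\<rparr>" R h
      using ring_hom_ringI2[OF subring_is_ring[OF sub] ring_axioms h] .
    show ?thesis using h'_eval[of "\<zero>\<^bsub>E[X]\<^esub>"] H.hom_zero True by simp
  next
    case False
    then have p: "[a] \<in> carrier (E[X])"
      using a unfolding sym[OF univ_poly_carrier] polynomial_def by auto
    have "eval [a] x = a" "\<phi> [a] = h a"
      using a x y subfieldE(3)[OF E] ring_hom_memE(1)[OF h] by (auto simp: \<phi>_def)
    then show ?thesis using h'_eval[OF p] by simp
  qed
  moreover have "h' x = y"
  proof -
    interpret H: ring_hom_ring "R\<lparr>carrier := E\<rparr>" R h
      using ring_hom_ringI2[OF subring_is_ring[OF sub] ring_axioms h] .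
    have "\<phi> X = y" using H.hom_zero H.hom_one y(1) by (simp add: \<phi>_def var_def)
    then show ?thesis using h'_eval[OF var_closed(1)[OF sub]] eval_var[OF x(1)] by simp
  qed
  ultimately show thesis by (rule that)
qed

lemma (in field) hom_subfield_inj:
  assumes E: "subfield E R" and h: "h \<in> ring_hom (R\<lparr>carrier := E\<rparr>) R"
  shows "inj_on h E"
proof -
  interpret H: ring_hom_ring "R\<lparr>carrier := E\<rparr>" R h
    using ring_hom_ringI2[OF subring_is_ring[OF subfieldE(1)[OF E]] ring_axioms h] .
  show ?thesis
    using H.img_is_subfield(1)[of E] field.carrier_is_subfield[OF subfield_iff(2)[OF E]] one_not_zero
    by simp
qed

lemma (in field) polynomial_map_hom:
  assumes E: "subfield E R" and h: "h \<in> ring_hom (R\<lparr>carrier := E\<rparr>) R" and p: "p \<in> carrier (E[X])"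
  shows "map h p \<in> carrier (poly_ring R)"
  using polynomial_hom[OF h subfield_iff(2)[OF E] field_axioms, of p] p
  unfolding univ_poly_consistent[OF subfieldE(1)[OF E]] by simp

context rational_closure
begin

lemma prime_field_subset:
  assumes "subfield M \<Omega>" shows "generate_field \<Omega> {} \<subseteq> M"
  using generate_field_min_subfield1[OF _ assms] by simp

lemma algebraic_over:
  assumes "subfield M \<Omega>" "x \<in> carrier \<Omega>" shows "(algebraic over M) x"
  using algebraic_mono[OF prime_field_subset[OF assms(1)] algebraic_extension[OF assms(2)]] .

text \<open>Each element \<open>a\<close> is algebraic over the prime field, so its inverse is
  already a polynomial expression in \<open>a\<close>. Constructions of fields thus only have to
  secure the ring operations.\<close>

lemma subring_is_subfield:
  assumes D: "subring D \<Omega>" and k: "generate_field \<Omega> {} \<subseteq> D" shows "subfield D \<Omega>"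
proof (rule subfieldI'[OF D])
  fix a assume a: "a \<in> D - {\<zero>}"
  then have c: "a \<in> carrier \<Omega>" using subringE(1)[OF D] by auto
  let ?S = "simple_extension (generate_field \<Omega> {}) a"
  have "subfield ?S \<Omega>"
    using simple_extension_is_subfield[OF subfield_axioms c] algebraic_extension[OF c] by simp
  moreover have "a \<in> ?S" using simple_extension_mem[OF subfieldE(1)[OF subfield_axioms] c] .
  ultimately have "inv a \<in> ?S" using subfield_m_inv(1)[of ?S a] a by auto
  then show "inv a \<in> D"
    using simple_extension_subring_incl[OF D k, of a] a by auto
qed

lemma exists_root:
  assumes "p \<in> carrier (poly_ring \<Omega>)" "degree p \<ge> 1"
  obtains y where "y \<in> carrier \<Omega>" "eval p y = \<zero>"
proof -
  have "size (roots p) = degree p" using roots_over_carrier[OF assms(1)] by (simp add: splitted_def)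
  then have "roots p \<noteq> {#}" using assms(2) by auto
  then obtain y where "y \<in># roots p" by blast
  then show thesis using that roots_mem_iff_is_root[OF assms(1)] by (auto simp: is_root_def)
qed

lemma hom_a_inv_subring:
  assumes E: "subring E \<Omega>" and h: "h \<in> ring_hom (\<Omega>\<lparr>carrier := E\<rparr>) \<Omega>" and a: "a \<in> E"
  shows "h (\<ominus> a) = \<ominus> h a"
proof -
  interpret H: ring_hom_ring "\<Omega>\<lparr>carrier := E\<rparr>" \<Omega> h
    using ring_hom_ringI2[OF subring_is_ring[OF E] ring_axioms h] .
  have c: "a \<in> carrier \<Omega>" "\<ominus> a \<in> E" using a subringE[OF E] by auto
  have "h (a \<oplus> \<ominus> a) = h a \<oplus> h (\<ominus> a)" using ring_hom_memE(3)[OF h] a c by simp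
  then have "h a \<oplus> h (\<ominus> a) = \<zero>" using c H.hom_zero by (simp add: r_neg)
  then show ?thesis using H.hom_closed a c
    by (simp add: sum_zero_eq_neg add.m_comm)
qed

lemma hom_fixes_prime_field:
  assumes E: "subfield E \<Omega>" and h: "h \<in> ring_hom (\<Omega>\<lparr>carrier := E\<rparr>) \<Omega>"
    and x: "x \<in> generate_field \<Omega> {}"
  shows "h x = x"
proof -
  note sub = subfieldE(1)[OF E] note P = prime_field_subset[OF E]
  note H = ring_hom_memE[OF h, simplified]
  note neg = hom_a_inv_subring[OF sub h]
  from x show ?thesis
  proof (induction rule: generate_field.induct)
    case one
    then show ?case using H(4) .
  next
    case (incl h)
    then show ?case by simp
  next
    case (a_inv x)
    then show ?case using neg P by auto
  next
    case (m_inv x)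
    then have xE: "x \<in> E - {\<zero>}" "inv x \<in> E - {\<zero>}" using P subfield_m_inv(1)[OF E, of x] by auto
    have "h (x \<otimes> inv x) = h x \<otimes> h (inv x)" using H(2) xE by auto
    then have "x \<otimes> h (inv x) = \<one>" using subfield_m_inv(2)[OF E xE(1)] H(4) m_inv by simp
    moreover have "h (inv x) \<in> carrier \<Omega>" "x \<in> carrier \<Omega>" using H(1) xE subfieldE(3)[OF E] by auto
    ultimately show ?case by (metis comm_inv_char)
  next
    case (eng_add h1 h2)
    then show ?case using H(3)[of h1 h2] P by auto
  next
    case (eng_mult h1 h2)
    then show ?case using H(2)[of h1 h2] P by auto
  qed
qed

text \<open>Zorn's lemma for graphs of partial maps closed under the ring operations. As sets of
  pairs they are ordered by inclusion, and the conditions pass to the union of a chain because any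
  two pairs lie in a common member. The domain of a maximal graph is a field by
  \<open>subring_is_subfield\<close>.\<close>

lemma extend_hom_to_closure:
  assumes E: "subfield E \<Omega>" and h: "h \<in> ring_hom (\<Omega>\<lparr>carrier := E\<rparr>) \<Omega>"
  obtains f where "f \<in> ring_hom \<Omega> \<Omega>" "\<And>a. a \<in> E \<Longrightarrow> f a = h a"
proof -
  define gr where "gr h E = (\<lambda>a. (a, h a)) ` E" for h :: "'a \<Rightarrow> 'a" and E
  define P where "P W \<longleftrightarrow> gr h E \<subseteq> W \<and> W \<subseteq> carrier \<Omega> \<times> carrier \<Omega> \<and> single_valued W \<and>
     (\<forall>a b c d. (a,b) \<in> W \<longrightarrow> (c,d) \<in> W \<longrightarrow> (a \<oplus> c, b \<oplus> d) \<in> W \<and> (a \<otimes> c, b \<otimes> d) \<in> W) \<and>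
     (\<forall>a b. (a,b) \<in> W \<longrightarrow> (\<ominus> a, \<ominus> b) \<in> W)" for W
  have P_gr: "P (gr h' E')" if E': "subfield E' \<Omega>" and h': "h' \<in> ring_hom (\<Omega>\<lparr>carrier := E'\<rparr>) \<Omega>"
    and ext: "gr h E \<subseteq> gr h' E'" for h' E'
  proof -
    note s = subringE[OF subfieldE(1)[OF E']]
    note H = ring_hom_memE[OF h', simplified] hom_a_inv_subring[OF subfieldE(1)[OF E'] h']
    have gr_iff: "(a, b) \<in> gr h' E' \<longleftrightarrow> a \<in> E' \<and> b = h' a" for a b by (auto simp: gr_def)
    have "gr h' E' \<subseteq> carrier \<Omega> \<times> carrier \<Omega>" using s(1) H(1) by (auto simp: gr_def)
    moreover have "single_valued (gr h' E')" by (simp add: single_valued_def gr_iff)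
    ultimately show ?thesis unfolding P_def using ext by (simp add: gr_iff H s)
  qed
  have "\<exists>W\<in>Collect P. \<forall>Y\<in>Collect P. W \<subseteq> Y \<longrightarrow> Y = W"
  proof (rule subset_Zorn_nonempty)
    show "Collect P \<noteq> {}" using P_gr[OF E h] by auto
  next
    fix C assume C: "C \<noteq> {}" "subset.chain (Collect P) C"
    then have PC: "\<And>W. W \<in> C \<Longrightarrow> P W" by (auto simp: subset_chain_def)
    have tot: "\<And>W W'. W \<in> C \<Longrightarrow> W' \<in> C \<Longrightarrow> W \<subseteq> W' \<or> W' \<subseteq> W"
      using C(2) by (auto simp: subset_chain_def)
    have both: "\<exists>W\<in>C. u \<in> W \<and> v \<in> W" if uv: "u \<in> \<Union>C" "v \<in> \<Union>C" for u v
    proof -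
      obtain W W' where "W \<in> C" "u \<in> W" "W' \<in> C" "v \<in> W'" using uv by blast
      then show ?thesis using tot[of W W'] by blast
    qed
    have "P (\<Union>C)" unfolding P_def
    proof (intro conjI allI impI)
      obtain W where "W \<in> C" using C(1) by blast
      then show "gr h E \<subseteq> \<Union>C" using PC[of W] unfolding P_def by blast
      show "\<Union>C \<subseteq> carrier \<Omega> \<times> carrier \<Omega>" using PC unfolding P_def by blast
      show "single_valued (\<Union>C)"
      proof (rule single_valuedI)
        fix x y z assume "(x, y) \<in> \<Union>C" "(x, z) \<in> \<Union>C"
        then obtain W where "W \<in> C" "(x,y) \<in> W" "(x,z) \<in> W" using both by blast
        then show "y = z" using PC unfolding P_def by (meson single_valuedD)
      qed
    next
      fix a b c d assume "(a,b) \<in> \<Union>C" "(c,d) \<in> \<Union>C"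
      then obtain W where "W \<in> C" "(a,b) \<in> W" "(c,d) \<in> W" using both by blast
      then show "(a \<oplus> c, b \<oplus> d) \<in> \<Union>C" "(a \<otimes> c, b \<otimes> d) \<in> \<Union>C" using PC unfolding P_def by blast+
    next
      fix a b assume "(a,b) \<in> \<Union>C"
      then show "(\<ominus> a, \<ominus> b) \<in> \<Union>C" using PC unfolding P_def by blast
    qed
    then show "\<Union>C \<in> Collect P" by simp
  qed
  then obtain W where W: "P W" and max: "\<And>Y. P Y \<Longrightarrow> W \<subseteq> Y \<Longrightarrow> Y = W" by auto
  define D where "D = Domain W"
  define f where "f a = (THE b. (a,b) \<in> W)" for a
  have sv: "single_valued W" using W by (simp add: P_def)
  have f_eq: "f a = b" if "(a,b) \<in> W" for a b
    unfolding f_def using that sv by (auto simp: single_valued_def)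
  have fW: "(a, f a) \<in> W" if "a \<in> D" for a using that f_eq by (auto simp: D_def)
  have WD: "W = gr f D" using fW f_eq by (auto simp: gr_def D_def image_iff)
  have ED: "E \<subseteq> D" using W by (auto simp: P_def gr_def D_def)
  have fE: "f a = h a" if "a \<in> E" for a using that W by (intro f_eq) (auto simp: P_def gr_def)
  note sE = subringE[OF subfieldE(1)[OF E]]
  have closed: "\<And>a b. a \<in> D \<Longrightarrow> b \<in> D \<Longrightarrow> a \<oplus> b \<in> D \<and> f (a \<oplus> b) = f a \<oplus> f b"
    "\<And>a b. a \<in> D \<Longrightarrow> b \<in> D \<Longrightarrow> a \<otimes> b \<in> D \<and> f (a \<otimes> b) = f a \<otimes> f b"
    "\<And>a. a \<in> D \<Longrightarrow> \<ominus> a \<in> D"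
  proof -
    fix a b assume "a \<in> D" "b \<in> D"
    then have "(a \<oplus> b, f a \<oplus> f b) \<in> W \<and> (a \<otimes> b, f a \<otimes> f b) \<in> W"
      using fW W unfolding P_def by blast
    then show "a \<oplus> b \<in> D \<and> f (a \<oplus> b) = f a \<oplus> f b" "a \<otimes> b \<in> D \<and> f (a \<otimes> b) = f a \<otimes> f b"
      using f_eq by (auto simp: D_def)
  next
    fix a assume "a \<in> D"
    then have "(\<ominus> a, \<ominus> f a) \<in> W" using fW W unfolding P_def by blast
    then show "\<ominus> a \<in> D" by (auto simp: D_def)
  qed
  have "subring D \<Omega>"
    by (rule subringI) (use W sE ED closed in \<open>auto simp: P_def D_def\<close>)
  then have D: "subfield D \<Omega>"
    using subring_is_subfield prime_field_subset[OF E] ED by blast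
  have fc: "f a \<in> carrier \<Omega>" if "a \<in> D" for a using fW[OF that] W by (auto simp: P_def)
  have fhom: "f \<in> ring_hom (\<Omega>\<lparr>carrier := D\<rparr>) \<Omega>"
    by (rule ring_hom_memI) (use closed fc fE sE ring_hom_memE(4)[OF h] in auto)
  \<comment> \<open>Sending \<open>x\<close> to a root of the mapped minimal polynomial extends
    \<open>f\<close> to \<open>simple_extension D x\<close>. By maximality the new graph is still
    \<open>W\<close>, so \<open>x\<close> was in the domain already.\<close>
  have "x \<in> D" if x: "x \<in> carrier \<Omega>" for x
  proof -
    note alg = algebraic_over[OF D x]
    note I = IrrE[OF D x alg]
    have "degree (map f (Irr D x)) \<ge> 1" using pirreducible_degree[OF D I(1,2)] by simp
    then obtain y where y: "y \<in> carrier \<Omega>" "eval (map f (Irr D x)) y = \<zero>"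
      using exists_root[OF polynomial_map_hom[OF D fhom I(1)]] by blast
    obtain f' where f': "f' \<in> ring_hom (\<Omega>\<lparr>carrier := simple_extension D x\<rparr>) \<Omega>"
      "\<And>a. a \<in> D \<Longrightarrow> f' a = f a" using extend_hom_simple_extension[OF D fhom x alg y] by metis
    have S: "subfield (simple_extension D x) \<Omega>" using simple_extension_is_subfield[OF D x] alg by simp
    have "D \<subseteq> simple_extension D x" using simple_extension_incl[OF subfieldE(3)[OF D] x] .
    then have sub: "W \<subseteq> gr f' (simple_extension D x)"
      unfolding WD using f'(2) by (auto simp: gr_def image_iff)
    then have "gr h E \<subseteq> gr f' (simple_extension D x)" using W by (auto simp: P_def)
    from max[OF P_gr[OF S f'(1) this] sub] have "W = gr f' (simple_extension D x)" by simp
    then have "Domain W = simple_extension D x" by (auto simp: gr_def)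
    then show ?thesis
      using simple_extension_mem[OF subfieldE(1)[OF D] x] by (simp add: D_def)
  qed
  then have "D = carrier \<Omega>" using subfieldE(3)[OF D] by auto
  then have "f \<in> ring_hom \<Omega> \<Omega>" using fhom by simp
  then show thesis using fE by (rule that)
qed

text \<open>Surjectivity comes from algebraicity: \<open>f\<close> fixes the prime field, so it maps
  the finite root set of a polynomial of \<open>y\<close> over that field injectively into itself,
  and \<open>y\<close> is among the values.\<close>

lemma endomorphism_bij:
  assumes f: "f \<in> ring_hom \<Omega> \<Omega>" shows "bij_betw f (carrier \<Omega>) (carrier \<Omega>)"
proof -
  interpret f: ring_hom_ring \<Omega> \<Omega> f using ring_hom_ringI2[OF ring_axioms ring_axioms f] .
  have inj: "inj_on f (carrier \<Omega>)"
    using hom_subfield_inj[OF carrier_is_subfield] f by simp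
  let ?k = "generate_field \<Omega> {}"
  have "y \<in> f ` carrier \<Omega>" if y: "y \<in> carrier \<Omega>" for y
  proof -
    obtain p where p: "p \<in> carrier (?k[X])" "p \<noteq> []" "eval p y = \<zero>"
      using algebraicE[OF subfieldE(1)[OF subfield_axioms] y algebraic_extension[OF y]] .
    have fp: "map f p = p"
      using hom_fixes_prime_field[OF carrier_is_subfield, of f] f p(1)
      by (intro map_idI) (auto simp: sym[OF univ_poly_carrier] dest: polynomial_incl)
    have pc: "p \<in> carrier (poly_ring \<Omega>)"
      using carrier_polynomial_shell[OF subfieldE(1)[OF subfield_axioms] p(1)] .
    let ?Z = "{z. is_root p z}"
    have fin: "finite ?Z" using finite_number_of_roots[OF pc] .
    have "f ` ?Z \<subseteq> ?Z"
      using f.eval_hom[OF subfieldE(1)[OF subfield_axioms] _ p(1)] fp p(2)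
      by (auto simp: is_root_def) (metis f.hom_zero)
    moreover have "inj_on f ?Z" by (rule inj_on_subset[OF inj]) (auto simp: is_root_def)
    ultimately have "f ` ?Z = ?Z" using fin by (simp add: endo_inj_surj)
    moreover have "y \<in> ?Z" using p y by (simp add: is_root_def)
    ultimately show ?thesis by (auto simp: is_root_def)
  qed
  then show ?thesis using inj by (auto simp: bij_betw_def)
qed

text \<open>\<open>M\<close> may be any set. Every \<open>Aut M\<close> is a subset of the one group
  \<open>\<G>\<close>, where products, inverses and conjugates are formed.\<close>

definition Aut :: "'a set \<Rightarrow> ('a \<Rightarrow> 'a) set"
  where "Aut M = carrier (Galois_group \<Omega> M (carrier \<Omega>))"

abbreviation Gal :: "('a \<Rightarrow> 'a) monoid" (\<open>\<G>\<close>)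
  where "\<G> \<equiv> Galois_group \<Omega> {} (carrier \<Omega>)"

text \<open>Bijectivity comes for free from \<open>endomorphism_bij\<close>; of membership in
  \<open>Bij\<close> only extensionality remains.\<close>

lemma Aut_iff:
  "f \<in> Aut M \<longleftrightarrow> f \<in> extensional (carrier \<Omega>) \<and> f \<in> ring_hom \<Omega> \<Omega> \<and> (\<forall>x\<in>M. f x = x)"
  using endomorphism_bij[of f] by (auto simp: Aut_def Galois_group_carrier Bij_def)

lemma Aut_mem_iff: "f \<in> Aut M \<longleftrightarrow> f \<in> carrier \<G> \<and> (\<forall>x\<in>M. f x = x)"
  unfolding Aut_def by (auto simp: Galois_group_carrier)

lemma extend_to_Aut:
  assumes E: "subfield E \<Omega>" and h: "h \<in> ring_hom (\<Omega>\<lparr>carrier := E\<rparr>) \<Omega>"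
    and M: "M \<subseteq> E" "\<And>x. x \<in> M \<Longrightarrow> h x = x"
  obtains f where "f \<in> Aut M" "\<And>a. a \<in> E \<Longrightarrow> f a = h a"
proof -
  obtain f where f: "f \<in> ring_hom \<Omega> \<Omega>" "\<And>a. a \<in> E \<Longrightarrow> f a = h a"
    using extend_hom_to_closure[OF E h] by blast
  note c = subfieldE(3)[OF E]
  have "restrict f (carrier \<Omega>) \<in> ring_hom \<Omega> \<Omega>"
    by (rule ring_hom_memI) (use f(1) in \<open>auto simp: ring_hom_mult ring_hom_add ring_hom_one ring_hom_closed\<close>)
  then have "restrict f (carrier \<Omega>) \<in> Aut M"
    using M f(2) c by (auto simp: Aut_iff)
  then show thesis by (rule that) (use f(2) c in auto)
qed

lemma group_Gal: "group \<G>"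
  using group_Galois_group[OF carrier_is_subring, of "{}"] by simp

lemma Aut_subset: "Aut M \<subseteq> carrier \<G>"
  unfolding Aut_def by (auto simp: Galois_group_carrier)

lemma Aut_in_Gal: "f \<in> Aut M \<Longrightarrow> f \<in> carrier \<G>"
  using Aut_subset by (rule subsetD)

lemma Aut_anti: "M \<subseteq> M' \<Longrightarrow> Aut M' \<subseteq> Aut M"
  unfolding subset_iff Aut_iff by blast

lemma Gal_mult_apply:
  assumes "f \<in> carrier \<G>" "g \<in> carrier \<G>" "x \<in> carrier \<Omega>"
  shows "(f \<otimes>\<^bsub>\<G>\<^esub> g) x = f (g x)"
  using assms by (simp add: Galois_group_mult compose_def)

lemma Gal_one_apply: "x \<in> carrier \<Omega> \<Longrightarrow> \<one>\<^bsub>\<G>\<^esub> x = x"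
  by (simp add: Galois_group_one)

lemma Gal_closed: "f \<in> carrier \<G> \<Longrightarrow> x \<in> carrier \<Omega> \<Longrightarrow> f x \<in> carrier \<Omega>"
  by (auto simp: Galois_group_carrier dest: ring_hom_closed)

lemma Gal_inv_apply:
  assumes "f \<in> carrier \<G>" "x \<in> carrier \<Omega>"
  shows "(inv\<^bsub>\<G>\<^esub> f) (f x) = x" "f ((inv\<^bsub>\<G>\<^esub> f) x) = x"
proof -
  interpret G: group \<G> by (rule group_Gal)
  show "(inv\<^bsub>\<G>\<^esub> f) (f x) = x"
    using Gal_mult_apply[of "inv\<^bsub>\<G>\<^esub> f" f x] assms by (simp add: Gal_one_apply)
  show "f ((inv\<^bsub>\<G>\<^esub> f) x) = x"
    using Gal_mult_apply[of f "inv\<^bsub>\<G>\<^esub> f" x] assms by (simp add: Gal_one_apply)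
qed

lemma subgroup_Aut:
  assumes "M \<subseteq> carrier \<Omega>" shows "subgroup (Aut M) \<G>"
proof -
  interpret G: group \<G> by (rule group_Gal)
  have Gal: "\<And>f. f \<in> Aut M \<longleftrightarrow> f \<in> carrier \<G> \<and> (\<forall>x\<in>M. f x = x)"
    unfolding Aut_def by (auto simp: Galois_group_carrier)
  show ?thesis
  proof (rule G.subgroupI)
    show "Aut M \<subseteq> carrier \<G>" by (rule Aut_subset)
    have "\<one>\<^bsub>\<G>\<^esub> \<in> Aut M" using assms by (auto simp: Gal Gal_one_apply)
    then show "Aut M \<noteq> {}" by blast
  next
    fix a assume "a \<in> Aut M"
    then have a: "a \<in> carrier \<G>" "\<And>x. x \<in> M \<Longrightarrow> a x = x" by (auto simp: Gal)
    have "(inv\<^bsub>\<G>\<^esub> a) x = x" if "x \<in> M" for x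
      using Gal_inv_apply(1)[OF a(1), of x] a(2)[OF that] that assms by auto
    then show "inv\<^bsub>\<G>\<^esub> a \<in> Aut M" using a(1) by (simp add: Gal)
  next
    fix a b assume "a \<in> Aut M" "b \<in> Aut M"
    then show "a \<otimes>\<^bsub>\<G>\<^esub> b \<in> Aut M" using Gal_mult_apply[of a b] assms
      by (auto simp: Gal subset_iff)
  qed
qed

lemma Aut_hom: "f \<in> carrier \<G> \<Longrightarrow> f \<in> ring_hom \<Omega> \<Omega>"
  by (simp add: Galois_group_carrier)

lemma Gal_ring_hom_ring: "f \<in> carrier \<G> \<Longrightarrow> ring_hom_ring \<Omega> \<Omega> f"
  using ring_hom_ringI2[OF ring_axioms ring_axioms Aut_hom] .

lemma Aut_fixes: "f \<in> Aut M \<Longrightarrow> x \<in> M \<Longrightarrow> f x = x"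
  by (simp add: Aut_iff)

text \<open>The embedding of \<open>simple_extension M x\<close> over \<open>M\<close> that sends
  \<open>x\<close> to \<open>y\<close> extends to the closure; this is transitivity on the roots of
  a minimal polynomial.\<close>

lemma exists_conjugation:
  assumes M: "subfield M \<Omega>" and x: "x \<in> carrier \<Omega>" and y: "y \<in> carrier \<Omega>" "eval (Irr M x) y = \<zero>"
  obtains f where "f \<in> Aut M" "f x = y"
proof -
  have id: "(\<lambda>a. a) \<in> ring_hom (\<Omega>\<lparr>carrier := M\<rparr>) \<Omega>"
    by (rule ring_hom_memI) (use subfieldE(3)[OF M] in auto)
  note alg = algebraic_over[OF M x]
  obtain h where h: "h \<in> ring_hom (\<Omega>\<lparr>carrier := simple_extension M x\<rparr>) \<Omega>"
    "\<And>a. a \<in> M \<Longrightarrow> h a = a" "h x = y"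
    using extend_hom_simple_extension[OF M id x alg y(1)] y(2) by auto
  have S: "subfield (simple_extension M x) \<Omega>" using simple_extension_is_subfield[OF M x] alg by simp
  obtain f where f: "f \<in> Aut M" "\<And>a. a \<in> simple_extension M x \<Longrightarrow> f a = h a"
    using extend_to_Aut[OF S h(1) simple_extension_incl[OF subfieldE(3)[OF M] x] h(2)] by blast
  show thesis using that[OF f(1)] f(2) simple_extension_mem[OF subfieldE(1)[OF M] x] h(3) by simp
qed

lemma Aut_root:
  assumes M: "M \<subseteq> carrier \<Omega>" and f: "f \<in> Aut M" and p: "set p \<subseteq> M" and x: "x \<in> carrier \<Omega>"
    and "eval p x = \<zero>"
  shows "eval p (f x) = \<zero>"
proof -
  interpret f: ring_hom_ring \<Omega> \<Omega> f using Gal_ring_hom_ring f Aut_subset by blast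
  have "map f p = p" using p Aut_fixes[OF f] by (intro map_idI) auto
  then show ?thesis using f.eval_hom'[OF x, of p] p M assms(5) by auto
qed

lemma finite_Aut_orbit:
  assumes M: "subfield M \<Omega>" and x: "x \<in> carrier \<Omega>"
  shows "finite ((\<lambda>f. f x) ` Aut M)"
proof -
  note I = IrrE[OF M x algebraic_over[OF M x]]
  have pc: "Irr M x \<in> carrier (poly_ring \<Omega>)"
    using carrier_polynomial_shell[OF subfieldE(1)[OF M] I(1)] .
  have s: "set (Irr M x) \<subseteq> M" using I(1) polynomial_incl unfolding sym[OF univ_poly_carrier] by auto
  have "(\<lambda>f. f x) ` Aut M \<subseteq> {z. is_root (Irr M x) z}"
    using Aut_root[OF subfieldE(3)[OF M] _ s x I(4)] Gal_closed[OF subsetD[OF Aut_subset] x]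
      pirreducibleE(1)[OF subfieldE(1)[OF M] I(1,2)]
    by (auto simp: is_root_def)
  then show ?thesis using finite_number_of_roots[OF pc] finite_subset by blast
qed

end

section \<open>Fixed fields and orbit polynomials\<close>

lemma map_eq_self_imp_fixed: "map f xs = xs \<Longrightarrow> x \<in> set xs \<Longrightarrow> f x = x"
  by (induction xs) auto

text \<open>Only the two leading coefficients matter: if a power (X - x)^n has coefficients in a
  field of characteristic zero, the second one, -n x, puts \<open>x\<close> into that field. The
  exponent \<open>Suc n\<close> guarantees that a second coefficient exists.\<close>

lemma (in domain) monic_linear_pow_coeffs:
  assumes x: "x \<in> carrier R"
  shows "\<exists>cs. [\<one>, \<ominus> x] [^]\<^bsub>poly_ring R\<^esub> Suc n = \<one> # (\<ominus> add_pow R (Suc n) x) # cs"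
proof -
  interpret UP: domain "poly_ring R" using univ_poly_is_domain[OF carrier_is_subring] .
  have lin: "[\<one>, \<ominus> x] \<in> carrier (poly_ring R)"
    using x unfolding sym[OF univ_poly_carrier] polynomial_def by auto
  show ?thesis
  proof (induction n)
    case 0
    then show ?case using lin x by simp
  next
    case (Suc n)
    define q where "q = [\<one>, \<ominus> x] [^]\<^bsub>poly_ring R\<^esub> Suc n"
    obtain cs where cs: "q = \<one> # (\<ominus> add_pow R (Suc n) x) # cs" using Suc unfolding q_def by blast
    have "q \<in> carrier (poly_ring R)" unfolding q_def using lin by (rule UP.nat_pow_closed)
    then have qc: "set q \<subseteq> carrier R" using polynomial_incl unfolding sym[OF univ_poly_carrier] by auto
    have qx: "set (map ((\<otimes>) (\<ominus> x)) q) \<subseteq> carrier R" using qc x by auto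
    have q1: "map ((\<otimes>) \<one>) q = q" using qc by (intro map_idI) auto
    have "[\<one>, \<ominus> x] [^]\<^bsub>poly_ring R\<^esub> Suc (Suc n) = poly_mult [\<one>, \<ominus> x] q"
      unfolding UP.nat_pow_Suc2[OF lin, of "Suc n"] univ_poly_mult q_def by simp
    also have "\<dots> = poly_add (q @ [\<zero>]) (poly_mult [\<ominus> x] q)"
      using q1 by (simp del: poly_add.simps)
    also have "poly_mult [\<ominus> x] q = normalize (map ((\<otimes>) (\<ominus> x)) q)"
      using poly_add_zero'(1)[OF qx] by (simp del: poly_add.simps)
    also have "poly_add (q @ [\<zero>]) (normalize (map ((\<otimes>) (\<ominus> x)) q)) = poly_add (q @ [\<zero>]) (map ((\<otimes>) (\<ominus> x)) q)"
      using poly_add_normalize(2)[OF _ qx, of "q @ [\<zero>]"] qc by auto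
    \<comment> \<open>Coefficients stand highest degree first: \<open>q @ [\<zero>]\<close> is X q,
      and the shorter summand is padded with a leading zero.\<close>
    also have "\<dots> = normalize (map2 (\<oplus>) (q @ [\<zero>]) (\<zero> # map ((\<otimes>) (\<ominus> x)) q))"
      by simp
    also have "\<exists>cs'. \<dots> = \<one> # ((\<ominus> add_pow R (Suc n) x) \<oplus> (\<ominus> x)) # cs'"
      unfolding cs using x by (cases cs) auto
    finally have "\<exists>cs'. [\<one>, \<ominus> x] [^]\<^bsub>poly_ring R\<^esub> Suc (Suc n) = \<one> # ((\<ominus> add_pow R (Suc n) x) \<oplus> (\<ominus> x)) # cs'" .
    moreover have "(\<ominus> add_pow R (Suc n) x) \<oplus> (\<ominus> x) = \<ominus> add_pow R (Suc (Suc n)) x"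
      using x minus_add[of "add_pow R (Suc n) x" x] by simp
    ultimately show ?case by metis
  qed
qed

definition (in ring) root_poly :: "'a set \<Rightarrow> 'a list"
  where "root_poly S = finprod (poly_ring R) (\<lambda>z. [\<one>, \<ominus> z]) S"

context domain
begin

lemma monic_linear_closed:
  "z \<in> carrier R \<Longrightarrow> [\<one>, \<ominus> z] \<in> carrier (poly_ring R)"
  unfolding sym[OF univ_poly_carrier] polynomial_def by auto

lemma root_poly_empty: "root_poly {} = [\<one>]"
proof -
  interpret UP: domain "poly_ring R" using univ_poly_is_domain[OF carrier_is_subring] .
  show ?thesis by (simp add: root_poly_def univ_poly_one)
qed

lemma root_poly_insert:
  assumes "finite S" "insert a S \<subseteq> carrier R" "a \<notin> S"
  shows "root_poly (insert a S) = poly_mult [\<one>, \<ominus> a] (root_poly S)"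
proof -
  interpret UP: domain "poly_ring R" using univ_poly_is_domain[OF carrier_is_subring] .
  have "(\<lambda>z. [\<one>, \<ominus> z]) \<in> S \<rightarrow> carrier (poly_ring R)"
    using assms(2) by (intro funcsetI monic_linear_closed) auto
  then show ?thesis
    using UP.finprod_insert[OF assms(1,3), of "\<lambda>z. [\<one>, \<ominus> z]"] monic_linear_closed[of a] assms(2)
    by (simp add: root_poly_def univ_poly_mult del: poly_mult.simps)
qed

lemma root_poly_polynomial:
  assumes M: "subring M R" and S: "finite S" "S \<subseteq> M"
  shows "root_poly S \<in> carrier (M[X])"
  using S
proof (induction S)
  case empty
  then show ?case using subringE(3)[OF M] unfolding sym[OF univ_poly_carrier] polynomial_def
    by (simp add: root_poly_empty)
next
  case (insert a S)
  have c: "insert a S \<subseteq> carrier R" using insert(4) subringE(1)[OF M] by auto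
  have "set (root_poly S) \<subseteq> M" "set [\<one>, \<ominus> a] \<subseteq> M"
    using insert polynomial_incl subringE[OF M] unfolding sym[OF univ_poly_carrier] by auto
  then show ?case
    unfolding root_poly_insert[OF insert(1) c insert(2)] sym[OF univ_poly_carrier]
    by (intro poly_mult_is_polynomial[OF M])
qed

lemma eval_root_poly_eq_zero_iff:
  assumes "finite S" "S \<subseteq> carrier R" "y \<in> carrier R"
  shows "eval (root_poly S) y = \<zero> \<longleftrightarrow> y \<in> S"
  using assms(1,2)
proof (induction S)
  case empty
  then show ?case using assms(3) by (simp add: root_poly_empty)
next
  case (insert a S)
  have "root_poly S \<in> carrier (poly_ring R)"
    using root_poly_polynomial[OF carrier_is_subring] insert by simp
  then have s: "set (root_poly S) \<subseteq> carrier R"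
    using polynomial_incl unfolding sym[OF univ_poly_carrier] by auto
  have a: "a \<in> carrier R" using insert by simp
  have "eval (root_poly (insert a S)) y = eval [\<one>, \<ominus> a] y \<otimes> eval (root_poly S) y"
    unfolding root_poly_insert[OF insert(1,4,2)]
    using eval_poly_mult[OF _ s assms(3), of "[\<one>, \<ominus> a]"] a by simp
  moreover have "eval [\<one>, \<ominus> a] y = y \<ominus> a" using a assms(3) by (simp add: a_minus_def)
  ultimately show ?case
    using insert a assms(3) eval_in_carrier[OF s assms(3)] r_right_minus_eq[OF assms(3) a]
    by (simp add: integral_iff)
qed

lemma degree_root_poly:
  assumes "finite S" "S \<subseteq> carrier R"
  shows "root_poly S \<noteq> [] \<and> degree (root_poly S) = card S"
  using assms
proof (induction S)
  case empty
  then show ?case by (simp add: root_poly_empty)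
next
  case (insert a S)
  have p: "polynomial (carrier R) (root_poly S)" "polynomial (carrier R) [\<one>, \<ominus> a]"
    using root_poly_polynomial[OF carrier_is_subring] insert monic_linear_closed
    unfolding univ_poly_carrier by auto
  have "degree (root_poly (insert a S)) = Suc (card S)"
    unfolding root_poly_insert[OF insert(1,4,2)]
    using poly_mult_degree_eq[OF carrier_is_subring p(2,1)] insert by simp
  then show ?case using insert by auto
qed

end

context rational_closure
begin

text \<open>An automorphism permutes the linear factors. If \<open>f\<close> maps \<open>S\<close>
  onto itself, it therefore fixes every coefficient, which is the form used below.\<close>

lemma map_root_poly:
  assumes f: "f \<in> carrier \<G>" and "finite S" "S \<subseteq> carrier \<Omega>"
  shows "map f (root_poly S) = root_poly (f ` S)"
  using assms(2,3)
proof (induction S)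
  case empty
  then show ?case using ring_hom_one[OF Aut_hom[OF f]] by (simp add: root_poly_empty)
next
  case (insert a S)
  interpret f: ring_hom_ring \<Omega> \<Omega> f using Gal_ring_hom_ring[OF f] .
  have inj: "inj_on f (carrier \<Omega>)"
    using endomorphism_bij[OF Aut_hom[OF f]] by (simp add: bij_betw_def)
  have a: "a \<in> carrier \<Omega>" using insert by simp
  have fa: "f a \<notin> f ` S" using insert inj by (auto simp: inj_on_def)
  have fc: "insert (f a) (f ` S) \<subseteq> carrier \<Omega>" using insert(4) by auto
  have rS: "root_poly S \<in> carrier (poly_ring \<Omega>)" "root_poly (insert a S) \<in> carrier (poly_ring \<Omega>)"
    using root_poly_polynomial[OF carrier_is_subring] insert by simp_all
  then have s: "set (root_poly S) \<subseteq> carrier \<Omega>"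
    using polynomial_incl unfolding sym[OF univ_poly_carrier] by auto
  have "map f (root_poly (insert a S)) \<in> carrier (poly_ring \<Omega>)"
    using polynomial_map_hom[OF carrier_is_subfield _ rS(2), of f] Aut_hom[OF f] by simp
  then have "map f (root_poly (insert a S)) = normalize (map f (root_poly (insert a S)))"
    using normalize_polynomial unfolding sym[OF univ_poly_carrier] by metis
  also have "\<dots> = poly_mult (map f [\<one>, \<ominus> a]) (map f (root_poly S))"
    unfolding root_poly_insert[OF insert(1,4,2)]
    using f.poly_mult_hom'[OF _ s, of "[\<one>, \<ominus> a]"] a by simp
  also have "\<dots> = poly_mult [\<one>, \<ominus> (f a)] (root_poly (f ` S))"
    using insert a by (simp del: poly_mult.simps)
  also have "\<dots> = root_poly (insert (f a) (f ` S))"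
    using root_poly_insert[OF _ fc fa] insert(1) by simp
  finally show ?case by simp
qed

lemma prime_field_add_pow: "add_pow \<Omega> (n :: nat) \<one> \<in> generate_field \<Omega> {}"
proof (induction n)
  case 0
  then show ?case using zero_in_generate by simp
next
  case (Suc n)
  then show ?case using generate_field.eng_add[OF Suc generate_field.one] by simp
qed

text \<open>In characteristic zero the integer multiples of one are distinct. The choice of a
  separating combination needs this infinite supply of scalars.\<close>

lemma infinite_prime_field: "infinite (generate_field \<Omega> {})"
proof -
  have "inj (\<lambda>n :: nat. add_pow \<Omega> n \<one>)"
  proof (rule injI)
    have *: "\<not> m < n" if "add_pow \<Omega> m \<one> = add_pow \<Omega> n \<one>" for m n :: nat
    proof
      assume "m < n"
      then have "add_pow \<Omega> n \<one> = add_pow \<Omega> m \<one> \<oplus> add_pow \<Omega> (n - m) \<one>"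
        by (simp add: add.nat_pow_mult)
      then have "add_pow \<Omega> m \<one> \<oplus> add_pow \<Omega> (n - m) \<one> = add_pow \<Omega> m \<one> \<oplus> \<zero>"
        using that by simp
      then have "add_pow \<Omega> (n - m) \<one> = \<zero>" by (simp del: r_zero)
      then show False using char_zero[of "n - m"] \<open>m < n\<close> by simp
    qed
    fix m n :: nat assume "add_pow \<Omega> m \<one> = add_pow \<Omega> n \<one>"
    then show "m = n" using *[of m n] *[of n m] by simp
  qed
  then have "infinite (range (\<lambda>n :: nat. add_pow \<Omega> n \<one>))" by (rule range_inj_infinite)
  then show ?thesis using prime_field_add_pow by (meson image_subsetI infinite_super)
qed

text \<open>
  No separability is needed: if \<open>x\<close> is its only conjugate, then its minimal polynomial is
  \<open>(X - x)\<^sup>n\<close>, whose second coefficient \<open>- n x\<close> lies in \<open>M\<close>.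
\<close>

lemma fixed_field_Aut:
  assumes M: "subfield M \<Omega>" and x: "x \<in> carrier \<Omega>" and fix_x: "\<And>f. f \<in> Aut M \<Longrightarrow> f x = x"
  shows "x \<in> M"
proof -
  interpret UP: domain "poly_ring \<Omega>" using univ_poly_is_domain[OF carrier_is_subring] .
  define p where "p = Irr M x"
  note I = IrrE[OF M x algebraic_over[OF M x], folded p_def]
  have pc: "p \<in> carrier (poly_ring \<Omega>)" using carrier_polynomial_shell[OF subfieldE(1)[OF M] I(1)] .
  have pM: "set p \<subseteq> M" using I(1) polynomial_incl unfolding sym[OF univ_poly_carrier] by auto
  have p0: "p \<noteq> []" using pirreducibleE(1)[OF subfieldE(1)[OF M] I(1,2)] .
  obtain n where n: "degree p = Suc n"
    using pirreducible_degree[OF M I(1,2)] by (metis One_nat_def Suc_le_D)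
  have "y = x" if "y \<in># roots p" for y
    using exists_conjugation[OF M x, of y] fix_x that roots_mem_iff_is_root[OF pc]
    by (auto simp: is_root_def p_def)
  then have "roots p = replicate_mset (size (roots p)) x"
    by (intro set_mset_subset_singletonD) auto
  moreover have "size (roots p) = Suc n"
    using roots_over_carrier[OF pc] n by (simp add: splitted_def)
  ultimately have "alg_mult p x = Suc n"
    using alg_mult_eq_count_roots[OF pc] by (metis count_replicate_mset)
  define l where "l = [\<one>, \<ominus> x] [^]\<^bsub>poly_ring \<Omega>\<^esub> Suc n"
  have "l pdivides p" using alg_multE(1)[OF x pc p0] \<open>alg_mult p x = Suc n\<close> unfolding l_def by simp
  then obtain q where q: "q \<in> carrier (poly_ring \<Omega>)" "p = poly_mult l q"
    by (auto simp: pdivides_def factor_def univ_poly_mult)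
  have lc: "l \<in> carrier (poly_ring \<Omega>)" unfolding l_def using monic_linear_closed[OF x] by (rule UP.nat_pow_closed)
  obtain cs where cs: "l = \<one> # (\<ominus> add_pow \<Omega> (Suc n) x) # cs"
    unfolding l_def using monic_linear_pow_coeffs[OF x] by blast
  have q0: "q \<noteq> []" using p0 q poly_mult_zero(2)[of l] lc polynomial_incl
    unfolding sym[OF univ_poly_carrier] by auto
  have "degree p = degree l + degree q"
    using poly_mult_degree_eq[OF carrier_is_subring, of l q] lc q q0 cs
    unfolding univ_poly_carrier by auto
  moreover have "degree l = Suc n"
    using polynomial_pow_degree[OF monic_linear_closed[OF x], of "Suc n"] unfolding l_def by simp
  \<comment> \<open>By degrees the cofactor \<open>q\<close> is a constant, and it equals one
    because \<open>p\<close> and \<open>l\<close> are both monic.\<close>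
  ultimately have "degree q = 0" using n by simp
  then obtain c where c: "q = [c]" using q0 by (cases q) auto
  have "lead_coeff p = lead_coeff l \<otimes> c"
    using poly_mult_lead_coeff[OF carrier_is_subring, of l q] lc q q0 cs c
    unfolding univ_poly_carrier by auto
  moreover have "c \<in> carrier \<Omega>" using q(1) c unfolding sym[OF univ_poly_carrier] polynomial_def by auto
  ultimately have "c = \<one>" using I(3) cs by simp
  then have "p = l" using q c lc UP.r_one[OF lc] by (simp add: univ_poly_mult univ_poly_one)
  then have m: "\<ominus> add_pow \<Omega> (Suc n) x \<in> M" using pM cs by auto
  note sM = subringE[OF subfieldE(1)[OF M]]
  \<comment> \<open>The integer \<open>Suc n\<close> inside the prime field, hence in
    \<open>M\<close>; it is invertible in characteristic zero.\<close>
  let ?c = "add_pow \<Omega> (Suc n) \<one>"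
  have "\<ominus> (\<ominus> add_pow \<Omega> (Suc n) x) \<in> M" using m sM(5) by blast
  then have "add_pow \<Omega> (Suc n) x \<in> M" using x by simp
  moreover have "add_pow \<Omega> (Suc n) x = ?c \<otimes> x"
    using add_pow_ldistr[OF _ x, of \<one> "Suc n"] x by simp
  moreover have "?c \<in> M - {\<zero>}"
    using prime_field_add_pow[of "Suc n"] prime_field_subset[OF M] char_zero[of "Suc n"]
    by (auto simp del: add.nat_pow_Suc)
  ultimately show ?thesis using subfield_m_inv_simprule[OF M, of ?c x] x by simp
qed

text \<open>Automorphisms over \<open>M\<close> permute \<open>S\<close>, so they fix the
  coefficients, which then lie in the fixed field \<open>M\<close>.\<close>

lemma root_poly_Aut_stable:
  assumes M: "subfield M \<Omega>" and S: "finite S" "S \<subseteq> carrier \<Omega>"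
    and stable: "\<And>f z. f \<in> Aut M \<Longrightarrow> z \<in> S \<Longrightarrow> f z \<in> S"
  shows "root_poly S \<in> carrier (M[X])"
proof -
  have rc: "root_poly S \<in> carrier (poly_ring \<Omega>)" using root_poly_polynomial[OF carrier_is_subring S] .
  then have rs: "set (root_poly S) \<subseteq> carrier \<Omega>"
    using polynomial_incl unfolding sym[OF univ_poly_carrier] by auto
  have "set (root_poly S) \<subseteq> M"
  proof
    fix c assume c: "c \<in> set (root_poly S)"
    show "c \<in> M"
    proof (rule fixed_field_Aut[OF M])
      show "c \<in> carrier \<Omega>" using c rs by blast
      fix f assume f: "f \<in> Aut M"
      then have fG: "f \<in> carrier \<G>" using Aut_subset by blast
      have "inj_on f S"
        using endomorphism_bij[OF Aut_hom[OF fG]] S(2) by (meson bij_betw_def inj_on_subset)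
      then have "f ` S = S" using stable[OF f] S(1) by (intro endo_inj_surj) auto
      then have "map f (root_poly S) = root_poly S" using map_root_poly[OF fG S] by simp
      then show "f c = c" using c by (rule map_eq_self_imp_fixed)
    qed
  qed
  then show ?thesis using rc unfolding sym[OF univ_poly_carrier] polynomial_def by auto
qed

lemma Aut_orbit_stable:
  assumes "M \<subseteq> carrier \<Omega>" "x \<in> carrier \<Omega>" "f \<in> Aut M" "z \<in> (\<lambda>g. g x) ` Aut M"
  shows "f z \<in> (\<lambda>g. g x) ` Aut M"
proof -
  interpret G: group \<G> by (rule group_Gal)
  obtain g where g: "g \<in> Aut M" "z = g x" using assms(4) by blast
  have "f \<otimes>\<^bsub>\<G>\<^esub> g \<in> Aut M" using subgroup.m_closed[OF subgroup_Aut[OF assms(1)]] assms(3) g by simp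
  moreover have "(f \<otimes>\<^bsub>\<G>\<^esub> g) x = f z" using Gal_mult_apply[of f g x] assms g by (simp add: Aut_in_Gal)
  ultimately show ?thesis by (metis image_eqI)
qed

lemma Aut_orbit_carrier: "x \<in> carrier \<Omega> \<Longrightarrow> (\<lambda>g. g x) ` Aut M \<subseteq> carrier \<Omega>"
  using Gal_closed by (auto simp: Aut_in_Gal)

lemma Aut_orbit_self:
  assumes "M \<subseteq> carrier \<Omega>" "x \<in> carrier \<Omega>" shows "x \<in> (\<lambda>g. g x) ` Aut M"
  using subgroup.one_closed[OF subgroup_Aut[OF assms(1)]] Gal_one_apply[OF assms(2)]
  by (metis image_eqI)

text \<open>The orbit polynomial has coefficients in \<open>M\<close> and vanishes at
  \<open>x\<close>, so the minimal polynomial divides it; conversely every conjugate is a root of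
  the minimal polynomial.\<close>

lemma degree_Irr_eq_card_orbit:
  assumes M: "subfield M \<Omega>" and x: "x \<in> carrier \<Omega>"
  shows "degree (Irr M x) = card ((\<lambda>f. f x) ` Aut M)"
proof (rule antisym)
  let ?S = "(\<lambda>f. f x) ` Aut M"
  note Mc = subfieldE(3)[OF M]
  note fin = finite_Aut_orbit[OF M x] note Sc = Aut_orbit_carrier[OF x, of M]
  note I = IrrE[OF M x algebraic_over[OF M x]]
  have pc: "Irr M x \<in> carrier (poly_ring \<Omega>)" using carrier_polynomial_shell[OF subfieldE(1)[OF M] I(1)] .
  have rp: "root_poly ?S \<in> carrier (M[X])"
    by (rule root_poly_Aut_stable[OF M fin Sc]) (rule Aut_orbit_stable[OF Mc x])
  have "eval (root_poly ?S) x = \<zero>"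
    using eval_root_poly_eq_zero_iff[OF fin Sc x] Aut_orbit_self[OF Mc x] by simp
  then have "Irr M x pdivides root_poly ?S" using Irr_minimal[OF M x algebraic_over[OF M x] rp] by simp
  then show "degree (Irr M x) \<le> card ?S"
    using pdivides_imp_degree_le[OF subfieldE(1)[OF M] I(1) rp] degree_root_poly[OF fin Sc] by simp
  have pM: "set (Irr M x) \<subseteq> M" using I(1) polynomial_incl unfolding sym[OF univ_poly_carrier] by auto
  have "?S \<subseteq> set_mset (roots (Irr M x))"
  proof
    fix z assume z: "z \<in> ?S"
    then have "is_root (Irr M x) z"
      using Aut_root[OF Mc _ pM x I(4)] Sc pirreducibleE(1)[OF subfieldE(1)[OF M] I(1,2)]
      by (auto simp: is_root_def)
    then show "z \<in># roots (Irr M x)" using roots_mem_iff_is_root[OF pc] by simp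
  qed
  then have "card ?S \<le> card (set_mset (roots (Irr M x)))" by (intro card_mono) auto
  also have "\<dots> \<le> size (roots (Irr M x))"
    by (metis mset_set_set_mset_msubset size_mset_mono size_mset_set)
  also have "\<dots> \<le> degree (Irr M x)" using size_roots_le_degree[OF pc] .
  finally show "card ?S \<le> degree (Irr M x)" .
qed

end

section \<open>Open subgroups and normal extensions\<close>

context rational_closure
begin

text \<open>The counting argument of the primitive element theorem, phrased with stabilizers: only
  finitely many scalars \<open>c\<close> allow \<open>a \<oplus> c \<otimes> b\<close> to be fixed
  by an automorphism over \<open>M\<close> that moves \<open>b\<close>.\<close>

lemma exists_separating_pair:
  assumes M: "subfield M \<Omega>" and a: "a \<in> carrier \<Omega>" and b: "b \<in> carrier \<Omega>"
  obtains c where "c \<in> generate_field \<Omega> {}"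
    "\<And>f. f \<in> Aut M \<Longrightarrow> f (a \<oplus> c \<otimes> b) = a \<oplus> c \<otimes> b \<Longrightarrow> f a = a \<and> f b = b"
proof -
  let ?A = "(\<lambda>f. f a) ` Aut M" and ?B = "(\<lambda>f. f b) ` Aut M"
  \<comment> \<open>Solving \<open>a' \<oplus> c \<otimes> b' = a \<oplus> c \<otimes> b\<close> for
    \<open>c\<close> gives these values; the junk values at \<open>b' = b\<close> only exclude
    finitely many more scalars.\<close>
  define bad where "bad = (\<lambda>(a', b'). inv (b \<ominus> b') \<otimes> (a' \<ominus> a)) ` (?A \<times> ?B)"
  have "finite bad" unfolding bad_def
    using finite_Aut_orbit[OF M a] finite_Aut_orbit[OF M b] by blast
  then obtain c where c: "c \<in> generate_field \<Omega> {}" "c \<notin> bad"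
    using infinite_prime_field by (meson ex_new_if_finite finite_subset subsetI)
  have cc: "c \<in> carrier \<Omega>" using c(1) generate_field_in_carrier by blast
  have "f a = a \<and> f b = b" if f: "f \<in> Aut M" and eq: "f (a \<oplus> c \<otimes> b) = a \<oplus> c \<otimes> b" for f
  proof -
    have fG: "f \<in> carrier \<G>" using Aut_in_Gal[OF f] .
    interpret f: ring_hom_ring \<Omega> \<Omega> f using Gal_ring_hom_ring[OF fG] .
    have fc: "f c = c" using Aut_fixes[OF f] c(1) prime_field_subset[OF M] by blast
    have car: "f a \<in> carrier \<Omega>" "f b \<in> carrier \<Omega>" using a b by auto
    have e: "f a \<oplus> c \<otimes> f b = a \<oplus> c \<otimes> b" using eq a b cc fc by simp
    have "f b = b"
    proof (rule ccontr)
      assume ne: "f b \<noteq> b"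
      then have nz: "b \<ominus> f b \<noteq> \<zero>" using b car r_right_minus_eq by simp
      have "c \<otimes> (b \<ominus> f b) = (a \<oplus> c \<otimes> b) \<ominus> a \<ominus> c \<otimes> f b"
        using a b cc car by algebra
      also have "\<dots> = (f a \<oplus> c \<otimes> f b) \<ominus> a \<ominus> c \<otimes> f b" using e by simp
      also have "\<dots> = f a \<ominus> a" using a b cc car by algebra
      finally have "inv (b \<ominus> f b) \<otimes> (f a \<ominus> a) = inv (b \<ominus> f b) \<otimes> (c \<otimes> (b \<ominus> f b))" by simp
      also have "\<dots> = c \<otimes> ((b \<ominus> f b) \<otimes> inv (b \<ominus> f b))"
        using b car cc nz field_Units by (simp add: m_ac)
      also have "\<dots> = c" using b car cc nz field_Units by simp
      finally have "c = inv (b \<ominus> f b) \<otimes> (f a \<ominus> a)" by simp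
      then have "c \<in> bad" unfolding bad_def using f by (intro image_eqI[of _ _ "(f a, f b)"]) auto
      then show False using c(2) by blast
    qed
    moreover from this have "f a = a" using e a b cc car by simp
    ultimately show ?thesis by blast
  qed
  then show thesis using that c(1) by blast
qed

lemma exists_separating_element:
  assumes M: "subfield M \<Omega>" and "finite Y" "Y \<subseteq> carrier \<Omega>"
  obtains \<theta> where "\<theta> \<in> generate_field \<Omega> Y" "\<And>f y. f \<in> Aut M \<Longrightarrow> f \<theta> = \<theta> \<Longrightarrow> y \<in> Y \<Longrightarrow> f y = y"
proof -
  have "\<exists>\<theta>\<in>generate_field \<Omega> Y. \<forall>f\<in>Aut M. f \<theta> = \<theta> \<longrightarrow> (\<forall>y\<in>Y. f y = y)"
    using assms(2,3)
  proof (induction Y)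
    case empty
    then show ?case using generate_field.one by blast
  next
    case (insert y Y)
    then obtain t where t: "t \<in> generate_field \<Omega> Y" "\<And>f. f \<in> Aut M \<Longrightarrow> f t = t \<Longrightarrow> \<forall>y\<in>Y. f y = y"
      by auto
    have yc: "y \<in> carrier \<Omega>" and Yc: "Y \<subseteq> carrier \<Omega>" using insert by auto
    have tc: "t \<in> carrier \<Omega>" using generate_field_in_carrier[OF Yc t(1)] .
    obtain c where c: "c \<in> generate_field \<Omega> {}"
      "\<And>f. f \<in> Aut M \<Longrightarrow> f (t \<oplus> c \<otimes> y) = t \<oplus> c \<otimes> y \<Longrightarrow> f t = t \<and> f y = y"
      using exists_separating_pair[OF M tc yc] by blast
    have "generate_field \<Omega> Y \<subseteq> generate_field \<Omega> (insert y Y)"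
      "generate_field \<Omega> {} \<subseteq> generate_field \<Omega> (insert y Y)"
      using mono_generate_field insert(4) by blast+
    then have "t \<oplus> c \<otimes> y \<in> generate_field \<Omega> (insert y Y)"
      using t(1) c(1) generate_field.incl[of y "insert y Y" \<Omega>]
      by (intro generate_field.eng_add generate_field.eng_mult) auto
    moreover have "\<forall>z\<in>insert y Y. f z = z" if f: "f \<in> Aut M" "f (t \<oplus> c \<otimes> y) = t \<oplus> c \<otimes> y" for f
      using c(2)[OF f] t(2)[OF f(1)] by blast
    ultimately show ?case by blast
  qed
  then show thesis using that by blast
qed

text \<open>A form of Artin's theorem; the assumption on \<open>Y\<close> says that \<open>H\<close> is open in the Krull topology.\<close>

lemma mem_open_subgroup:
  assumes M: "subfield M \<Omega>" and H: "subgroup H \<G>" "H \<subseteq> Aut M"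
    and Y: "finite Y" "Y \<subseteq> carrier \<Omega>" "\<And>f. f \<in> Aut M \<Longrightarrow> (\<And>y. y \<in> Y \<Longrightarrow> f y = y) \<Longrightarrow> f \<in> H"
    and h: "h \<in> Aut M" "\<And>x. x \<in> carrier \<Omega> \<Longrightarrow> (\<And>f. f \<in> H \<Longrightarrow> f x = x) \<Longrightarrow> h x = x"
  shows "h \<in> H"
proof -
  interpret G: group \<G> by (rule group_Gal)
  note sub = subgroup_Aut[OF subfieldE(3)[OF M]]
  obtain \<theta> where \<theta>: "\<theta> \<in> generate_field \<Omega> Y" "\<And>f y. f \<in> Aut M \<Longrightarrow> f \<theta> = \<theta> \<Longrightarrow> y \<in> Y \<Longrightarrow> f y = y"
    using exists_separating_element[OF M Y(1,2)] by blast
  have \<theta>c: "\<theta> \<in> carrier \<Omega>" using generate_field_in_carrier[OF Y(2) \<theta>(1)] .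
  let ?S = "(\<lambda>f. f \<theta>) ` H"
  have HG: "f \<in> carrier \<G>" if "f \<in> H" for f using that H(2) Aut_in_Gal by blast
  have fin: "finite ?S" using finite_Aut_orbit[OF M \<theta>c] H(2) by (meson finite_subset image_mono)
  have Sc: "?S \<subseteq> carrier \<Omega>" using HG Gal_closed \<theta>c by auto
  have hG: "h \<in> carrier \<G>" using Aut_in_Gal[OF h(1)] .
  have rc: "set (root_poly ?S) \<subseteq> carrier \<Omega>"
    using root_poly_polynomial[OF carrier_is_subring fin Sc] polynomial_incl
    unfolding sym[OF univ_poly_carrier] by auto
  \<comment> \<open>\<open>H\<close> permutes \<open>?S\<close>, so the coefficients are fixed by
    \<open>H\<close> and hence by \<open>h\<close>. It follows that \<open>h\<close> sends
    \<open>\<theta>\<close> to a root again, that is, to \<open>g \<theta>\<close> for some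
    \<open>g\<close> in \<open>H\<close>.\<close>
  have "h c = c" if c: "c \<in> set (root_poly ?S)" for c
  proof (rule h(2))
    show "c \<in> carrier \<Omega>" using c rc by blast
    fix f assume f: "f \<in> H"
    have "f z \<in> ?S" if z: "z \<in> ?S" for z
    proof -
      obtain g where g: "g \<in> H" "z = g \<theta>" using z by blast
      then have "f z = (f \<otimes>\<^bsub>\<G>\<^esub> g) \<theta>" using Gal_mult_apply[OF HG[OF f] HG[OF g(1)] \<theta>c] by simp
      then show ?thesis using subgroup.m_closed[OF H(1) f g(1)] by blast
    qed
    moreover have "inj_on f ?S"
      using endomorphism_bij[OF Aut_hom[OF HG[OF f]]] Sc by (meson bij_betw_def inj_on_subset)
    ultimately have "f ` ?S = ?S" using fin by (intro endo_inj_surj) auto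
    then have "map f (root_poly ?S) = root_poly ?S" using map_root_poly[OF HG[OF f] fin Sc] by simp
    then show "f c = c" using c by (rule map_eq_self_imp_fixed)
  qed
  then have hr: "map h (root_poly ?S) = root_poly ?S" by (intro map_idI) auto
  interpret h: ring_hom_ring \<Omega> \<Omega> h using Gal_ring_hom_ring[OF hG] .
  have "\<theta> \<in> ?S" using subgroup.one_closed[OF H(1)] Gal_one_apply[OF \<theta>c] by (metis image_eqI)
  then have "eval (root_poly ?S) \<theta> = \<zero>" using eval_root_poly_eq_zero_iff[OF fin Sc \<theta>c] by simp
  then have "eval (root_poly ?S) (h \<theta>) = \<zero>" using h.eval_hom'[OF \<theta>c rc] hr by simp
  then have "h \<theta> \<in> ?S" using eval_root_poly_eq_zero_iff[OF fin Sc] \<theta>c by simp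
  then obtain g where g: "g \<in> H" "h \<theta> = g \<theta>" by blast
  have gA: "g \<in> Aut M" using g(1) H(2) by blast
  \<comment> \<open>Corrected by \<open>g\<close>, the automorphism fixes \<open>\<theta>\<close>
    and with it all of \<open>Y\<close>, so openness puts it into \<open>H\<close>.\<close>
  define k where "k = inv\<^bsub>\<G>\<^esub> g \<otimes>\<^bsub>\<G>\<^esub> h"
  have kA: "k \<in> Aut M" unfolding k_def
    using subgroup.m_closed[OF sub subgroup.m_inv_closed[OF sub gA] h(1)] .
  have "k \<theta> = \<theta>" unfolding k_def
    using Gal_mult_apply[OF G.inv_closed[OF HG[OF g(1)]] hG \<theta>c] g(2) Gal_inv_apply(1)[OF HG[OF g(1)] \<theta>c] by simp
  then have "k \<in> H" using Y(3)[OF kA] \<theta>(2)[OF kA] by blast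
  then have "g \<otimes>\<^bsub>\<G>\<^esub> k \<in> H" using subgroup.m_closed[OF H(1) g(1)] by blast
  moreover have "g \<otimes>\<^bsub>\<G>\<^esub> k = h" unfolding k_def using G.m_assoc[symmetric] HG[OF g(1)] hG by simp
  ultimately show ?thesis by simp
qed

text \<open>Induction on the degree, splitting off a linear factor with root in \<open>E\<close>:
  either \<open>y\<close> is that root, or it is a root of the cofactor, which splits over
  \<open>E\<close> again.\<close>

lemma splitted_root_mem:
  assumes E: "subfield E \<Omega>" and "p \<in> carrier (E[X])" "p \<noteq> []"
    and "ring.splitted (\<Omega>\<lparr>carrier := E\<rparr>) p" and y: "y \<in> carrier \<Omega>" and "eval p y = \<zero>"
  shows "y \<in> E"
  using assms(2,3,4,6)
proof (induction "degree p" arbitrary: p)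
  case 0
  then obtain c where c: "p = [c]" by (cases p) auto
  then have "c \<in> E" "c \<noteq> \<zero>" using 0 unfolding sym[OF univ_poly_carrier] polynomial_def by auto
  then show ?case using 0 c y subfieldE(3)[OF E] by auto
next
  case (Suc n)
  interpret EE: field "\<Omega>\<lparr>carrier := E\<rparr>" using subfield_iff(2)[OF E] .
  note cons = univ_poly_consistent[OF subfieldE(1)[OF E]]
  have EEp: "poly_ring (\<Omega>\<lparr>carrier := E\<rparr>) = E[X]" using cons by simp
  have pc: "p \<in> carrier (poly_ring (\<Omega>\<lparr>carrier := E\<rparr>))" unfolding EEp using Suc by simp
  have "EE.roots p \<noteq> {#}" using Suc by (auto simp: EE.splitted_def)
  then obtain a where a: "a \<in> E" and dv: "[\<one>, \<ominus>\<^bsub>\<Omega>\<lparr>carrier := E\<rparr>\<^esub> a] pdivides\<^bsub>\<Omega>\<lparr>carrier := E\<rparr>\<^esub> p"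
    and lc: "[\<one>, \<ominus>\<^bsub>\<Omega>\<lparr>carrier := E\<rparr>\<^esub> a] \<in> carrier (poly_ring (\<Omega>\<lparr>carrier := E\<rparr>))"
    using EE.not_empty_rootsE[OF pc] by auto
  define b where "b = \<ominus>\<^bsub>\<Omega>\<lparr>carrier := E\<rparr>\<^esub> a"
  have b: "b \<in> E" "a \<oplus> b = \<zero>" using EE.a_inv_closed[of a] EE.r_neg[of a] a unfolding b_def by auto
  have ab: "a \<in> carrier \<Omega>" "b \<in> carrier \<Omega>" using a b subfieldE(3)[OF E] by auto
  obtain q where q: "q \<in> carrier (E[X])" "p = poly_mult [\<one>, b] q"
    using dv unfolding pdivides_def EEp factor_def univ_poly_mult b_def by auto
  have q0: "q \<noteq> []" using Suc(4) q poly_mult_zero(2)[of "[\<one>, b]"] ab by auto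
  have lE: "[\<one>, b] \<in> carrier (E[X])" using lc unfolding EEp b_def .
  have dq: "degree p = Suc (degree q)"
    using poly_mult_degree_eq[OF subfieldE(1)[OF E], of "[\<one>, b]" q] lE q q0
    unfolding univ_poly_carrier by simp
  have "EE.roots p = add_mset a (EE.roots q)"
    using EE.poly_mult_degree_one_monic_imp_same_roots[of a q] a q q0
    unfolding EEp univ_poly_mult b_def by simp
  then have sq: "EE.splitted q" using Suc(5) dq by (simp add: EE.splitted_def)
  have qs: "set q \<subseteq> carrier \<Omega>"
    using q(1) polynomial_incl subfieldE(3)[OF E] unfolding sym[OF univ_poly_carrier] by blast
  have "eval p y = (y \<oplus> b) \<otimes> eval q y"
    unfolding q(2) using eval_poly_mult[OF _ qs y, of "[\<one>, b]"] ab y by simp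
  then have "y \<oplus> b = \<zero> \<or> eval q y = \<zero>"
    using Suc(6) integral_iff[of "y \<oplus> b" "eval q y"] y ab eval_in_carrier[OF qs y] by simp
  then show ?case
  proof
    assume "y \<oplus> b = \<zero>"
    then have "y \<oplus> b = a \<oplus> b" using b by simp
    then show ?thesis using y ab a by simp
  next
    assume "eval q y = \<zero>"
    then show ?thesis using Suc(1)[OF _ q(1) q0 sq] dq Suc(2) by simp
  qed
qed

text \<open>By normality the minimal polynomial of \<open>x\<close> over \<open>F\<close> splits
  over \<open>E\<close>, and \<open>f x\<close> is one of its roots.\<close>

lemma normal_extension_stable:
  assumes N: "normal_extension \<Omega> F E" and f: "f \<in> Aut F" and x: "x \<in> E"
  shows "f x \<in> E"
proof -
  have F: "subfield F \<Omega>" and E: "subfield E \<Omega>" and FE: "F \<subseteq> E"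
    using N by (auto simp: normal_extension_def)
  have xc: "x \<in> carrier \<Omega>" using x subfieldE(3)[OF E] by blast
  note I = IrrE[OF F xc algebraic_over[OF F xc]]
  have sp: "ring.splitted (\<Omega>\<lparr>carrier := E\<rparr>) (Irr F x)"
    using N I x unfolding normal_extension_def by blast
  have IF: "set (Irr F x) \<subseteq> F" using I(1) polynomial_incl unfolding sym[OF univ_poly_carrier] by auto
  have IE: "Irr F x \<in> carrier (E[X])"
    using I(1) FE unfolding sym[OF univ_poly_carrier] polynomial_def by auto
  show ?thesis
    using splitted_root_mem[OF E IE pirreducibleE(1)[OF subfieldE(1)[OF F] I(1,2)] sp]
      Gal_closed[OF Aut_in_Gal[OF f] xc] Aut_root[OF subfieldE(3)[OF F] f IF xc I(4)] by blast
qed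

text \<open>By transitivity on conjugates, all roots of \<open>p\<close> are images of
  \<open>x\<close> and lie in \<open>E\<close>. An irreducible factor over \<open>E\<close> of
  degree above one would have a root in the closure, hence in \<open>E\<close>, which is
  impossible.\<close>

lemma normal_extensionI:
  assumes F: "subfield F \<Omega>" and E: "subfield E \<Omega>" and FE: "F \<subseteq> E"
    and stable: "\<And>f x. f \<in> Aut F \<Longrightarrow> x \<in> E \<Longrightarrow> f x \<in> E"
  shows "normal_extension \<Omega> F E"
  unfolding normal_extension_def
proof (intro conjI ballI impI F E FE)
  fix x assume "x \<in> E"
  then show "(algebraic over F) x" using algebraic_over[OF F] subfieldE(3)[OF E] by blast
next
  fix p assume p: "p \<in> carrier (F[X])" and "pirreducible F p \<and> (\<exists>x\<in>E. eval p x = \<zero>)"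
  then obtain x where irr: "pirreducible F p" and x: "x \<in> E" "eval p x = \<zero>" by blast
  have xc: "x \<in> carrier \<Omega>" using x subfieldE(3)[OF E] by blast
  note alg = algebraic_over[OF F xc]
  note I = IrrE[OF F xc alg]
  interpret UPF: principal_domain "F[X]" using univ_poly_is_principal[OF F] .
  interpret EE: field "\<Omega>\<lparr>carrier := E\<rparr>" using subfield_iff(2)[OF E] .
  have EEp: "poly_ring (\<Omega>\<lparr>carrier := E\<rparr>) = E[X]"
    using univ_poly_consistent[OF subfieldE(1)[OF E]] by simp
  have "p \<in> PIdl\<^bsub>F[X]\<^esub> (Irr F x)"
    using Irr_generates_ker[OF F xc alg] p x(2) unfolding a_kernel_def' by auto
  then have "Irr F x \<sim>\<^bsub>F[X]\<^esub> p" using cgenideal_pirreducible[OF F I(1,2) irr] by simp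
  then have "p divides\<^bsub>F[X]\<^esub> Irr F x" by (simp add: associated_def)
  then have pI: "p pdivides Irr F x" using pdivides_iff_shell[OF F p I(1)] by simp
  have pc: "p \<in> carrier (poly_ring \<Omega>)" using carrier_polynomial_shell[OF subfieldE(1)[OF F] p] .
  have pE: "p \<in> carrier (E[X])" using p FE unfolding sym[OF univ_poly_carrier] polynomial_def by auto
  show "EE.splitted p"
  proof (rule EE.trivial_factors_imp_splitted)
    show "p \<in> carrier (poly_ring (\<Omega>\<lparr>carrier := E\<rparr>))" unfolding EEp by (rule pE)
    fix q assume q: "q \<in> carrier (poly_ring (\<Omega>\<lparr>carrier := E\<rparr>))"
      and qi: "pirreducible\<^bsub>\<Omega>\<lparr>carrier := E\<rparr>\<^esub> (carrier (\<Omega>\<lparr>carrier := E\<rparr>)) q" and qp: "q pdivides\<^bsub>\<Omega>\<lparr>carrier := E\<rparr>\<^esub> p"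
    show "degree q \<le> 1"
    proof (rule ccontr)
      assume deg: "\<not> degree q \<le> 1"
      have qE: "q \<in> carrier (E[X])" using q unfolding EEp .
      have qc: "q \<in> carrier (poly_ring \<Omega>)" using carrier_polynomial_shell[OF subfieldE(1)[OF E] qE] .
      obtain y where y: "y \<in> carrier \<Omega>" "eval q y = \<zero>" using exists_root[OF qc] deg by auto
      have "q divides\<^bsub>E[X]\<^esub> p" using qp unfolding pdivides_def EEp .
      then have "q pdivides p" using pdivides_iff_shell[OF E qE pE] by simp
      then have "eval p y = \<zero>" using pdivides_imp_root_sharing[OF qc _ y(1)] y(2) by simp
      then have "eval (Irr F x) y = \<zero>" using pdivides_imp_root_sharing[OF pc pI y(1)] by simp
      then obtain f where "f \<in> Aut F" "f x = y" using exists_conjugation[OF F xc y(1)] by blast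
      then have yE: "y \<in> E" using stable x(1) by blast
      have "EE.is_root q y"
        using yE y(2) deg eval_consistent[OF subfieldE(1)[OF E]] by (auto simp: EE.is_root_def)
      then have "y \<in># EE.roots q" using EE.roots_mem_iff_is_root[OF q] by simp
      then show False using EE.pirreducible_roots[OF q qi] deg by auto
    qed
  qed
qed

text \<open>Common source of \<open>ab_field M\<close>, where the pairs are the two orders of
  composition, and of the fixed field of one automorphism, paired with the identity.\<close>

lemma equalizer_subfield:
  assumes "\<And>f g. (f, g) \<in> S \<Longrightarrow> f \<in> ring_hom \<Omega> \<Omega> \<and> g \<in> ring_hom \<Omega> \<Omega>"
  shows "subfield {x \<in> carrier \<Omega>. \<forall>(f, g)\<in>S. f x = g x} \<Omega>" (is "subfield ?E \<Omega>")
proof -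
  have eq: "f z = g z" if "z \<in> ?E" "(f, g) \<in> S" for f g z using that by auto
  show ?thesis
  proof (rule subfieldI'[OF subringI])
    show "?E \<subseteq> carrier \<Omega>" by blast
    have "f \<one> = g \<one>" if "(f, g) \<in> S" for f g
      using ring_hom_one[of f \<Omega> \<Omega>] ring_hom_one[of g \<Omega> \<Omega>] assms[OF that] by simp
    then show "\<one> \<in> ?E" by auto
    fix x assume x: "x \<in> ?E"
    have "f (\<ominus> x) = g (\<ominus> x)" if "(f, g) \<in> S" for f g
      using hom_a_inv_subring[OF carrier_is_subring, of f x] hom_a_inv_subring[OF carrier_is_subring, of g x]
        assms[OF that] x eq[OF x that] by auto
    then show "\<ominus> x \<in> ?E" using x by auto
    fix y assume y: "y \<in> ?E"
    have "f (x \<otimes> y) = g (x \<otimes> y)" "f (x \<oplus> y) = g (x \<oplus> y)" if "(f, g) \<in> S" for f g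
      using ring_hom_mult[of f \<Omega> \<Omega> x y] ring_hom_mult[of g \<Omega> \<Omega> x y] ring_hom_add[of f \<Omega> \<Omega> x y]
        ring_hom_add[of g \<Omega> \<Omega> x y] assms[OF that] x y eq[OF x that] eq[OF y that] by auto
    then show "x \<otimes> y \<in> ?E" "x \<oplus> y \<in> ?E" using x y by auto
  next
    fix x assume x: "x \<in> ?E - {\<zero>}"
    then have xU: "x \<in> Units \<Omega>" and xc: "x \<in> carrier \<Omega>" using field_Units by auto
    have hom_inv: "f (inv x) = inv (f x)" if "f \<in> ring_hom \<Omega> \<Omega>" for f
    proof -
      have "f x \<otimes> f (inv x) = \<one>"
        using ring_hom_mult[OF that, of x "inv x"] xU xc ring_hom_one[OF that] by simp
      then show ?thesis using comm_inv_char[of "f x" "f (inv x)"] xU xc ring_hom_closed[OF that] by simp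
    qed
    have "f (inv x) = g (inv x)" if "(f, g) \<in> S" for f g
      using hom_inv[of f] hom_inv[of g] assms[OF that] eq[OF _ that, of x] x by simp
    then show "inv x \<in> ?E" using xU by auto
  qed
qed

end

section \<open>The maximal abelian extension\<close>

context rational_closure
begin

lemma Aut_inv_closed:
  assumes "F \<subseteq> carrier \<Omega>" "f \<in> Aut F" shows "inv\<^bsub>\<G>\<^esub> f \<in> Aut F"
  using subgroup.m_inv_closed[OF subgroup_Aut[OF assms(1)] assms(2)] .

text \<open>Surjectivity onto \<open>E\<close> is the point: it rests on stability under the inverse
  of \<open>f\<close>.\<close>

lemma Aut_restrict:
  assumes E: "subfield E \<Omega>" and FE: "F \<subseteq> E"
    and stable: "\<And>f x. f \<in> Aut F \<Longrightarrow> x \<in> E \<Longrightarrow> f x \<in> E" and f: "f \<in> Aut F"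
  shows "restrict f E \<in> carrier (Galois_group \<Omega> F E)"
proof -
  have Ec: "E \<subseteq> carrier \<Omega>" using subfieldE(3)[OF E] .
  have fG: "f \<in> carrier \<G>" using Aut_in_Gal[OF f] .
  note h = ring_hom_memE[OF Aut_hom[OF fG]]
  have if_: "inv\<^bsub>\<G>\<^esub> f \<in> Aut F" using Aut_inv_closed[OF _ f] FE Ec by blast
  have "inj_on f E"
    using endomorphism_bij[OF Aut_hom[OF fG]] Ec by (meson bij_betw_def inj_on_subset)
  moreover have "f ` E = E"
  proof
    show "f ` E \<subseteq> E" using stable[OF f] by blast
    show "E \<subseteq> f ` E"
    proof
      fix y assume y: "y \<in> E"
      then have "f ((inv\<^bsub>\<G>\<^esub> f) y) = y" using Gal_inv_apply(2)[OF fG] Ec by blast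
      then show "y \<in> f ` E" using stable[OF if_ y] by (metis image_eqI)
    qed
  qed
  ultimately have "bij_betw (restrict f E) E E" by (simp add: bij_betw_def)
  then have "restrict f E \<in> Bij E" by (simp add: Bij_def)
  moreover have "restrict f E \<in> ring_hom (\<Omega>\<lparr>carrier := E\<rparr>) (\<Omega>\<lparr>carrier := E\<rparr>)"
    by (rule ring_hom_memI) (use h stable[OF f] subringE[OF subfieldE(1)[OF E]] Ec in \<open>auto simp: subset_iff\<close>)
  moreover have "restrict f E x = x" if "x \<in> F" for x using that FE Aut_fixes[OF f that] by auto
  ultimately show ?thesis by (simp add: Galois_group_carrier)
qed

lemma Galois_group_lift:
  assumes E: "subfield E \<Omega>" and FE: "F \<subseteq> E" and s: "s \<in> carrier (Galois_group \<Omega> F E)"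
  obtains f where "f \<in> Aut F" "\<And>x. x \<in> E \<Longrightarrow> f x = s x"
proof -
  note h = ring_hom_memE[OF conjunct1[OF conjunct2[OF s[unfolded Galois_group_carrier]]]]
  have "s \<in> ring_hom (\<Omega>\<lparr>carrier := E\<rparr>) \<Omega>"
    by (rule ring_hom_memI) (use h subfieldE(3)[OF E] in auto)
  then show thesis
    using extend_to_Aut[OF E _ FE, of s] s that by (auto simp: Galois_group_carrier)
qed

text \<open>The fixed field of the commutator subgroup of \<open>Aut M\<close>.\<close>

definition ab_field :: "'a set \<Rightarrow> 'a set"
  where "ab_field M = {x \<in> carrier \<Omega>. \<forall>f\<in>Aut M. \<forall>g\<in>Aut M. f (g x) = g (f x)}"

lemma ab_fieldD: "x \<in> ab_field M \<Longrightarrow> f \<in> Aut M \<Longrightarrow> g \<in> Aut M \<Longrightarrow> f (g x) = g (f x)"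
  by (simp add: ab_field_def)

lemma subfield_ab_field: "subfield (ab_field M) \<Omega>"
proof -
  let ?S = "(\<lambda>(f, g). (f \<circ> g, g \<circ> f)) ` (Aut M \<times> Aut M)"
  have "subfield {x \<in> carrier \<Omega>. \<forall>(f, g)\<in>?S. f x = g x} \<Omega>"
  proof (rule equalizer_subfield)
    fix f g assume "(f, g) \<in> ?S"
    then obtain a b where "a \<in> Aut M" "b \<in> Aut M" "f = a \<circ> b" "g = b \<circ> a" by auto
    then show "f \<in> ring_hom \<Omega> \<Omega> \<and> g \<in> ring_hom \<Omega> \<Omega>"
      using ring_hom_trans[of a \<Omega> \<Omega> b \<Omega>] ring_hom_trans[of b \<Omega> \<Omega> a \<Omega>] by (simp add: Aut_iff)
  qed
  moreover have "{x \<in> carrier \<Omega>. \<forall>(f, g)\<in>?S. f x = g x} = ab_field M"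
    by (auto simp: ab_field_def)
  ultimately show ?thesis by simp
qed

lemma subset_ab_field: "M \<subseteq> carrier \<Omega> \<Longrightarrow> M \<subseteq> ab_field M"
  by (auto simp: ab_field_def Aut_fixes)

lemma ab_field_mono: "M \<subseteq> M' \<Longrightarrow> ab_field M \<subseteq> ab_field M'"
  using Aut_anti[of M M'] by (auto simp: ab_field_def subset_iff)

text \<open>Conjugation by \<open>g\<close> maps \<open>Aut M\<close> into itself since
  \<open>g\<close> preserves \<open>M\<close>. That the conjugates commute at \<open>x\<close> means
  that the original automorphisms commute at \<open>g x\<close>.\<close>

lemma ab_field_stable:
  assumes M: "M \<subseteq> carrier \<Omega>"
    and stable: "\<And>g x. g \<in> Aut k \<Longrightarrow> x \<in> M \<Longrightarrow> g x \<in> M"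
    and g: "g \<in> Aut k" and x: "x \<in> ab_field M"
  shows "g x \<in> ab_field M"
proof -
  interpret G: group \<G> by (rule group_Gal)
  have gG: "g \<in> carrier \<G>" using Aut_in_Gal[OF g] .
  have xc: "x \<in> carrier \<Omega>" using x by (simp add: ab_field_def)
  define c where "c f = inv\<^bsub>\<G>\<^esub> g \<otimes>\<^bsub>\<G>\<^esub> f \<otimes>\<^bsub>\<G>\<^esub> g" for f
  have c_apply: "c f z = (inv\<^bsub>\<G>\<^esub> g) (f (g z))" if "f \<in> Aut M" "z \<in> carrier \<Omega>" for f z
    using that gG Gal_closed[OF gG that(2)]
    by (simp add: c_def Gal_mult_apply Aut_in_Gal)
  have cA: "c f \<in> Aut M" if f: "f \<in> Aut M" for f
  proof -
    have "c f z = z" if "z \<in> M" for z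
      using c_apply[OF f, of z] Aut_fixes[OF f stable[OF g that]] Gal_inv_apply(1)[OF gG] that M by auto
    moreover have "c f \<in> carrier \<G>" using gG Aut_in_Gal[OF f] by (simp add: c_def)
    ultimately show ?thesis unfolding Aut_def by (simp add: Galois_group_carrier)
  qed
  have "f (h (g x)) = h (f (g x))" if f: "f \<in> Aut M" and h: "h \<in> Aut M" for f h
  proof -
    have fG: "f \<in> carrier \<G>" "h \<in> carrier \<G>" using f h Aut_in_Gal by auto
    have car: "g x \<in> carrier \<Omega>" "f (g x) \<in> carrier \<Omega>" "h (g x) \<in> carrier \<Omega>"
      "f (h (g x)) \<in> carrier \<Omega>" "h (f (g x)) \<in> carrier \<Omega>"
      using Gal_closed fG gG xc by simp_all
    have cl: "(inv\<^bsub>\<G>\<^esub> g) z \<in> carrier \<Omega>" if "z \<in> carrier \<Omega>" for z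
      using Gal_closed[OF G.inv_closed[OF gG] that] .
    have "c f (c h x) = c h (c f x)" using ab_fieldD[OF x cA[OF f] cA[OF h]] .
    then have "(inv\<^bsub>\<G>\<^esub> g) (f (h (g x))) = (inv\<^bsub>\<G>\<^esub> g) (h (f (g x)))"
      using f h xc car cl gG by (simp add: c_apply Gal_inv_apply)
    then have "g ((inv\<^bsub>\<G>\<^esub> g) (f (h (g x)))) = g ((inv\<^bsub>\<G>\<^esub> g) (h (f (g x))))" by simp
    then show ?thesis using car gG by (simp add: Gal_inv_apply)
  qed
  then show ?thesis using Gal_closed[OF gG xc] by (simp add: ab_field_def)
qed

lemma ab_field_stable_self:
  assumes "M \<subseteq> carrier \<Omega>" "g \<in> Aut M" "x \<in> ab_field M" shows "g x \<in> ab_field M"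
  by (rule ab_field_stable[OF assms(1) _ assms(2,3)]) (simp add: Aut_fixes)

lemma comm_group_ab_field:
  assumes M: "subfield M \<Omega>" shows "comm_group (Galois_group \<Omega> M (ab_field M))"
proof -
  note Mc = subfieldE(3)[OF M]
  interpret A: group "Galois_group \<Omega> M (ab_field M)"
    using group_Galois_group[OF subfieldE(1)[OF subfield_ab_field] subset_ab_field[OF Mc]] .
  show ?thesis
  proof (rule A.group_comm_groupI)
    fix a b assume a: "a \<in> carrier (Galois_group \<Omega> M (ab_field M))"
      and b: "b \<in> carrier (Galois_group \<Omega> M (ab_field M))"
    obtain f where f: "f \<in> Aut M" "\<And>x. x \<in> ab_field M \<Longrightarrow> f x = a x"
      using Galois_group_lift[OF subfield_ab_field subset_ab_field[OF Mc] a] by blast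
    obtain g where g: "g \<in> Aut M" "\<And>x. x \<in> ab_field M \<Longrightarrow> g x = b x"
      using Galois_group_lift[OF subfield_ab_field subset_ab_field[OF Mc] b] by blast
    have "a (b x) = b (a x)" if x: "x \<in> ab_field M" for x
      using ab_fieldD[OF x f(1) g(1)] ab_field_stable_self[OF Mc f(1) x]
        ab_field_stable_self[OF Mc g(1) x] f(2) g(2) x by simp
    then show "a \<otimes>\<^bsub>Galois_group \<Omega> M (ab_field M)\<^esub> b = b \<otimes>\<^bsub>Galois_group \<Omega> M (ab_field M)\<^esub> a"
      using a b by (auto simp: Galois_group_mult compose_def)
  qed
qed

text \<open>Automorphisms over \<open>M\<close> restrict to commuting maps on any abelian extension,
  which therefore lies in \<open>ab_field M\<close>; and \<open>ab_field M\<close> is itself abelian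
  over \<open>M\<close>. Membership in the compositum becomes a pointwise condition.\<close>

lemma max_abelian_extension_eq:
  assumes M: "subfield M \<Omega>" shows "max_abelian_extension \<Omega> M = ab_field M"
proof
  note Mc = subfieldE(3)[OF M]
  have "E \<subseteq> ab_field M" if ab: "abelian_extension \<Omega> M E" for E
  proof
    fix x assume x: "x \<in> E"
    have N: "normal_extension \<Omega> M E" and C: "comm_group (Galois_group \<Omega> M E)"
      using ab by (auto simp: abelian_extension_def)
    then have E: "subfield E \<Omega>" and ME: "M \<subseteq> E" by (auto simp: normal_extension_def)
    interpret C: comm_group "Galois_group \<Omega> M E" using C .
    note stable = normal_extension_stable[OF N]
    have "f (g x) = g (f x)" if f: "f \<in> Aut M" and g: "g \<in> Aut M" for f g
    proof -
      have r: "restrict f E \<in> carrier (Galois_group \<Omega> M E)" "restrict g E \<in> carrier (Galois_group \<Omega> M E)"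
        using Aut_restrict[OF E ME _ f] Aut_restrict[OF E ME _ g] stable by blast+
      from C.m_comm[OF r] have "compose E (restrict f E) (restrict g E) x = compose E (restrict g E) (restrict f E) x"
        using Galois_group_mult[OF r] Galois_group_mult[OF r(2,1)] by simp
      then show ?thesis using x stable[OF f x] stable[OF g x] by (simp add: compose_def)
    qed
    then show "x \<in> ab_field M" using x subfieldE(3)[OF E] by (auto simp: ab_field_def)
  qed
  then have "\<Union>{E. abelian_extension \<Omega> M E} \<subseteq> ab_field M" by blast
  then show "max_abelian_extension \<Omega> M \<subseteq> ab_field M"
    unfolding max_abelian_extension_def
    using generate_field_min_subfield1[OF _ subfield_ab_field] subfieldE(3)[OF subfield_ab_field]
    by (meson subset_trans)
  have "abelian_extension \<Omega> M (ab_field M)"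
    unfolding abelian_extension_def
    using normal_extensionI[OF M subfield_ab_field subset_ab_field[OF Mc]] ab_field_stable_self[OF Mc]
      comm_group_ab_field[OF M] by blast
  then show "ab_field M \<subseteq> max_abelian_extension \<Omega> M"
    unfolding max_abelian_extension_def by (auto intro: generate_field.incl)
qed

text \<open>Plays the part of the projection of \<open>Aut M\<close> to its abelianization; the
  target is abelian by \<open>comm_group_ab_field\<close>.\<close>

lemma restrict_ab_field_hom:
  assumes M: "subfield M \<Omega>"
  shows "(\<lambda>f. restrict f (ab_field M)) \<in> hom (\<G>\<lparr>carrier := Aut M\<rparr>) (Galois_group \<Omega> M (ab_field M))"
proof -
  note Mc = subfieldE(3)[OF M]
  note stable = ab_field_stable_self[OF Mc]
  have r: "restrict f (ab_field M) \<in> carrier (Galois_group \<Omega> M (ab_field M))" if "f \<in> Aut M" for f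
    by (rule Aut_restrict[OF subfield_ab_field subset_ab_field[OF Mc] _ that]) (rule stable)
  show ?thesis
  proof (rule homI; simp)
    fix f assume "f \<in> Aut M"
    then show "restrict f (ab_field M) \<in> carrier (Galois_group \<Omega> M (ab_field M))" by (rule r)
    fix g assume g: "g \<in> Aut M"
    have "(f \<otimes>\<^bsub>\<G>\<^esub> g) x = f (g x)" if "x \<in> ab_field M" for x
      using Gal_mult_apply \<open>f \<in> Aut M\<close> g that subfieldE(3)[OF subfield_ab_field]
      by (auto simp: Aut_in_Gal subset_iff)
    then show "restrict (f \<otimes>\<^bsub>\<G>\<^esub> g) (ab_field M) = restrict f (ab_field M) \<otimes>\<^bsub>Galois_group \<Omega> M (ab_field M)\<^esub> restrict g (ab_field M)"
      unfolding Galois_group_mult[OF r[OF \<open>f \<in> Aut M\<close>] r[OF g]]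
      using stable[OF g] by (auto simp: compose_def)
  qed
qed

end

section \<open>The transfer\<close>

text \<open>Think of \<open>S\<close> as \<open>G / B\<close>, with representatives \<open>s c\<close> and inverses \<open>u c\<close>; keeping
  \<open>u\<close> separate lets \<open>G\<close> be a subgroup without comparing its inverses with the ambient ones.\<close>

lemma transfer_hom:
  fixes act :: "'g \<Rightarrow> 'x \<Rightarrow> 'x"
  assumes G: "group G" and A: "comm_group A" and \<phi>: "\<phi> \<in> hom (G\<lparr>carrier := B\<rparr>) A"
    and S: "finite S"
    and act: "\<And>g c. g \<in> carrier G \<Longrightarrow> c \<in> S \<Longrightarrow> act g c \<in> S"
      "\<And>g h c. g \<in> carrier G \<Longrightarrow> h \<in> carrier G \<Longrightarrow> c \<in> S \<Longrightarrow> act (g \<otimes>\<^bsub>G\<^esub> h) c = act g (act h c)"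
      "\<And>c. c \<in> S \<Longrightarrow> act \<one>\<^bsub>G\<^esub> c = c"
    and s: "\<And>c. c \<in> S \<Longrightarrow> s c \<in> carrier G" "\<And>c. c \<in> S \<Longrightarrow> u c \<in> carrier G"
      "\<And>c. c \<in> S \<Longrightarrow> s c \<otimes>\<^bsub>G\<^esub> u c = \<one>\<^bsub>G\<^esub>"
      "\<And>g c. g \<in> carrier G \<Longrightarrow> c \<in> S \<Longrightarrow> u (act g c) \<otimes>\<^bsub>G\<^esub> g \<otimes>\<^bsub>G\<^esub> s c \<in> B"
  shows "(\<lambda>g. finprod A (\<lambda>c. \<phi> (u (act g c) \<otimes>\<^bsub>G\<^esub> g \<otimes>\<^bsub>G\<^esub> s c)) S) \<in> hom G A"
proof -
  interpret G: group G by (rule G)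
  interpret A: comm_group A by (rule A)
  define b where "b g c = u (act g c) \<otimes>\<^bsub>G\<^esub> g \<otimes>\<^bsub>G\<^esub> s c" for g c
  have bB: "b g c \<in> B" if "g \<in> carrier G" "c \<in> S" for g c using s(4)[OF that] by (simp add: b_def)
  have \<phi>A: "\<phi> (b g c) \<in> carrier A" if "g \<in> carrier G" "c \<in> S" for g c
    using hom_in_carrier[OF \<phi>, of "b g c"] bB[OF that] by simp
  have \<phi>m: "\<phi> (x \<otimes>\<^bsub>G\<^esub> y) = \<phi> x \<otimes>\<^bsub>A\<^esub> \<phi> y" if "x \<in> B" "y \<in> B" for x y
    using hom_mult[OF \<phi>, of x y] that by simp
  have "finprod A (\<lambda>c. \<phi> (b (g \<otimes>\<^bsub>G\<^esub> h) c)) S =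
      finprod A (\<lambda>c. \<phi> (b g c)) S \<otimes>\<^bsub>A\<^esub> finprod A (\<lambda>c. \<phi> (b h c)) S"
    if g: "g \<in> carrier G" and h: "h \<in> carrier G" for g h
  proof -
    have inj: "inj_on (act h) S"
    proof (rule inj_onI)
      fix c d assume cd: "c \<in> S" "d \<in> S" "act h c = act h d"
      have act_inv: "act (inv\<^bsub>G\<^esub> h) (act h x) = x" if "x \<in> S" for x
        using act(2)[of "inv\<^bsub>G\<^esub> h" h x] h that act(3)[OF that] by simp
      show "c = d"
        using arg_cong[OF cd(3), of "act (inv\<^bsub>G\<^esub> h)"] unfolding act_inv[OF cd(1)] act_inv[OF cd(2)] .
    qed
    have img: "act h ` S = S" using inj S act(1)[OF h] by (intro endo_inj_surj) auto
    \<comment> \<open>In the product of the two factors, \<open>s (act h c)\<close> meets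
      \<open>u (act h c)\<close> and cancels. This identity makes the transfer multiplicative up to
      a shift of the index.\<close>
    have cocycle: "b (g \<otimes>\<^bsub>G\<^esub> h) c = b g (act h c) \<otimes>\<^bsub>G\<^esub> b h c" if c: "c \<in> S" for c
    proof -
      have hc: "act h c \<in> S" "act g (act h c) \<in> S" using act(1) g h c by auto
      define v where "v = u (act g (act h c))"
      have v: "v \<in> carrier G" using s(2)[OF hc(2)] by (simp add: v_def)
      have "b g (act h c) \<otimes>\<^bsub>G\<^esub> b h c
          = v \<otimes>\<^bsub>G\<^esub> g \<otimes>\<^bsub>G\<^esub> (s (act h c) \<otimes>\<^bsub>G\<^esub> u (act h c)) \<otimes>\<^bsub>G\<^esub> (h \<otimes>\<^bsub>G\<^esub> s c)"
        unfolding b_def v_def[symmetric] using v s(1,2)[OF hc(1)] s(1)[OF c] g h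
        by (simp only: G.m_assoc G.m_closed G.inv_closed)
      also have "\<dots> = v \<otimes>\<^bsub>G\<^esub> g \<otimes>\<^bsub>G\<^esub> (h \<otimes>\<^bsub>G\<^esub> s c)"
        using v s(3)[OF hc(1)] s(1)[OF c] g h by simp
      also have "\<dots> = b (g \<otimes>\<^bsub>G\<^esub> h) c"
        unfolding b_def act(2)[OF g h c] v_def[symmetric] using v s(1)[OF c] g h
        by (simp add: G.m_assoc)
      finally show ?thesis by simp
    qed
    have "finprod A (\<lambda>c. \<phi> (b (g \<otimes>\<^bsub>G\<^esub> h) c)) S
        = finprod A (\<lambda>c. \<phi> (b g (act h c)) \<otimes>\<^bsub>A\<^esub> \<phi> (b h c)) S"
      using \<phi>A g h act(1) bB by (intro A.finprod_cong') (auto simp: cocycle \<phi>m)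
    also have "\<dots> = finprod A (\<lambda>c. \<phi> (b g (act h c))) S \<otimes>\<^bsub>A\<^esub> finprod A (\<lambda>c. \<phi> (b h c)) S"
      using \<phi>A g h act(1) by (intro A.finprod_multf) auto
    \<comment> \<open>The shift by \<open>h\<close> permutes \<open>S\<close> and is absorbed by the
      commutative product.\<close>
    also have "finprod A (\<lambda>c. \<phi> (b g (act h c))) S = finprod A (\<lambda>c. \<phi> (b g c)) (act h ` S)"
      using \<phi>A[OF g] inj img by (intro A.finprod_reindex[symmetric]) auto
    finally show ?thesis by (simp add: img)
  qed
  moreover have "finprod A (\<lambda>c. \<phi> (b g c)) S \<in> carrier A" if "g \<in> carrier G" for g
    using \<phi>A[OF that] by (intro A.finprod_closed) auto
  ultimately show ?thesis unfolding b_def by (intro homI) auto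
qed

text \<open>The order of the factors affects a product in \<open>G\<close>, but not its image in an
  abelian group. Hence one element serves all the homomorphisms at once.\<close>

lemma exists_product_over_abelian_homs:
  fixes A :: "'i \<Rightarrow> ('h, 'm) monoid_scheme"
  assumes "group G" and "finite Z" and "f \<in> Z \<rightarrow> carrier G"
    and "\<And>i. i \<in> I \<Longrightarrow> comm_group (A i)" "\<And>i. i \<in> I \<Longrightarrow> \<phi> i \<in> hom G (A i)"
  shows "\<exists>P\<in>carrier G. \<forall>i\<in>I. \<phi> i P = finprod (A i) (\<lambda>z. \<phi> i (f z)) Z"
  using assms(2,3)
proof (induction Z)
  case empty
  interpret G: group G by fact
  have "\<phi> i \<one>\<^bsub>G\<^esub> = \<one>\<^bsub>A i\<^esub>" if "i \<in> I" for i
    using hom_one[OF assms(5)[OF that] assms(1)] assms(4)[OF that] by (simp add: comm_group_def)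
  moreover have "finprod (A i) (\<lambda>z. \<phi> i (f z)) {} = \<one>\<^bsub>A i\<^esub>" if "i \<in> I" for i
    by (rule comm_monoid.finprod_empty[OF comm_group.axioms(1)[OF assms(4)[OF that]]])
  ultimately show ?case by (intro bexI[of _ "\<one>\<^bsub>G\<^esub>"]) auto
next
  case (insert z Z)
  interpret G: group G by fact
  obtain P where P: "P \<in> carrier G" "\<And>i. i \<in> I \<Longrightarrow> \<phi> i P = finprod (A i) (\<lambda>z. \<phi> i (f z)) Z"
    using insert by auto
  have fz: "f z \<in> carrier G" "f \<in> Z \<rightarrow> carrier G" using insert by auto
  have "\<phi> i (f z \<otimes>\<^bsub>G\<^esub> P) = finprod (A i) (\<lambda>z. \<phi> i (f z)) (insert z Z)" if i: "i \<in> I" for i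
  proof -
    interpret A: comm_group "A i" using assms(4)[OF i] .
    have c: "(\<lambda>z. \<phi> i (f z)) \<in> Z \<rightarrow> carrier (A i)" "\<phi> i (f z) \<in> carrier (A i)"
      using hom_in_carrier[OF assms(5)[OF i]] fz by auto
    show ?thesis
      using A.finprod_insert[OF insert(1,2) c] hom_mult[OF assms(5)[OF i] fz(1) P(1)] P(2)[OF i] by simp
  qed
  then show ?case using fz(1) P(1) by (intro bexI[of _ "f z \<otimes>\<^bsub>G\<^esub> P"]) auto
qed

lemma (in comm_group) finprod_pow:
  assumes "f \<in> S \<rightarrow> carrier G"
  shows "finprod G (\<lambda>c. f c [^] (n :: nat)) S = finprod G f S [^] n"
  using assms
proof (induction S rule: infinite_finite_induct)
  case (insert c S)
  then have "f c \<in> carrier G" "f \<in> S \<rightarrow> carrier G" by auto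
  moreover from this have "(\<lambda>c. f c [^] n) \<in> S \<rightarrow> carrier G" by auto
  ultimately show ?case using insert by (simp add: nat_pow_distrib)
qed auto

text \<open>Partition \<open>Z\<close> along \<open>\<pi>\<close>. This turns a product over the
  representatives of one quotient into a power of a transfer, which is a product over
  another.\<close>

lemma (in comm_group) finprod_equal_fibers:
  assumes Z: "finite Z" and S: "finite S" and \<pi>: "\<And>z. z \<in> Z \<Longrightarrow> \<pi> z \<in> S"
    and d: "\<And>c. c \<in> S \<Longrightarrow> card {z \<in> Z. \<pi> z = c} = d" and f: "f \<in> S \<rightarrow> carrier G"
  shows "finprod G (\<lambda>z. f (\<pi> z)) Z = finprod G f S [^] d"
proof -
  have Zeq: "Z = (\<Union>c\<in>S. {z \<in> Z. \<pi> z = c})" using \<pi> by auto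
  have "finprod G (\<lambda>z. f (\<pi> z)) Z = finprod G (\<lambda>z. f (\<pi> z)) (\<Union>c\<in>S. {z \<in> Z. \<pi> z = c})"
    using Zeq by simp
  also have "\<dots> = finprod G (\<lambda>c. finprod G (\<lambda>z. f (\<pi> z)) {z \<in> Z. \<pi> z = c}) S"
    using S Z f \<pi> by (intro finprod_UN_disjoint) (auto simp: pairwise_def disjnt_def)
  also have "\<dots> = finprod G (\<lambda>c. f c [^] d) S"
  proof (intro finprod_cong')
    fix c assume c: "c \<in> S"
    then have fc: "f c \<in> carrier G" using f by auto
    have "finprod G (\<lambda>z. f (\<pi> z)) {z \<in> Z. \<pi> z = c} = finprod G (\<lambda>z. f c) {z \<in> Z. \<pi> z = c}"
      using fc by (intro finprod_cong') auto
    then show "finprod G (\<lambda>z. f (\<pi> z)) {z \<in> Z. \<pi> z = c} = f c [^] d"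
      using finprod_const[OF fc, of "{z \<in> Z. \<pi> z = c}"] unfolding d[OF c] by (rule trans)
  qed (use f in auto)
  finally show ?thesis using finprod_pow[OF f] by simp
qed

section \<open>Primitive elements and disjoint extensions\<close>

context rational_closure
begin

lemma fixed_points_subfield:
  assumes "f \<in> carrier \<G>" shows "subfield {x \<in> carrier \<Omega>. f x = x} \<Omega>"
proof -
  have id: "(\<lambda>x. x) \<in> ring_hom \<Omega> \<Omega>" by (rule ring_hom_memI) auto
  show ?thesis using equalizer_subfield[of "{(f, \<lambda>x. x)}"] Aut_hom[OF assms] id by simp
qed

lemma Aut_generate_field:
  assumes H: "H \<subseteq> carrier \<Omega>" and f: "f \<in> Aut H" shows "f \<in> Aut (generate_field \<Omega> H)"
proof -
  have "generate_field \<Omega> H \<subseteq> {x \<in> carrier \<Omega>. f x = x}"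
    using generate_field_min_subfield1[OF H fixed_points_subfield[OF Aut_in_Gal[OF f]]] H Aut_fixes[OF f]
    by blast
  then show ?thesis using f by (auto simp: Aut_iff)
qed

text \<open>One element separates a finite spanning list, and the elements fixed by \<open>f\<close>
  form a subspace over \<open>M\<close>. Primitivity is stated with stabilizers because
  \<open>f \<mapsto> f \<theta>\<close> then identifies the cosets of \<open>Aut K\<close> in
  \<open>Aut M\<close> with an orbit.\<close>

lemma exists_primitive_element:
  assumes M: "subfield M \<Omega>" and K: "subfield K \<Omega>" and MK: "M \<subseteq> K" and fin: "finite_dimension M K"
  obtains \<theta> where "\<theta> \<in> K" "\<And>f. f \<in> Aut M \<Longrightarrow> f \<theta> = \<theta> \<Longrightarrow> f \<in> Aut K"
proof -
  obtain Us where Us: "set Us \<subseteq> carrier \<Omega>" "Span M Us = K"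
    using exists_base[OF M finite_dimensionE[OF M fin]] by blast
  have UK: "set Us \<subseteq> K" using Span_base_incl[OF M Us(1)] Us(2) by simp
  obtain \<theta> where \<theta>: "\<theta> \<in> generate_field \<Omega> (set Us)"
    "\<And>f y. f \<in> Aut M \<Longrightarrow> f \<theta> = \<theta> \<Longrightarrow> y \<in> set Us \<Longrightarrow> f y = y"
    using exists_separating_element[OF M finite_set Us(1)] by blast
  have "\<theta> \<in> K" using generate_field_min_subfield1[OF Us(1) K UK] \<theta>(1) by blast
  moreover have "f \<in> Aut K" if f: "f \<in> Aut M" "f \<theta> = \<theta>" for f
  proof -
    let ?V = "{x \<in> carrier \<Omega>. f x = x}"
    have V: "subfield ?V \<Omega>" using fixed_points_subfield[OF Aut_in_Gal[OF f(1)]] .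
    have MV: "M \<subseteq> ?V" using Aut_fixes[OF f(1)] subfieldE(3)[OF M] by blast
    have "subalgebra M ?V \<Omega>"
      unfolding subalgebra_def subalgebra_axioms_def
      using subring.axioms(1)[OF subfieldE(1)[OF V]] subringE(6)[OF subfieldE(1)[OF V]] MV by blast
    moreover have "set Us \<subseteq> ?V" using \<theta>(2)[OF f] Us(1) by blast
    ultimately have "K \<subseteq> ?V" using subalgebra_Span_incl[OF M] Us(2) by blast
    then show ?thesis using f(1) by (auto simp: Aut_iff)
  qed
  ultimately show thesis using that by blast
qed

text \<open>By \<open>fixed_field_Aut\<close>, \<open>K\<close> is
  \<open>simple_extension M \<theta>\<close>, whose degree is that of the minimal polynomial of
  \<open>\<theta>\<close>. This links the dimensions in the theorem to orbit sizes.\<close>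

lemma primitive_element_dim:
  assumes M: "subfield M \<Omega>" and K: "subfield K \<Omega>" and MK: "M \<subseteq> K"
    and \<theta>: "\<theta> \<in> K" "\<And>f. f \<in> Aut M \<Longrightarrow> f \<theta> = \<theta> \<Longrightarrow> f \<in> Aut K"
  shows "(dim over M) K = card ((\<lambda>f. f \<theta>) ` Aut M)"
proof -
  have \<theta>c: "\<theta> \<in> carrier \<Omega>" using \<theta>(1) subfieldE(3)[OF K] by blast
  let ?S = "simple_extension M \<theta>"
  have S: "subfield ?S \<Omega>" using simple_extension_is_subfield[OF M \<theta>c] algebraic_over[OF M \<theta>c] by simp
  have "K \<subseteq> ?S"
  proof
    fix x assume x: "x \<in> K"
    show "x \<in> ?S"
    proof (rule fixed_field_Aut[OF S])
      show "x \<in> carrier \<Omega>" using x subfieldE(3)[OF K] by blast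
      fix f assume f: "f \<in> Aut ?S"
      then have "f \<in> Aut M" using Aut_anti[OF simple_extension_incl[OF subfieldE(3)[OF M] \<theta>c]] by blast
      moreover have "f \<theta> = \<theta>" using Aut_fixes[OF f simple_extension_mem[OF subfieldE(1)[OF M] \<theta>c]] .
      ultimately show "f x = x" using Aut_fixes[OF \<theta>(2) x] by blast
    qed
  qed
  moreover have "?S \<subseteq> K" using simple_extension_subring_incl[OF subfieldE(1)[OF K] MK \<theta>(1)] .
  ultimately have "K = ?S" by blast
  then show ?thesis
    using simple_extension_dim[OF M \<theta>c algebraic_over[OF M \<theta>c]] degree_Irr_eq_card_orbit[OF M \<theta>c] by simp
qed

lemma card_Aut_orbit_pos:
  assumes "subfield M \<Omega>" "x \<in> carrier \<Omega>" shows "0 < card ((\<lambda>f. f x) ` Aut M)"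
  using finite_Aut_orbit[OF assms] Aut_orbit_self[OF subfieldE(3)[OF assms(1)] assms(2)]
  by (auto simp: card_gt_0_iff)

text \<open>The coefficients of the orbit polynomial lie in \<open>M \<inter> K\<close>.\<close>

lemma Aut_orbit_disjoint:
  assumes k: "subfield k \<Omega>" and M: "subfield M \<Omega>" and K: "subfield K \<Omega>" and MK: "M \<inter> K = k"
    and stable: "\<And>f x. f \<in> Aut k \<Longrightarrow> x \<in> M \<Longrightarrow> f x \<in> M" and x: "x \<in> M"
  shows "(\<lambda>f. f x) ` Aut k = (\<lambda>f. f x) ` Aut K"
proof
  let ?S = "(\<lambda>f. f x) ` Aut K"
  have KA: "Aut K \<subseteq> Aut k" using Aut_anti MK by blast
  then show "?S \<subseteq> (\<lambda>f. f x) ` Aut k" by blast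
  have xc: "x \<in> carrier \<Omega>" using x subfieldE(3)[OF M] by blast
  note fin = finite_Aut_orbit[OF K xc] note Sc = Aut_orbit_carrier[OF xc, of K]
  have SM: "?S \<subseteq> M" using stable x KA by blast
  have rK: "root_poly ?S \<in> carrier (K[X])"
    by (rule root_poly_Aut_stable[OF K fin Sc]) (rule Aut_orbit_stable[OF subfieldE(3)[OF K] xc])
  have rM: "root_poly ?S \<in> carrier (M[X])" using root_poly_polynomial[OF subfieldE(1)[OF M] fin SM] .
  have rk: "set (root_poly ?S) \<subseteq> k"
    using rK rM polynomial_incl MK unfolding sym[OF univ_poly_carrier] by blast
  have r0: "eval (root_poly ?S) x = \<zero>"
    using eval_root_poly_eq_zero_iff[OF fin Sc xc] Aut_orbit_self[OF subfieldE(3)[OF K] xc] by simp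
  show "(\<lambda>f. f x) ` Aut k \<subseteq> ?S"
  proof
    fix z assume "z \<in> (\<lambda>f. f x) ` Aut k"
    then obtain f where f: "f \<in> Aut k" "z = f x" by blast
    have "eval (root_poly ?S) z = \<zero>" using Aut_root[OF subfieldE(3)[OF k] f(1) rk xc r0] f(2) by simp
    then show "z \<in> ?S"
      using eval_root_poly_eq_zero_iff[OF fin Sc] Gal_closed[OF Aut_in_Gal[OF f(1)] xc] f(2) by simp
  qed
qed

text \<open>Supplies the continuity of the transfer: it fixes \<open>y\<close> as soon as each of
  its factors does.\<close>

lemma finprod_Galois_group_fixes:
  assumes A: "comm_group (Galois_group \<Omega> F E)" and a: "a \<in> S \<rightarrow> carrier (Galois_group \<Omega> F E)"
    and y: "y \<in> E" and fixes_y: "\<And>c. c \<in> S \<Longrightarrow> a c y = y"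
  shows "finprod (Galois_group \<Omega> F E) a S y = y"
  using a fixes_y
proof (induction S rule: infinite_finite_induct)
  case (infinite S)
  interpret A: comm_group "Galois_group \<Omega> F E" by fact
  show ?case using infinite y by (simp add: Galois_group_one)
next
  case empty
  interpret A: comm_group "Galois_group \<Omega> F E" by fact
  show ?case using y by (simp add: Galois_group_one)
next
  case (insert c S)
  interpret A: comm_group "Galois_group \<Omega> F E" by fact
  have aS: "a \<in> S \<rightarrow> carrier (Galois_group \<Omega> F E)" and ac: "a c \<in> carrier (Galois_group \<Omega> F E)"
    using insert.prems by auto
  have "finprod (Galois_group \<Omega> F E) a S y = y" using insert.IH aS insert.prems(2) by simp
  then show ?case
    using A.finprod_insert[OF insert.hyps(1,2) aS ac] Galois_group_mult[OF ac A.finprod_closed[OF aS]]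
      y insert.prems(2) by (simp add: compose_def)
qed

end

section \<open>Triviality of the transfer\<close>

context rational_closure
begin

lemma Aut_conj:
  assumes M: "M \<subseteq> carrier \<Omega>"
    and stable: "\<And>g x. g \<in> Aut k \<Longrightarrow> x \<in> M \<Longrightarrow> g x \<in> M"
    and g: "g \<in> Aut k" and f: "f \<in> Aut M"
  shows "inv\<^bsub>\<G>\<^esub> g \<otimes>\<^bsub>\<G>\<^esub> f \<otimes>\<^bsub>\<G>\<^esub> g \<in> Aut M"
proof -
  interpret G: group \<G> by (rule group_Gal)
  note gG = Aut_in_Gal[OF g] note fG = Aut_in_Gal[OF f]
  have "(inv\<^bsub>\<G>\<^esub> g \<otimes>\<^bsub>\<G>\<^esub> f \<otimes>\<^bsub>\<G>\<^esub> g) z = z" if z: "z \<in> M" for z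
  proof -
    have zc: "z \<in> carrier \<Omega>" using z M by blast
    show ?thesis
      using Gal_mult_apply[OF _ gG zc, of "inv\<^bsub>\<G>\<^esub> g \<otimes>\<^bsub>\<G>\<^esub> f"] gG fG
        Gal_mult_apply[OF G.inv_closed[OF gG] fG Gal_closed[OF gG zc]]
        Aut_fixes[OF f stable[OF g z]] Gal_inv_apply(1)[OF gG zc] by simp
  qed
  then show ?thesis using gG fG by (simp add: Aut_mem_iff)
qed

lemma Gal_conj_apply:
  assumes "g \<in> carrier \<G>" "f \<in> carrier \<G>" "h \<in> carrier \<G>" "x \<in> carrier \<Omega>"
  shows "(inv\<^bsub>\<G>\<^esub> g \<otimes>\<^bsub>\<G>\<^esub> f \<otimes>\<^bsub>\<G>\<^esub> h) x = (inv\<^bsub>\<G>\<^esub> g) (f (h x))"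
proof -
  interpret G: group \<G> by (rule group_Gal)
  show ?thesis using assms by (simp add: Gal_mult_apply Gal_closed)
qed

text \<open>\<open>S\<close> models the cosets of \<open>Aut M\<close> in \<open>Aut k\<close>, with
  representatives \<open>s c\<close>, and the product is the transfer of \<open>h\<close> to the
  group of \<open>ab_field M\<close> over \<open>M\<close>. That this is the identity is checked at
  each \<open>y\<close> separately, through the subgroup \<open>H\<close> of automorphisms whose
  transfer fixes \<open>y\<close>.\<close>

lemma transfer_trivial:
  assumes k: "subfield k \<Omega>" and M: "subfield M \<Omega>" and kM: "k \<subseteq> M"
    and Mst: "\<And>f x. f \<in> Aut k \<Longrightarrow> x \<in> M \<Longrightarrow> f x \<in> M"
    and \<theta>: "\<theta> \<in> M" "\<And>f. f \<in> Aut k \<Longrightarrow> f \<theta> = \<theta> \<Longrightarrow> f \<in> Aut M"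
    and S_def: "S = (\<lambda>f. f \<theta>) ` Aut k"
    and s: "\<And>c. c \<in> S \<Longrightarrow> s c \<in> Aut k \<and> s c \<theta> = c"
    and h: "h \<in> Aut M" "\<And>x. x \<in> ab_field k \<Longrightarrow> h x = x"
  shows "finprod (Galois_group \<Omega> M (ab_field M))
      (\<lambda>c. restrict (inv\<^bsub>\<G>\<^esub> (s c) \<otimes>\<^bsub>\<G>\<^esub> h \<otimes>\<^bsub>\<G>\<^esub> s c) (ab_field M)) S = \<one>\<^bsub>Galois_group \<Omega> M (ab_field M)\<^esub>"
proof -
  interpret G: group \<G> by (rule group_Gal)
  let ?A = "Galois_group \<Omega> M (ab_field M)" and ?Gk = "\<G>\<lparr>carrier := Aut k\<rparr>"
  interpret A: comm_group ?A using comm_group_ab_field[OF M] .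
  note kc = subfieldE(3)[OF k] note Mc = subfieldE(3)[OF M]
  note subk = subgroup_Aut[OF kc]
  interpret Gk: group ?Gk using subgroup.subgroup_is_group[OF subk G.group_axioms] .
  have \<theta>c: "\<theta> \<in> carrier \<Omega>" using \<theta>(1) Mc by blast
  have finS: "finite S" unfolding S_def using finite_Aut_orbit[OF k \<theta>c] .
  have Sc: "S \<subseteq> carrier \<Omega>" unfolding S_def using Aut_orbit_carrier[OF \<theta>c] .
  have SM: "S \<subseteq> M" unfolding S_def using Mst \<theta>(1) by blast
  have Sst: "f c \<in> S" if "f \<in> Aut k" "c \<in> S" for f c
    using Aut_orbit_stable[OF kc \<theta>c] that unfolding S_def by blast
  define \<phi> where "\<phi> f = restrict f (ab_field M)" for f :: "'a \<Rightarrow> 'a"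
  have \<phi>: "\<phi> \<in> hom (?Gk\<lparr>carrier := Aut M\<rparr>) ?A"
    using restrict_ab_field_hom[OF M] by (simp add: \<phi>_def[abs_def])
  have \<phi>c: "\<phi> f \<in> carrier ?A" if "f \<in> Aut M" for f
    using hom_in_carrier[OF \<phi>, of f] that by simp
  have sG: "s c \<in> carrier \<G>" if "c \<in> S" for c using s[OF that] Aut_in_Gal by blast
  \<comment> \<open>The general transfer factor. Taking the representative of \<open>g c\<close> on
    the left makes it fix \<open>\<theta>\<close>, so it belongs to \<open>Aut M\<close>.\<close>
  define b where "b g c = inv\<^bsub>\<G>\<^esub> (s (g c)) \<otimes>\<^bsub>\<G>\<^esub> g \<otimes>\<^bsub>\<G>\<^esub> s c" for g c
  have bM: "b g c \<in> Aut M" if g: "g \<in> Aut k" and c: "c \<in> S" for g c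
  proof (rule \<theta>(2))
    have gc: "g c \<in> S" using Sst[OF g c] .
    show "b g c \<in> Aut k" unfolding b_def
      using s[OF c] s[OF gc] g subgroup.m_closed[OF subk] subgroup.m_inv_closed[OF subk] by simp
    have "b g c \<theta> = (inv\<^bsub>\<G>\<^esub> (s (g c))) (g (s c \<theta>))"
      unfolding b_def using Gal_conj_apply[OF sG[OF gc] Aut_in_Gal[OF g] sG[OF c] \<theta>c] .
    then show "b g c \<theta> = \<theta>"
      using s[OF c] s[OF gc] Gal_inv_apply(1)[OF sG[OF gc] \<theta>c] by simp
  qed
  define V where "V g = finprod ?A (\<lambda>c. \<phi> (b g c)) S" for g
  have "(\<lambda>g. finprod ?A (\<lambda>c. \<phi> (inv\<^bsub>\<G>\<^esub> (s (g c)) \<otimes>\<^bsub>?Gk\<^esub> g \<otimes>\<^bsub>?Gk\<^esub> s c)) S) \<in> hom ?Gk ?A"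
  proof (rule transfer_hom[OF Gk.group_axioms A.comm_group_axioms \<phi> finS,
        where u = "\<lambda>c. inv\<^bsub>\<G>\<^esub> (s c)" and act = "\<lambda>g c. g c"])
    fix g c assume g: "g \<in> carrier ?Gk" and c: "c \<in> S"
    show "g c \<in> S" using Sst g c by simp
    show "inv\<^bsub>\<G>\<^esub> (s (g c)) \<otimes>\<^bsub>?Gk\<^esub> g \<otimes>\<^bsub>?Gk\<^esub> s c \<in> Aut M" using bM[of g c] g c by (simp add: b_def)
    fix h assume "h \<in> carrier ?Gk"
    then show "(g \<otimes>\<^bsub>?Gk\<^esub> h) c = g (h c)"
      using Gal_mult_apply[of g h c] g c Sc by (auto simp: Aut_in_Gal)
  next
    fix c assume c: "c \<in> S"
    show "\<one>\<^bsub>?Gk\<^esub> c = c" using Gal_one_apply c Sc by auto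
    show "s c \<otimes>\<^bsub>?Gk\<^esub> inv\<^bsub>\<G>\<^esub> (s c) = \<one>\<^bsub>?Gk\<^esub>" using sG[OF c] by simp
    show "s c \<in> carrier ?Gk" using s[OF c] by simp
    show "inv\<^bsub>\<G>\<^esub> (s c) \<in> carrier ?Gk" using s[OF c] subgroup.m_inv_closed[OF subk] by simp
  qed
  then have V: "V \<in> hom ?Gk ?A" by (simp add: V_def[abs_def] b_def)
  have Vc: "V g \<in> carrier ?A" if "g \<in> Aut k" for g using hom_in_carrier[OF V, of g] that by simp
  have Vm: "V (f \<otimes>\<^bsub>\<G>\<^esub> g) = V f \<otimes>\<^bsub>?A\<^esub> V g" if "f \<in> Aut k" "g \<in> Aut k" for f g
    using hom_mult[OF V, of f g] that by simp
  have V1: "V \<one>\<^bsub>\<G>\<^esub> = \<one>\<^bsub>?A\<^esub>" using hom_one[OF V Gk.group_axioms A.group_axioms] by simp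
  have hk: "h \<in> Aut k" using h(1) Aut_anti[OF kM] by blast
  have Vh_fixes: "V h y = y" if y: "y \<in> ab_field M" for y
  proof -
    define H where "H = {g \<in> Aut k. V g y = y}"
    have Vm_apply: "V (f \<otimes>\<^bsub>\<G>\<^esub> g) y = V f (V g y)" if "f \<in> Aut k" "g \<in> Aut k" for f g
      using Vm[OF that] Galois_group_mult[OF Vc[OF that(1)] Vc[OF that(2)]] y by (simp add: compose_def)
    have one_y: "\<one>\<^bsub>?A\<^esub> y = y" using y by (simp add: Galois_group_one)
    have inv_k: "inv\<^bsub>\<G>\<^esub> g \<in> Aut k" if "g \<in> Aut k" for g using subgroup.m_inv_closed[OF subk that] .
    have Vinv: "V (inv\<^bsub>\<G>\<^esub> g) \<otimes>\<^bsub>?A\<^esub> V g = \<one>\<^bsub>?A\<^esub>" if g: "g \<in> Aut k" for g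
      using Vm[OF inv_k[OF g] g] V1 Aut_in_Gal[OF g] by simp
    have "h \<in> H"
    \<comment> \<open>Why these points suffice: if \<open>f\<close> fixes \<open>S\<close>, the same
      representative stands on both sides of \<open>b f c\<close>, and if \<open>f\<close> also
      fixes \<open>s c y\<close>, then \<open>b f c\<close> fixes \<open>y\<close>.\<close>
    proof (rule mem_open_subgroup[OF k, where Y = "S \<union> (\<lambda>c. s c y) ` S"])
      show "subgroup H \<G>"
      proof (rule G.subgroupI)
        show "H \<subseteq> carrier \<G>" using Aut_in_Gal by (auto simp: H_def)
        have "\<one>\<^bsub>\<G>\<^esub> \<in> H" using subgroup.one_closed[OF subk] V1 one_y by (simp add: H_def)
        then show "H \<noteq> {}" by blast
        fix a assume "a \<in> H"
        then have a: "a \<in> Aut k" "V a y = y" by (auto simp: H_def)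
        have "V (inv\<^bsub>\<G>\<^esub> a) (V a y) = y"
          using Vm_apply[OF inv_k[OF a(1)] a(1)] V1 one_y Aut_in_Gal[OF a(1)] by simp
        then show "inv\<^bsub>\<G>\<^esub> a \<in> H" using inv_k[OF a(1)] a(2) by (simp add: H_def)
        fix c assume "c \<in> H"
        then show "a \<otimes>\<^bsub>\<G>\<^esub> c \<in> H"
          using a Vm_apply[OF a(1), of c] subgroup.m_closed[OF subk a(1), of c] by (simp add: H_def)
      qed
      show "H \<subseteq> Aut k" by (auto simp: H_def)
      show "finite (S \<union> (\<lambda>c. s c y) ` S)" using finS by simp
      have yc: "y \<in> carrier \<Omega>" using y by (simp add: ab_field_def)
      show "S \<union> (\<lambda>c. s c y) ` S \<subseteq> carrier \<Omega>" using Sc Gal_closed[OF sG yc] by blast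
      show "h \<in> Aut k" by (rule hk)
      show "f \<in> H" if f: "f \<in> Aut k" and fix_f: "\<And>z. z \<in> S \<union> (\<lambda>c. s c y) ` S \<Longrightarrow> f z = z" for f
      proof -
        have "\<phi> (b f c) y = y" if c: "c \<in> S" for c
        proof -
          have "b f c y = (inv\<^bsub>\<G>\<^esub> (s c)) (s c y)"
            unfolding b_def using Gal_conj_apply[OF _ Aut_in_Gal[OF f] sG[OF c] yc] sG[OF c]
              fix_f[of c] fix_f[of "s c y"] c by simp
          then show ?thesis using Gal_inv_apply(1)[OF sG[OF c] yc] y by (simp add: \<phi>_def)
        qed
        then have "V f y = y" unfolding V_def
          using \<phi>c bM[OF f] by (intro finprod_Galois_group_fixes[OF A.comm_group_axioms _ y]) auto
        then show ?thesis using f by (simp add: H_def)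
      qed
      show "h x = x" if x: "x \<in> carrier \<Omega>" and Hx: "\<And>f. f \<in> H \<Longrightarrow> f x = x" for x
      proof (rule h(2))
        \<comment> \<open>\<open>V\<close> takes the same value on both orders of the product, its
          target being abelian. So the quotient of the two, a commutator, lies in \<open>H\<close>
          and fixes \<open>x\<close>.\<close>
        have "f (g x) = g (f x)" if f: "f \<in> Aut k" and g: "g \<in> Aut k" for f g
        proof -
          note fG = Aut_in_Gal[OF f] note gG = Aut_in_Gal[OF g]
          let ?p = "f \<otimes>\<^bsub>\<G>\<^esub> g" and ?q = "g \<otimes>\<^bsub>\<G>\<^esub> f"
          have p: "?p \<in> Aut k" and q: "?q \<in> Aut k" using subgroup.m_closed[OF subk] f g by auto
          have "V ?p = V ?q" using Vm f g A.m_comm[OF Vc[OF f] Vc[OF g]] by simp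
          then have "V (inv\<^bsub>\<G>\<^esub> ?q \<otimes>\<^bsub>\<G>\<^esub> ?p) = \<one>\<^bsub>?A\<^esub>" using Vm[OF inv_k[OF q] p] Vinv[OF q] by simp
          then have "inv\<^bsub>\<G>\<^esub> ?q \<otimes>\<^bsub>\<G>\<^esub> ?p \<in> H"
            using subgroup.m_closed[OF subk inv_k[OF q] p] one_y by (simp add: H_def)
          then have "(inv\<^bsub>\<G>\<^esub> ?q \<otimes>\<^bsub>\<G>\<^esub> ?p) x = x" by (rule Hx)
          then have "(inv\<^bsub>\<G>\<^esub> ?q) (?p x) = x"
            using Gal_mult_apply[OF Aut_in_Gal[OF inv_k[OF q]] Aut_in_Gal[OF p] x] by simp
          then have "?q x = ?p x"
            using Gal_inv_apply(2)[OF Aut_in_Gal[OF q] Gal_closed[OF Aut_in_Gal[OF p] x]] by simp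
          then show ?thesis using Gal_mult_apply[OF fG gG x] Gal_mult_apply[OF gG fG x] by simp
        qed
        then show "x \<in> ab_field k" using x by (simp add: ab_field_def)
      qed
    qed
    then show ?thesis by (simp add: H_def)
  qed
  have "V h = \<one>\<^bsub>?A\<^esub>"
  proof
    fix y show "V h y = \<one>\<^bsub>?A\<^esub> y"
    proof (cases "y \<in> ab_field M")
      case True
      then show ?thesis using Vh_fixes by (simp add: Galois_group_one)
    next
      case False
      have "V h \<in> extensional (ab_field M)" using Vc[OF hk] by (simp add: Galois_group_carrier Bij_def)
      then show ?thesis using False by (simp add: Galois_group_one extensional_def)
    qed
  qed
  moreover have "V h = finprod ?A (\<lambda>c. restrict (inv\<^bsub>\<G>\<^esub> (s c) \<otimes>\<^bsub>\<G>\<^esub> h \<otimes>\<^bsub>\<G>\<^esub> s c) (ab_field M)) S"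
    unfolding V_def
  proof (rule A.finprod_cong')
    \<comment> \<open>\<open>h\<close> fixes \<open>c\<close>, an element of \<open>M\<close>, so
      the factor is a plain conjugate of \<open>h\<close>.\<close>
    have eq: "b h c = inv\<^bsub>\<G>\<^esub> (s c) \<otimes>\<^bsub>\<G>\<^esub> h \<otimes>\<^bsub>\<G>\<^esub> s c" if "c \<in> S" for c
      using Aut_fixes[OF h(1)] that SM by (auto simp: b_def)
    then show "\<phi> (b h c) = restrict (inv\<^bsub>\<G>\<^esub> (s c) \<otimes>\<^bsub>\<G>\<^esub> h \<otimes>\<^bsub>\<G>\<^esub> s c) (ab_field M)" if "c \<in> S" for c
      using that by (simp add: \<phi>_def)
    show "(\<lambda>c. restrict (inv\<^bsub>\<G>\<^esub> (s c) \<otimes>\<^bsub>\<G>\<^esub> h \<otimes>\<^bsub>\<G>\<^esub> s c) (ab_field M)) \<in> S \<rightarrow> carrier ?A"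
      using \<phi>c[OF bM[OF hk]] eq by (auto simp: \<phi>_def)
  qed simp
  ultimately show ?thesis by simp
qed

text \<open>Two orbits are compared: that of \<open>\<eta>\<close> for \<open>Aut N\<close> modulo
  \<open>Aut K\<close>, and that of \<open>\<theta>\<close> for \<open>Aut k\<close> modulo
  \<open>Aut M\<close>. By \<open>Aut_orbit_disjoint\<close> the group \<open>Aut N\<close> is
  already transitive on the second, and the equivariance of \<open>\<pi>\<close> makes all fibers
  equally large.\<close>

lemma transfer_trivial_fibers:
  assumes k: "subfield k \<Omega>" and M: "subfield M \<Omega>" and N: "subfield N \<Omega>" and MN: "M \<inter> N = k"
    and Mst: "\<And>f x. f \<in> Aut k \<Longrightarrow> x \<in> M \<Longrightarrow> f x \<in> M"
    and \<theta>: "\<theta> \<in> M" "\<And>f. f \<in> Aut k \<Longrightarrow> f \<theta> = \<theta> \<Longrightarrow> f \<in> Aut M"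
    and K: "subfield K \<Omega>" "M \<subseteq> K" "N \<subseteq> K"
    and \<eta>: "\<eta> \<in> K" "\<And>f. f \<in> Aut N \<Longrightarrow> f \<eta> = \<eta> \<Longrightarrow> f \<in> Aut K"
    and Z_def: "Z = (\<lambda>f. f \<eta>) ` Aut N"
    and t: "\<And>z. z \<in> Z \<Longrightarrow> t z \<in> Aut N \<and> t z \<eta> = z"
    and h: "h \<in> Aut K" "\<And>x. x \<in> ab_field k \<Longrightarrow> h x = x"
  shows "finprod (Galois_group \<Omega> M (ab_field M))
      (\<lambda>z. restrict (inv\<^bsub>\<G>\<^esub> (t z) \<otimes>\<^bsub>\<G>\<^esub> h \<otimes>\<^bsub>\<G>\<^esub> t z) (ab_field M)) Z = \<one>\<^bsub>Galois_group \<Omega> M (ab_field M)\<^esub>"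
proof -
  interpret G: group \<G> by (rule group_Gal)
  let ?A = "Galois_group \<Omega> M (ab_field M)"
  interpret A: comm_group ?A using comm_group_ab_field[OF M] .
  note kc = subfieldE(3)[OF k] note Mc = subfieldE(3)[OF M] note Nc = subfieldE(3)[OF N]
  have kM: "k \<subseteq> M" and kN: "k \<subseteq> N" using MN by auto
  note subN = subgroup_Aut[OF Nc] note subk = subgroup_Aut[OF kc]
  have Nk: "f \<in> Aut k" if "f \<in> Aut N" for f using that Aut_anti[OF kN] by blast
  have \<theta>c: "\<theta> \<in> carrier \<Omega>" using \<theta>(1) Mc by blast
  have \<eta>c: "\<eta> \<in> carrier \<Omega>" using \<eta>(1) subfieldE(3)[OF K(1)] by blast
  define S where "S = (\<lambda>f. f \<theta>) ` Aut k"
  have SN: "S = (\<lambda>f. f \<theta>) ` Aut N"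
    unfolding S_def by (rule Aut_orbit_disjoint[OF k M N MN _ \<theta>(1)]) (rule Mst)
  have finS: "finite S" unfolding S_def using finite_Aut_orbit[OF k \<theta>c] .
  have finZ: "finite Z" unfolding Z_def using finite_Aut_orbit[OF N \<eta>c] .
  have Zst: "g z \<in> Z" if "g \<in> Aut N" "z \<in> Z" for g z
    using Aut_orbit_stable[OF Nc \<eta>c] that unfolding Z_def by blast
  have Zc: "Z \<subseteq> carrier \<Omega>" unfolding Z_def using Aut_orbit_carrier[OF \<eta>c] .
  have "\<exists>f. f \<in> Aut k \<and> f \<theta> = c" if "c \<in> S" for c using that by (auto simp: S_def)
  then obtain s where s: "\<And>c. c \<in> S \<Longrightarrow> s c \<in> Aut k \<and> s c \<theta> = c" by metis
  have hM: "h \<in> Aut M" using h(1) Aut_anti[OF K(2)] by blast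
  define w where "w c = inv\<^bsub>\<G>\<^esub> (s c) \<otimes>\<^bsub>\<G>\<^esub> h \<otimes>\<^bsub>\<G>\<^esub> s c" for c
  define F where "F c = restrict (w c) (ab_field M)" for c
  have wM: "w c \<in> Aut M" if "c \<in> S" for c
    unfolding w_def by (rule Aut_conj[OF Mc _ _ hM]) (use s[OF that] Mst in auto)
  have FA: "F \<in> S \<rightarrow> carrier ?A"
    using hom_in_carrier[OF restrict_ab_field_hom[OF M]] wM by (auto simp: F_def)
  have prod_S: "finprod ?A F S = \<one>\<^bsub>?A\<^esub>"
    unfolding F_def w_def using k M kM Mst \<theta> S_def s hM h(2) by (rule transfer_trivial)
  define \<pi> where "\<pi> z = t z \<theta>" for z
  have tN: "t z \<in> Aut N" if "z \<in> Z" for z using t[OF that] by blast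
  have tG: "t z \<in> carrier \<G>" if "z \<in> Z" for z using tN[OF that] Aut_in_Gal by blast
  have \<pi>S: "\<pi> z \<in> S" if "z \<in> Z" for z using tN[OF that] by (auto simp: SN \<pi>_def)
  have F_eq: "restrict (inv\<^bsub>\<G>\<^esub> (t z) \<otimes>\<^bsub>\<G>\<^esub> h \<otimes>\<^bsub>\<G>\<^esub> t z) (ab_field M) = F (\<pi> z)" if z: "z \<in> Z" for z
  proof -
    let ?c = "\<pi> z"
    have sk: "s ?c \<in> Aut k" "s ?c \<theta> = ?c" using s[OF \<pi>S[OF z]] by auto
    have sG: "s ?c \<in> carrier \<G>" using Aut_in_Gal[OF sk(1)] .
    \<comment> \<open>\<open>t z\<close> and \<open>s ?c\<close> agree at \<open>\<theta>\<close>,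
      so they differ by an element \<open>n\<close> of \<open>Aut M\<close>. On
      \<open>ab_field M\<close> it commutes with \<open>w ?c\<close> and drops out of the
      conjugate.\<close>
    define n where "n = inv\<^bsub>\<G>\<^esub> (s ?c) \<otimes>\<^bsub>\<G>\<^esub> t z"
    have nk: "n \<in> Aut k" unfolding n_def
      using subgroup.m_closed[OF subk subgroup.m_inv_closed[OF subk sk(1)] Nk[OF tN[OF z]]] .
    have "n \<theta> = \<theta>" unfolding n_def
      using Gal_mult_apply[OF G.inv_closed[OF sG] tG[OF z] \<theta>c] Gal_inv_apply(1)[OF sG \<theta>c] sk(2)
      by (simp add: \<pi>_def)
    then have nM: "n \<in> Aut M" using \<theta>(2)[OF nk] by blast
    note nG = Aut_in_Gal[OF nM]
    have tn: "t z = s ?c \<otimes>\<^bsub>\<G>\<^esub> n" unfolding n_def using sG tG[OF z] by (simp add: G.m_assoc[symmetric])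
    have hG: "h \<in> carrier \<G>" using Aut_in_Gal[OF hM] .
    have conj_eq: "inv\<^bsub>\<G>\<^esub> (t z) \<otimes>\<^bsub>\<G>\<^esub> h \<otimes>\<^bsub>\<G>\<^esub> t z = inv\<^bsub>\<G>\<^esub> n \<otimes>\<^bsub>\<G>\<^esub> w ?c \<otimes>\<^bsub>\<G>\<^esub> n"
      unfolding tn w_def using sG nG hG by (simp add: G.inv_mult_group G.m_assoc)
    have "(inv\<^bsub>\<G>\<^esub> (t z) \<otimes>\<^bsub>\<G>\<^esub> h \<otimes>\<^bsub>\<G>\<^esub> t z) x = w ?c x" if x: "x \<in> ab_field M" for x
    proof -
      have xc: "x \<in> carrier \<Omega>" using x by (simp add: ab_field_def)
      note wG = Aut_in_Gal[OF wM[OF \<pi>S[OF z]]]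
      have "(inv\<^bsub>\<G>\<^esub> (t z) \<otimes>\<^bsub>\<G>\<^esub> h \<otimes>\<^bsub>\<G>\<^esub> t z) x = (inv\<^bsub>\<G>\<^esub> n) (w ?c (n x))"
        unfolding conj_eq using Gal_conj_apply[OF nG wG nG xc] .
      also have "w ?c (n x) = n (w ?c x)" using ab_fieldD[OF x wM[OF \<pi>S[OF z]] nM] .
      also have "(inv\<^bsub>\<G>\<^esub> n) (n (w ?c x)) = w ?c x" using Gal_inv_apply(1)[OF nG Gal_closed[OF wG xc]] .
      finally show ?thesis .
    qed
    then show ?thesis by (auto simp: F_def)
  qed
  have equiv: "\<pi> (g z) = g (\<pi> z)" if g: "g \<in> Aut N" and z: "z \<in> Z" for g z
  proof -
    have gz: "g z \<in> Z" using Zst[OF g z] .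
    note gG = Aut_in_Gal[OF g]
    \<comment> \<open>\<open>t (g z)\<close> and \<open>g\<close> after \<open>t z\<close> agree at
      \<open>\<eta>\<close>, so they differ by an element of \<open>Aut K\<close>; this one fixes
      \<open>\<theta>\<close> because \<open>M \<subseteq> K\<close>.\<close>
    define n where "n = inv\<^bsub>\<G>\<^esub> (t (g z)) \<otimes>\<^bsub>\<G>\<^esub> g \<otimes>\<^bsub>\<G>\<^esub> t z"
    have nN: "n \<in> Aut N" unfolding n_def
      using subgroup.m_closed[OF subN subgroup.m_closed[OF subN subgroup.m_inv_closed[OF subN tN[OF gz]] g] tN[OF z]] .
    have n_apply: "n x = (inv\<^bsub>\<G>\<^esub> (t (g z))) (g (t z x))" if "x \<in> carrier \<Omega>" for x
      unfolding n_def using Gal_conj_apply[OF tG[OF gz] gG tG[OF z] that] .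
    have "n \<eta> = \<eta>"
      using n_apply[OF \<eta>c] t[OF z] t[OF gz] Gal_inv_apply(1)[OF tG[OF gz] \<eta>c] by simp
    then have "n \<in> Aut K" using \<eta>(2)[OF nN] by blast
    then have "n \<theta> = \<theta>" using Aut_fixes \<theta>(1) K(2) by blast
    then have "(inv\<^bsub>\<G>\<^esub> (t (g z))) (g (t z \<theta>)) = \<theta>" using n_apply[OF \<theta>c] by simp
    then have "t (g z) \<theta> = g (t z \<theta>)"
      using Gal_inv_apply(2)[OF tG[OF gz] Gal_closed[OF gG Gal_closed[OF tG[OF z] \<theta>c]]] by simp
    then show ?thesis by (simp add: \<pi>_def)
  qed
  have \<theta>S: "\<theta> \<in> S" unfolding S_def using Aut_orbit_self[OF kc \<theta>c] .
  \<comment> \<open>Some \<open>g\<close> in \<open>Aut N\<close> carries \<open>\<theta>\<close> to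
    \<open>c\<close>; by equivariance \<open>g\<close> and its inverse map the two fibers into each
    other.\<close>
  have fibers: "card {z \<in> Z. \<pi> z = c} = card {z \<in> Z. \<pi> z = \<theta>}" if c: "c \<in> S" for c
  proof -
    obtain g where g: "g \<in> Aut N" "g \<theta> = c" using c unfolding SN by blast
    note gG = Aut_in_Gal[OF g(1)]
    have ig: "inv\<^bsub>\<G>\<^esub> g \<in> Aut N" using subgroup.m_inv_closed[OF subN g(1)] .
    have inj: "inj_on f Z" if "f \<in> Aut N" for f
      using endomorphism_bij[OF Aut_hom[OF Aut_in_Gal[OF that]]] Zc by (meson bij_betw_def inj_on_subset)
    show ?thesis
    proof (rule card_bij_eq)
      show "inj_on (inv\<^bsub>\<G>\<^esub> g) {z \<in> Z. \<pi> z = c}" by (rule inj_on_subset[OF inj[OF ig]]) auto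
      show "inj_on g {z \<in> Z. \<pi> z = \<theta>}" by (rule inj_on_subset[OF inj[OF g(1)]]) auto
      have "(inv\<^bsub>\<G>\<^esub> g) c = \<theta>" using Gal_inv_apply(1)[OF gG \<theta>c] g(2) by simp
      then show "(inv\<^bsub>\<G>\<^esub> g) ` {z \<in> Z. \<pi> z = c} \<subseteq> {z \<in> Z. \<pi> z = \<theta>}"
        using Zst[OF ig] equiv[OF ig] by auto
      show "g ` {z \<in> Z. \<pi> z = \<theta>} \<subseteq> {z \<in> Z. \<pi> z = c}"
        using Zst[OF g(1)] equiv[OF g(1)] g(2) by auto
    qed (use finZ in auto)
  qed
  have "finprod ?A (\<lambda>z. restrict (inv\<^bsub>\<G>\<^esub> (t z) \<otimes>\<^bsub>\<G>\<^esub> h \<otimes>\<^bsub>\<G>\<^esub> t z) (ab_field M)) Z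
      = finprod ?A (\<lambda>z. F (\<pi> z)) Z"
    using FA \<pi>S by (intro A.finprod_cong') (auto simp: F_eq)
  also have "\<dots> = finprod ?A F S [^]\<^bsub>?A\<^esub> card {z \<in> Z. \<pi> z = \<theta>}"
    using A.finprod_equal_fibers[OF finZ finS \<pi>S fibers FA] .
  finally show ?thesis using prod_S by simp
qed

text \<open>\<open>P\<close> is a norm of \<open>h\<close> from \<open>Aut K\<close> to
  \<open>Aut N\<close>: a product of conjugates in an unspecified order. Only its images in abelian
  groups count, so one \<open>P\<close> handles the family \<open>\<M>\<close> and \<open>N\<close>
  together.\<close>

lemma exists_norm_automorphism:
  assumes k: "subfield k \<Omega>" and N: "subfield N \<Omega>" and K: "subfield K \<Omega>" and NK: "N \<subseteq> K"
    and kN: "k \<subseteq> N" and Kst: "\<And>f x. f \<in> Aut k \<Longrightarrow> x \<in> K \<Longrightarrow> f x \<in> K"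
    and \<eta>: "\<eta> \<in> K" "\<And>f. f \<in> Aut N \<Longrightarrow> f \<eta> = \<eta> \<Longrightarrow> f \<in> Aut K"
    and h: "h \<in> Aut K" "\<And>x. x \<in> ab_field k \<Longrightarrow> h x = x"
    and L: "\<And>M. M \<in> \<M> \<Longrightarrow> subfield M \<Omega> \<and> M \<inter> N = k \<and> M \<subseteq> K \<and> finite_dimension k M"
      "\<And>M f x. M \<in> \<M> \<Longrightarrow> f \<in> Aut k \<Longrightarrow> x \<in> M \<Longrightarrow> f x \<in> M"
  obtains P where "P \<in> Aut K" "\<And>M x. M \<in> \<M> \<Longrightarrow> x \<in> ab_field M \<Longrightarrow> P x = x"
    "\<And>x. x \<in> ab_field N \<Longrightarrow> P x = (h ^^ card ((\<lambda>f. f \<eta>) ` Aut N)) x"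
proof -
  interpret G: group \<G> by (rule group_Gal)
  note Kc = subfieldE(3)[OF K] note kc = subfieldE(3)[OF k] note Nc = subfieldE(3)[OF N]
  let ?GK = "\<G>\<lparr>carrier := Aut K\<rparr>"
  interpret GK: group ?GK using subgroup.subgroup_is_group[OF subgroup_Aut[OF Kc] G.group_axioms] .
  define Z where "Z = (\<lambda>f. f \<eta>) ` Aut N"
  have \<eta>c: "\<eta> \<in> carrier \<Omega>" using \<eta>(1) Kc by blast
  have finZ: "finite Z" unfolding Z_def using finite_Aut_orbit[OF N \<eta>c] .
  have "\<exists>f. f \<in> Aut N \<and> f \<eta> = z" if "z \<in> Z" for z using that by (auto simp: Z_def)
  then obtain t where t: "\<And>z. z \<in> Z \<Longrightarrow> t z \<in> Aut N \<and> t z \<eta> = z" by metis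
  define w where "w z = inv\<^bsub>\<G>\<^esub> (t z) \<otimes>\<^bsub>\<G>\<^esub> h \<otimes>\<^bsub>\<G>\<^esub> t z" for z
  have wK: "w z \<in> Aut K" if z: "z \<in> Z" for z
    unfolding w_def by (rule Aut_conj[OF Kc _ _ h(1)]) (use t[OF z] Aut_anti[OF kN] Kst in auto)
  define A where "A M = Galois_group \<Omega> M (ab_field M)" for M
  define \<phi> where "\<phi> M f = restrict f (ab_field M)" for M and f :: "'a \<Rightarrow> 'a"
  have hom: "\<phi> M \<in> hom ?GK (A M)" if M: "subfield M \<Omega>" "M \<subseteq> K" for M
    using restrict_ab_field_hom[OF M(1)] Aut_anti[OF M(2)]
    unfolding A_def \<phi>_def[abs_def] hom_def by auto
  have comm: "comm_group (A M)" if "subfield M \<Omega>" for M unfolding A_def using comm_group_ab_field[OF that] .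
  have "\<exists>P\<in>carrier ?GK. \<forall>M\<in>insert N \<M>. \<phi> M P = finprod (A M) (\<lambda>z. \<phi> M (w z)) Z"
    by (rule exists_product_over_abelian_homs[OF GK.group_axioms finZ])
      (use wK hom comm N NK L(1) in auto)
  then obtain P where P: "P \<in> Aut K" "\<And>M. M \<in> insert N \<M> \<Longrightarrow> \<phi> M P = finprod (A M) (\<lambda>z. \<phi> M (w z)) Z"
    by auto
  have "P x = x" if M: "M \<in> \<M>" and x: "x \<in> ab_field M" for M x
  proof -
    have Ms: "subfield M \<Omega>" "M \<inter> N = k" "M \<subseteq> K" "finite_dimension k M" using L(1)[OF M] by auto
    obtain \<theta> where \<theta>: "\<theta> \<in> M" "\<And>f. f \<in> Aut k \<Longrightarrow> f \<theta> = \<theta> \<Longrightarrow> f \<in> Aut M"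
      using exists_primitive_element[OF k Ms(1) _ Ms(4)] Ms(2) by blast
    have "finprod (A M) (\<lambda>z. \<phi> M (w z)) Z = \<one>\<^bsub>A M\<^esub>"
      unfolding A_def \<phi>_def w_def
      using k Ms(1) N Ms(2) L(2)[OF M] \<theta> K Ms(3) NK \<eta> Z_def t h by (rule transfer_trivial_fibers)
    then have "\<phi> M P x = x" using P(2)[of M] M x by (simp add: A_def Galois_group_one)
    then show ?thesis using x by (simp add: \<phi>_def)
  qed
  moreover have "P x = (h ^^ card Z) x" if x: "x \<in> ab_field N" for x
  proof -
    interpret AN: comm_group "A N" using comm[OF N] .
    have hN: "h \<in> Aut N" using h(1) Aut_anti[OF NK] by blast
    have \<phi>h: "\<phi> N h \<in> carrier (A N)" using hom_in_carrier[OF hom[OF N NK], of h] h(1) by simp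
    \<comment> \<open>On \<open>ab_field N\<close> the conjugating \<open>t z\<close> commutes with
      \<open>h\<close>, both lying in \<open>Aut N\<close>, so each factor acts as
      \<open>h\<close>.\<close>
    have "\<phi> N (w z) = \<phi> N h" if z: "z \<in> Z" for z
    proof -
      have tz: "t z \<in> Aut N" using t[OF z] by blast
      note tG = Aut_in_Gal[OF tz] note hG = Aut_in_Gal[OF hN]
      have "w z y = h y" if y: "y \<in> ab_field N" for y
      proof -
        have yc: "y \<in> carrier \<Omega>" using y by (simp add: ab_field_def)
        have "w z y = (inv\<^bsub>\<G>\<^esub> (t z)) (h (t z y))" unfolding w_def using Gal_conj_apply[OF tG hG tG yc] .
        also have "h (t z y) = t z (h y)" using ab_fieldD[OF y hN tz] .
        also have "(inv\<^bsub>\<G>\<^esub> (t z)) (t z (h y)) = h y" using Gal_inv_apply(1)[OF tG Gal_closed[OF hG yc]] .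
        finally show ?thesis .
      qed
      then show ?thesis by (auto simp: \<phi>_def)
    qed
    then have "finprod (A N) (\<lambda>z. \<phi> N (w z)) Z = finprod (A N) (\<lambda>z. \<phi> N h) Z"
      using \<phi>h by (intro AN.finprod_cong') auto
    then have "\<phi> N P = \<phi> N h [^]\<^bsub>A N\<^esub> card Z" using P(2)[of N] AN.finprod_const[OF \<phi>h] by simp
    then have "\<phi> N P x = (\<phi> N h ^^ card Z) x"
      using Galois_group_pow[OF subfieldE(1)[OF subfield_ab_field] subset_ab_field[OF Nc] \<phi>h[unfolded A_def] x, of "card Z"]
      by (simp add: A_def)
    then have "P x = (\<phi> N h ^^ card Z) x" using x by (simp add: \<phi>_def)
    \<comment> \<open>\<open>h\<close> preserves \<open>ab_field N\<close>, so iterating the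
      restriction is restricting the iterate.\<close>
    moreover have "(\<phi> N h ^^ n) x = (h ^^ n) x \<and> (h ^^ n) x \<in> ab_field N" for n
      using x ab_field_stable_self[OF Nc hN] by (induction n) (auto simp: \<phi>_def)
    ultimately show ?thesis by simp
  qed
  ultimately show thesis using P(1) that unfolding Z_def by blast
qed

end

section \<open>The annihilator\<close>

text \<open>\<open>LEAST\<close> is meaningful only once some number annihilates, which is why
  finiteness of the group is proved in the theorem.\<close>

lemma annihilates_group_exponent:
  assumes "annihilates n G" shows "annihilates (group_exponent G) G"
  unfolding group_exponent_def by (rule LeastI[of "\<lambda>n. annihilates n G", OF assms])

context rational_closure
begin

text \<open>The image of the generated field under the inverse of \<open>f\<close> is a subfield
  that contains \<open>H\<close>, hence contains the generated field.\<close>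

lemma generate_field_stable:
  assumes H: "H \<subseteq> carrier \<Omega>" and f: "f \<in> carrier \<G>"
    and fH: "\<And>x. x \<in> H \<Longrightarrow> f x \<in> generate_field \<Omega> H" and x: "x \<in> generate_field \<Omega> H"
  shows "f x \<in> generate_field \<Omega> H"
proof -
  interpret G: group \<G> by (rule group_Gal)
  let ?D = "generate_field \<Omega> H"
  note D = generate_field_is_subfield[OF H]
  interpret f': ring_hom_ring \<Omega> \<Omega> "inv\<^bsub>\<G>\<^esub> f" using Gal_ring_hom_ring[OF G.inv_closed[OF f]] .
  have "subfield ((inv\<^bsub>\<G>\<^esub> f) ` ?D) \<Omega>" using f'.img_is_subfield(2)[OF D one_not_zero] .
  moreover have "H \<subseteq> (inv\<^bsub>\<G>\<^esub> f) ` ?D"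
  proof
    fix y assume y: "y \<in> H"
    then have "(inv\<^bsub>\<G>\<^esub> f) (f y) = y" using Gal_inv_apply(1)[OF f] H by blast
    then show "y \<in> (inv\<^bsub>\<G>\<^esub> f) ` ?D" using fH[OF y] by (metis image_eqI)
  qed
  ultimately have "x \<in> (inv\<^bsub>\<G>\<^esub> f) ` ?D" using generate_field_min_subfield1[OF H] x by blast
  then obtain d where "d \<in> ?D" "x = (inv\<^bsub>\<G>\<^esub> f) d" by blast
  then show ?thesis using Gal_inv_apply(2)[OF f] subfieldE(3)[OF D] by auto
qed

text \<open>Adjoining a primitive element of each \<open>K i\<close> already gives the compositum:
  an automorphism over \<open>k\<close> that fixes these elements fixes each \<open>K i\<close>, and
  \<open>fixed_field_Aut\<close> applies.\<close>

lemma finite_dimension_compositum: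
  assumes k: "subfield k \<Omega>" and I: "finite I"
    and K: "\<And>i. i \<in> I \<Longrightarrow> subfield (K i) \<Omega>" "\<And>i. i \<in> I \<Longrightarrow> k \<subseteq> K i"
      "\<And>i. i \<in> I \<Longrightarrow> finite_dimension k (K i)" and ne: "I \<noteq> {}"
  shows "finite_dimension k (generate_field \<Omega> (\<Union>i\<in>I. K i))"
proof -
  have "\<exists>t. t \<in> K i \<and> (\<forall>f\<in>Aut k. f t = t \<longrightarrow> f \<in> Aut (K i))" if "i \<in> I" for i
    using exists_primitive_element[OF k K(1)[OF that] K(2)[OF that] K(3)[OF that]] by metis
  then obtain \<theta> where \<theta>: "\<And>i. i \<in> I \<Longrightarrow> \<theta> i \<in> K i"
    "\<And>i f. i \<in> I \<Longrightarrow> f \<in> Aut k \<Longrightarrow> f (\<theta> i) = \<theta> i \<Longrightarrow> f \<in> Aut (K i)" by metis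
  obtain xs where xs: "set xs = \<theta> ` I" using I finite_list by (metis finite_imageI)
  have UC: "(\<Union>i\<in>I. K i) \<subseteq> carrier \<Omega>" using K(1) subfieldE(3) by blast
  have xc: "set xs \<subseteq> carrier \<Omega>" using xs \<theta>(1) UC by auto
  have alg: "\<And>x. x \<in> set xs \<Longrightarrow> (algebraic over k) x" using algebraic_over[OF k] xc by blast
  let ?F = "finite_extension k xs" and ?D = "generate_field \<Omega> (\<Union>i\<in>I. K i)"
  have F: "subfield ?F \<Omega>" using finite_extension_is_subfield[OF k xc alg] .
  note D = generate_field_is_subfield[OF UC]
  have kF: "k \<subseteq> ?F" using finite_extension_incl[OF subfieldE(3)[OF k] xc] .
  have xF: "set xs \<subseteq> ?F" using finite_extension_mem[OF subfieldE(1)[OF k] xc] .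
  have "K i \<subseteq> ?F" if i: "i \<in> I" for i
  proof
    fix x assume x: "x \<in> K i"
    show "x \<in> ?F"
    proof (rule fixed_field_Aut[OF F])
      show "x \<in> carrier \<Omega>" using x UC i by blast
      fix f assume f: "f \<in> Aut ?F"
      have "\<theta> i \<in> ?F" using xF xs i by blast
      then have "f \<in> Aut (K i)" using \<theta>(2)[OF i] f Aut_anti[OF kF] Aut_fixes[OF f] by blast
      then show "f x = x" using Aut_fixes x by blast
    qed
  qed
  then have DF: "?D \<subseteq> ?F" using generate_field_min_subfield1[OF UC F] by blast
  have KD: "K i \<subseteq> ?D" if "i \<in> I" for i using that generate_field.incl[of _ "\<Union>i\<in>I. K i" \<Omega>] by blast
  obtain i where "i \<in> I" using ne by blast
  then have "k \<subseteq> ?D" using KD K(2) by blast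
  moreover have "set xs \<subseteq> ?D" using xs \<theta>(1) KD by auto
  ultimately have "?F \<subseteq> ?D" by (rule finite_extension_subring_incl[OF subfieldE(1)[OF D]])
  then have "?D = ?F" using DF by blast
  then show ?thesis using finite_extension_finite_dimension(1)[OF k xc alg] by simp
qed

end

theorem theorem1p1:
  fixes \<Omega> :: "('a, 'b) ring_scheme" (structure)
    and k :: "'a set" and K :: "nat \<Rightarrow> 'a set" and r :: nat and KK L :: "'a set"
  assumes "rational_closure \<Omega>"
    and "number_field \<Omega> k"
    and "2 \<le> r"
    and "\<And>i. i \<in> {1..r} \<Longrightarrow> normal_extension \<Omega> k (K i)"
    and "\<And>i. i \<in> {1..r} \<Longrightarrow> (ring.finite_dimension \<Omega> over k) (K i)"
    and "\<And>i j. i \<in> {1..r} \<Longrightarrow> j \<in> {1..r} \<Longrightarrow> i \<noteq> j \<Longrightarrow> K i \<inter> K j = k"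
    and "KK = generate_field \<Omega> (\<Union>i\<in>{1..r}. K i)"
    and "L = generate_field \<Omega> (K r \<union> (\<Union>i\<in>{1..r - 1}. max_abelian_extension \<Omega> (K i)))"
  shows "annihilates
    (group_exponent
       (Galois_group \<Omega>
          (generate_field \<Omega> (K r \<union> max_abelian_extension \<Omega> k))
          (generate_field \<Omega> (KK \<union> max_abelian_extension \<Omega> k)))
     * Lcm {(ring.dim \<Omega> over K i) KK * (ring.dim \<Omega> over k) (K j) | i j.
              i \<in> {1..r} \<and> j \<in> {1..r} \<and> i \<noteq> j})
    (Galois_group \<Omega>
       (generate_field \<Omega> (K r \<union> max_abelian_extension \<Omega> k))
       (max_abelian_extension \<Omega> (K r) \<inter> L))"
proof -
  interpret rational_closure \<Omega> by fact
  interpret G: group \<G> by (rule group_Gal)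
  have k: "subfield k \<Omega>" using assms(2) by (simp add: number_field_def)
  note kc = subfieldE(3)[OF k]
  have Ki: "subfield (K i) \<Omega>" "k \<subseteq> K i" "finite_dimension k (K i)" if "i \<in> {1..r}" for i
    using assms(4,5)[OF that] by (auto simp: normal_extension_def over_def)
  have Kst: "f x \<in> K i" if "i \<in> {1..r}" "f \<in> Aut k" "x \<in> K i" for i f x
    using normal_extension_stable[OF assms(4)[OF that(1)] that(2,3)] .
  have rr: "r \<in> {1..r}" "1 \<in> {1..r}" "1 \<noteq> r" using assms(3) by auto
  have UC: "(\<Union>i\<in>{1..r}. K i) \<subseteq> carrier \<Omega>" using Ki(1) subfieldE(3) by blast
  have KK: "subfield KK \<Omega>" using generate_field_is_subfield[OF UC] assms(7) by simp
  note KKc = subfieldE(3)[OF KK]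
  have KiKK: "K i \<subseteq> KK" if "i \<in> {1..r}" for i
    unfolding assms(7) using that generate_field.incl[of _ "\<Union>i\<in>{1..r}. K i" \<Omega>] by blast
  have kKK: "k \<subseteq> KK" using Ki(2)[OF rr(1)] KiKK[OF rr(1)] by blast
  have KKst: "f x \<in> KK" if f: "f \<in> Aut k" and x: "x \<in> KK" for f x
    unfolding assms(7)
  proof (rule generate_field_stable[OF UC Aut_in_Gal[OF f]])
    show "x \<in> generate_field \<Omega> (\<Union>i\<in>{1..r}. K i)" using x assms(7) by simp
    fix y assume "y \<in> (\<Union>i\<in>{1..r}. K i)"
    then have "f y \<in> (\<Union>i\<in>{1..r}. K i)" using Kst f by blast
    then show "f y \<in> generate_field \<Omega> (\<Union>i\<in>{1..r}. K i)" by (rule generate_field.incl)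
  qed
  have "finite_dimension k KK"
    unfolding assms(7) by (rule finite_dimension_compositum[OF k]) (use Ki rr in auto)
  then obtain \<eta> where \<eta>: "\<eta> \<in> KK" "\<And>f. f \<in> Aut k \<Longrightarrow> f \<eta> = \<eta> \<Longrightarrow> f \<in> Aut KK"
    using exists_primitive_element[OF k KK kKK] by blast
  have \<eta>c: "\<eta> \<in> carrier \<Omega>" using \<eta>(1) KKc by blast
  \<comment> \<open>Being primitive over \<open>k\<close>, \<open>\<eta>\<close> is primitive over
    every \<open>K i\<close>, so its orbits measure all the degrees of \<open>KK\<close>.\<close>
  have \<eta>i: "f \<in> Aut KK" if "i \<in> {1..r}" "f \<in> Aut (K i)" "f \<eta> = \<eta>" for i f
    using \<eta>(2)[of f] that(3) Aut_anti[OF Ki(2)[OF that(1)]] that(2) by blast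
  have dimKK: "(dim over K i) KK = card ((\<lambda>f. f \<eta>) ` Aut (K i))" if i: "i \<in> {1..r}" for i
    using Ki(1)[OF i] KK KiKK[OF i] \<eta>(1) \<eta>i[OF i] by (rule primitive_element_dim)
  have dimKK_pos: "0 < (dim over K i) KK" if i: "i \<in> {1..r}" for i
    using dimKK[OF i] card_Aut_orbit_pos[OF Ki(1)[OF i] \<eta>c] by simp
  have dimK_pos: "0 < (dim over k) (K i)" if i: "i \<in> {1..r}" for i
  proof -
    obtain t where t: "t \<in> K i" "\<And>f. f \<in> Aut k \<Longrightarrow> f t = t \<Longrightarrow> f \<in> Aut (K i)"
      using exists_primitive_element[OF k Ki[OF i]] by blast
    have tc: "t \<in> carrier \<Omega>" using t(1) subfieldE(3)[OF Ki(1)[OF i]] by blast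
    have "(dim over k) (K i) = card ((\<lambda>f. f t) ` Aut k)"
      using k Ki(1,2)[OF i] t by (rule primitive_element_dim)
    then show ?thesis using card_Aut_orbit_pos[OF k tc] by simp
  qed

  \<comment> \<open>The least common multiple and its divisor \<open>m\<close>\<close>
  define D where "D = {(dim over K i) KK * (dim over k) (K j) | i j. i \<in> {1..r} \<and> j \<in> {1..r} \<and> i \<noteq> j}"
  define m where "m = (dim over K r) KK"
  have "D \<subseteq> (\<lambda>(i, j). (dim over K i) KK * (dim over k) (K j)) ` ({1..r} \<times> {1..r})"
    by (auto simp: D_def)
  then have finD: "finite D" by (rule finite_subset) simp
  have "0 \<notin> D" using dimKK_pos dimK_pos by (auto simp: D_def)
  \<comment> \<open>Positivity is part of \<open>annihilates\<close>, and an \<open>Lcm\<close>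
    vanishes for a set that is infinite or contains zero.\<close>
  then have Lcm_pos: "0 < Lcm D" using Lcm_0_iff[OF finD] by (intro gr0I) simp
  \<comment> \<open>The pair \<open>i = r\<close>, \<open>j = 1\<close>, distinct because
    \<open>2 \<le> r\<close>.\<close>
  have "m * (dim over k) (K 1) \<in> D" using rr by (auto simp: D_def m_def)
  then have m_dvd: "m dvd Lcm D" by (meson dvd_Lcm dvd_mult_left)

  \<comment> \<open>The fields \<open>F\<close>, \<open>E'\<close> and \<open>E\<close> of the two
    Galois groups\<close>
  note ab_eq = max_abelian_extension_eq[OF k] max_abelian_extension_eq[OF Ki(1)]
  define F where "F = generate_field \<Omega> (K r \<union> ab_field k)"
  define E' where "E' = generate_field \<Omega> (KK \<union> ab_field k)"
  define E where "E = ab_field (K r) \<inter> L"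
  have abc: "ab_field M \<subseteq> carrier \<Omega>" for M by (auto simp: ab_field_def)
  have L_eq: "L = generate_field \<Omega> (K r \<union> (\<Union>i\<in>{1..r - 1}. ab_field (K i)))"
  proof -
    have "max_abelian_extension \<Omega> (K i) = ab_field (K i)" if "i \<in> {1..r - 1}" for i
      using ab_eq(2)[of i] that by auto
    then show ?thesis unfolding assms(8) by simp
  qed
  have F_carrier: "K r \<union> ab_field k \<subseteq> carrier \<Omega>" using subfieldE(3)[OF Ki(1)[OF rr(1)]] abc by blast
  have E'_carrier: "KK \<union> ab_field k \<subseteq> carrier \<Omega>" using KKc abc by blast
  have L_carrier: "K r \<union> (\<Union>i\<in>{1..r - 1}. ab_field (K i)) \<subseteq> carrier \<Omega>"
    using subfieldE(3)[OF Ki(1)[OF rr(1)]] abc by blast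
  have Fs: "subfield F \<Omega>" unfolding F_def using generate_field_is_subfield[OF F_carrier] .
  have E's: "subfield E' \<Omega>" unfolding E'_def using generate_field_is_subfield[OF E'_carrier] .
  have Ls: "subfield L \<Omega>" unfolding L_eq using generate_field_is_subfield[OF L_carrier] .
  have Es: "subfield E \<Omega>"
  proof -
    have "subring E \<Omega>" unfolding E_def
      using subring_inter subfieldE(1)[OF subfield_ab_field] subfieldE(1)[OF Ls] .
    then show ?thesis
      using subring_is_subfield prime_field_subset[OF subfield_ab_field] prime_field_subset[OF Ls]
      by (simp add: E_def)
  qed
  have FE': "F \<subseteq> E'"
    unfolding F_def E'_def using KiKK[OF rr(1)] E'_carrier by (intro mono_generate_field) auto
  have kF: "k \<subseteq> F" unfolding F_def using Ki(2)[OF rr(1)] by (auto intro: generate_field.incl)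
  have FE: "F \<subseteq> E"
  proof -
    have "K r \<union> ab_field k \<subseteq> ab_field (K r)"
      using subset_ab_field[OF subfieldE(3)[OF Ki(1)[OF rr(1)]]] ab_field_mono[OF Ki(2)[OF rr(1)]] by blast
    then have "F \<subseteq> ab_field (K r)"
      unfolding F_def using generate_field_min_subfield1[OF F_carrier subfield_ab_field] by blast
    \<comment> \<open>The index 1 occurs in \<open>{1..r - 1}\<close> because
      \<open>2 \<le> r\<close>; through it \<open>L\<close> contains
      \<open>k\<^sup>a\<^sup>b\<close>.\<close>
    moreover have "ab_field k \<subseteq> (\<Union>i\<in>{1..r - 1}. ab_field (K i))"
      using ab_field_mono[OF Ki(2)[OF rr(2)]] assms(3) by force
    then have "F \<subseteq> L"
      unfolding F_def L_eq using L_carrier by (intro mono_generate_field) auto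
    ultimately show ?thesis by (simp add: E_def)
  qed
  have FAut: "f \<in> Aut k" if "f \<in> Aut F" for f using that Aut_anti[OF kF] by blast
  have E'st: "f x \<in> E'" if f: "f \<in> Aut F" and x: "x \<in> E'" for f x
    unfolding E'_def
  proof (rule generate_field_stable[OF E'_carrier Aut_in_Gal[OF f]])
    show "x \<in> generate_field \<Omega> (KK \<union> ab_field k)" using x by (simp add: E'_def)
    fix y assume "y \<in> KK \<union> ab_field k"
    then have "f y \<in> KK \<union> ab_field k"
      using KKst[OF FAut[OF f]] ab_field_stable_self[OF kc FAut[OF f]] by blast
    then show "f y \<in> generate_field \<Omega> (KK \<union> ab_field k)" by (rule generate_field.incl)
  qed

  \<comment> \<open>Finiteness of the group of \<open>E'\<close> over \<open>F\<close>\<close>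
  let ?Q = "Galois_group \<Omega> F E'"
  interpret Q: group ?Q using group_Galois_group[OF subfieldE(1)[OF E's] FE'] .
  \<comment> \<open>\<open>E'\<close> is generated by \<open>KK\<close> and
    \<open>k\<^sup>a\<^sup>b\<close>, and the latter lies in \<open>F\<close>. So an automorphism
    over \<open>F\<close> is determined by its value at \<open>\<eta>\<close>, which ranges over a
    finite orbit.\<close>
  have "inj_on (\<lambda>a. a \<eta>) (carrier ?Q)"
  proof (rule inj_onI)
    fix a b assume a: "a \<in> carrier ?Q" and b: "b \<in> carrier ?Q" and eq: "a \<eta> = b \<eta>"
    obtain f where f: "f \<in> Aut F" "\<And>x. x \<in> E' \<Longrightarrow> f x = a x" using Galois_group_lift[OF E's FE' a] by blast
    obtain g where g: "g \<in> Aut F" "\<And>x. x \<in> E' \<Longrightarrow> g x = b x" using Galois_group_lift[OF E's FE' b] by blast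
    note fG = Aut_in_Gal[OF f(1)] note gG = Aut_in_Gal[OF g(1)]
    have \<eta>E': "\<eta> \<in> E'" unfolding E'_def using \<eta>(1) by (auto intro: generate_field.incl)
    define n where "n = inv\<^bsub>\<G>\<^esub> g \<otimes>\<^bsub>\<G>\<^esub> f"
    have subF: "subgroup (Aut F) \<G>" using subgroup_Aut[OF subfieldE(3)[OF Fs]] .
    have nF: "n \<in> Aut F" unfolding n_def
      using subgroup.m_closed[OF subF subgroup.m_inv_closed[OF subF g(1)] f(1)] .
    have n_apply: "n x = (inv\<^bsub>\<G>\<^esub> g) (f x)" if "x \<in> carrier \<Omega>" for x
      unfolding n_def using Gal_mult_apply[OF G.inv_closed[OF gG] fG that] .
    have "f \<eta> = g \<eta>" using eq f(2)[OF \<eta>E'] g(2)[OF \<eta>E'] by simp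
    then have "n \<eta> = \<eta>" using n_apply[OF \<eta>c] Gal_inv_apply(1)[OF gG \<eta>c] by simp
    then have "n \<in> Aut KK" using \<eta>(2)[OF FAut[OF nF]] by blast
    moreover have "n \<in> Aut (ab_field k)"
      using nF Aut_anti[of "ab_field k" F] by (auto simp: F_def intro: generate_field.incl)
    ultimately have "n \<in> Aut (KK \<union> ab_field k)" by (auto simp: Aut_iff)
    then have nE': "n \<in> Aut E'" unfolding E'_def using Aut_generate_field[OF E'_carrier] by blast
    have "a x = b x" if x: "x \<in> E'" for x
    proof -
      have xc: "x \<in> carrier \<Omega>" using x subfieldE(3)[OF E's] by blast
      have "(inv\<^bsub>\<G>\<^esub> g) (f x) = x" using Aut_fixes[OF nE' x] n_apply[OF xc] by simp
      then have "f x = g x" using Gal_inv_apply(2)[OF gG Gal_closed[OF fG xc]] by simp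
      then show ?thesis using f(2) g(2) x by simp
    qed
    moreover have "a \<in> extensional E'" "b \<in> extensional E'"
      using a b by (auto simp: Galois_group_carrier Bij_def)
    ultimately show "a = b" by (intro extensionalityI)
  qed
  moreover have "(\<lambda>a. a \<eta>) ` carrier ?Q \<subseteq> (\<lambda>f. f \<eta>) ` Aut k"
  proof
    fix z assume "z \<in> (\<lambda>a. a \<eta>) ` carrier ?Q"
    then obtain a where a: "a \<in> carrier ?Q" "z = a \<eta>" by blast
    obtain f where f: "f \<in> Aut F" "\<And>x. x \<in> E' \<Longrightarrow> f x = a x" using Galois_group_lift[OF E's FE' a(1)] by blast
    have "\<eta> \<in> E'" unfolding E'_def using \<eta>(1) by (auto intro: generate_field.incl)
    then have "z = f \<eta>" using f(2) a(2) by simp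
    then show "z \<in> (\<lambda>f. f \<eta>) ` Aut k" using FAut[OF f(1)] by blast
  qed
  ultimately have "finite (carrier ?Q)"
    using finite_Aut_orbit[OF k \<eta>c] by (meson finite_imageD finite_subset)
  then have "annihilates (order ?Q) ?Q"
    using Q.order_gt_0_iff_finite Q.pow_order_eq_1 by (simp add: annihilates_def)
  then have ann: "annihilates (group_exponent ?Q) ?Q" by (rule annihilates_group_exponent)
  define e where "e = group_exponent ?Q"
  have e_pos: "0 < e" using ann by (simp add: e_def annihilates_def)

  \<comment> \<open>Annihilation of the group of \<open>E\<close> over \<open>F\<close>\<close>
  have EG: "group (Galois_group \<Omega> F E)" using group_Galois_group[OF subfieldE(1)[OF Es] FE] .
  have "a [^]\<^bsub>Galois_group \<Omega> F E\<^esub> (e * Lcm D) = \<one>\<^bsub>Galois_group \<Omega> F E\<^esub>"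
    if a: "a \<in> carrier (Galois_group \<Omega> F E)" for a
  proof -
    interpret EG: group "Galois_group \<Omega> F E" by (rule EG)
    obtain f where f: "f \<in> Aut F" "\<And>x. x \<in> E \<Longrightarrow> f x = a x" using Galois_group_lift[OF Es FE a] by blast
    note fG = Aut_in_Gal[OF f(1)]
    \<comment> \<open>\<open>f\<close> preserves \<open>E'\<close>, so its restriction lies in
      \<open>?Q\<close>, whose exponent is \<open>e\<close>.\<close>
    have fe_fixes: "(f ^^ e) x = x" if x: "x \<in> E'" for x
    proof -
      have fQ: "restrict f E' \<in> carrier ?Q"
        by (rule Aut_restrict[OF E's FE' _ f(1)]) (rule E'st)
      have "restrict f E' [^]\<^bsub>?Q\<^esub> e = \<one>\<^bsub>?Q\<^esub>" using ann fQ by (simp add: annihilates_def e_def)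
      then have "(restrict f E' ^^ e) x = x"
        using Galois_group_pow[OF subfieldE(1)[OF E's] FE' fQ x, of e] x by (simp add: Galois_group_one)
      moreover have "(restrict f E' ^^ n) x = (f ^^ n) x \<and> (f ^^ n) x \<in> E'" for n
        using x E'st[OF f(1)] by (induction n) auto
      ultimately show ?thesis by simp
    qed
    define h where "h = f [^]\<^bsub>\<G>\<^esub> e"
    have hG: "h \<in> carrier \<G>" unfolding h_def using fG by simp
    have h_apply: "h x = (f ^^ e) x" if "x \<in> carrier \<Omega>" for x
      unfolding h_def using Galois_group_pow[OF carrier_is_subring _ fG that, of e] by simp
    have h_fixes: "h x = x" if "x \<in> KK \<union> ab_field k" for x
    proof -
      have "x \<in> E'" unfolding E'_def using that by (rule generate_field.incl)
      then show ?thesis using fe_fixes h_apply E'_carrier that by auto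
    qed
    have hKK: "h \<in> Aut KK" using hG h_fixes by (simp add: Aut_mem_iff)
    obtain P where P: "P \<in> Aut KK" "\<And>M x. M \<in> K ` {1..r - 1} \<Longrightarrow> x \<in> ab_field M \<Longrightarrow> P x = x"
      "\<And>x. x \<in> ab_field (K r) \<Longrightarrow> P x = (h ^^ card ((\<lambda>f. f \<eta>) ` Aut (K r))) x"
    proof (rule exists_norm_automorphism[OF k Ki(1)[OF rr(1)] KK KiKK[OF rr(1)] Ki(2)[OF rr(1)] _ \<eta>(1) _ hKK,
          where \<M> = "K ` {1..r - 1}"])
      show "f x \<in> KK" if "f \<in> Aut k" "x \<in> KK" for f x using KKst that by blast
      show "f \<in> Aut KK" if "f \<in> Aut (K r)" "f \<eta> = \<eta>" for f using \<eta>i[OF rr(1)] that by blast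
      show "h x = x" if "x \<in> ab_field k" for x using h_fixes that by blast
      show "subfield M \<Omega> \<and> M \<inter> K r = k \<and> M \<subseteq> KK \<and> finite_dimension k M" if M: "M \<in> K ` {1..r - 1}" for M
      proof -
        obtain i where i: "i \<in> {1..r - 1}" "M = K i" using M by blast
        then have "i \<in> {1..r}" "i \<noteq> r" by auto
        then show ?thesis using Ki KiKK assms(6) rr(1) i(2) by blast
      qed
      show "f x \<in> M" if "M \<in> K ` {1..r - 1}" "f \<in> Aut k" "x \<in> M" for M f x
        using Kst that by force
    qed blast
    \<comment> \<open>\<open>K r\<close> is fixed because \<open>P\<close> fixes \<open>KK\<close>,
      the other generators of \<open>L\<close> by the choice of \<open>P\<close>.\<close>
    have PL: "P \<in> Aut L"
    proof -
      have "P \<in> Aut (K r \<union> (\<Union>i\<in>{1..r - 1}. ab_field (K i)))"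
        using P(1,2) KiKK[OF rr(1)] by (auto simp: Aut_mem_iff)
      then show ?thesis unfolding L_eq using Aut_generate_field[OF L_carrier] by blast
    qed
    \<comment> \<open>On \<open>E\<close> both descriptions of \<open>P\<close> apply: the identity
      inside \<open>L\<close>, and \<open>h ^^ m\<close> inside
      \<open>ab_field (K r)\<close>.\<close>
    have hm: "(h ^^ m) x = x" if x: "x \<in> E" for x
      using P(3)[of x] Aut_fixes[OF PL, of x] x dimKK[OF rr(1)] by (simp add: E_def m_def)
    have iter: "(h ^^ n) x = (f ^^ (e * n)) x \<and> (f ^^ (e * n)) x \<in> carrier \<Omega>" if x: "x \<in> carrier \<Omega>" for n x
    proof (induction n)
      case 0
      then show ?case using x by simp
    next
      case (Suc n)
      have "h ((f ^^ (e * n)) x) = (f ^^ e) ((f ^^ (e * n)) x)" using h_apply Suc by blast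
      moreover have "h ((f ^^ (e * n)) x) \<in> carrier \<Omega>" using Gal_closed[OF hG] Suc by blast
      ultimately show ?case using Suc by (simp add: funpow_add)
    qed
    have aE: "a x \<in> E" if "x \<in> E" for x
      using a that by (auto simp: Galois_group_carrier dest: Bij_imp_funcset)
    have fa: "(f ^^ n) x = (a ^^ n) x \<and> (a ^^ n) x \<in> E" if "x \<in> E" for n x
      using that f(2) aE by (induction n) auto
    have aem: "(a ^^ (e * m)) x = x" if x: "x \<in> E" for x
      using hm[OF x] iter[of x m] fa[OF x, of "e * m"] x subfieldE(3)[OF Es] by auto
    \<comment> \<open>Passing from \<open>m\<close> to the least common multiple merely iterates the
      identity on \<open>E\<close>.\<close>
    obtain q where q: "Lcm D = m * q" using m_dvd by blast
    have "((a ^^ (e * m)) ^^ n) x = x" if "x \<in> E" for n x using aem[OF that] by (induction n) auto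
    then have "(a ^^ (e * Lcm D)) x = x" if "x \<in> E" for x
      using that unfolding q by (simp add: funpow_mult mult.assoc)
    then have "(a [^]\<^bsub>Galois_group \<Omega> F E\<^esub> (e * Lcm D)) x = x" if "x \<in> E" for x
      using that Galois_group_pow[OF subfieldE(1)[OF Es] FE a that] by simp
    moreover have "a [^]\<^bsub>Galois_group \<Omega> F E\<^esub> (e * Lcm D) \<in> extensional E"
      using EG.nat_pow_closed[OF a, of "e * Lcm D"] by (simp add: Galois_group_carrier Bij_def)
    ultimately show ?thesis
      unfolding Galois_group_one by (intro extensionalityI[of _ E]) auto
  qed
  then have "annihilates (e * Lcm D) (Galois_group \<Omega> F E)"
    using e_pos Lcm_pos by (simp add: annihilates_def)
  then show ?thesis
    unfolding e_def F_def E'_def E_def D_def ab_eq(1) ab_eq(2)[OF rr(1)] .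
qed

end
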